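(* Every generalized radical noetherian group is polycyclic-by-finite. Consequently, every generalized radical noetherian group can be embedded into $\mathrm{GL}_n(\mathbb{Z})$ for some $n\ge 1$.
   Context: A group is noetherian if it satisfies the maximal condition on subgroups (equivalently, all its subgroups are finitely generated). A group is generalized radical if it has an ascending (possibly transfinite) normal series, starting at $1$ and ending at the group (with unions at limit ordinals), each of whose factors is locally nilpotent or locally finite. A group is polycyclic-by-finite if it has a polycyclic normal subgroup of finite index. *)

theory Defs
  imports "HOL-Algebra.Elementary_Groups" "Jordan_Normal_Form.Matrix"
begin

definition noetherian_group :: "('a, 'b) monoid_scheme \<Rightarrow> bool" where
  "noetherian_group G \<longleftrightarrow>
     (\<forall>\<S>. \<S> \<subseteq> {H. subgroup H G} \<and> \<S> \<noteq> {} \<longrightarrow> (\<exists>M\<in>\<S>. \<forall>H\<in>\<S>. M \<subseteq> H \<longrightarrow> H = M))"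

definition group_center :: "('a, 'b) monoid_scheme \<Rightarrow> 'a set" where
  "group_center G = {z \<in> carrier G. \<forall>g\<in>carrier G. z \<otimes>\<^bsub>G\<^esub> g = g \<otimes>\<^bsub>G\<^esub> z}"

text \<open>Existence of a finite central series.\<close>

definition nilpotent_group :: "('a, 'b) monoid_scheme \<Rightarrow> bool" where
  "nilpotent_group G \<longleftrightarrow>
     (\<exists>(n::nat) H. H 0 = {\<one>\<^bsub>G\<^esub>} \<and> H n = carrier G \<and> (\<forall>i\<le>n. H i \<lhd> G) \<and>
        (\<forall>i<n. H i \<subseteq> H (Suc i) \<and>
           carrier (G\<lparr>carrier := H (Suc i)\<rparr> Mod H i) \<subseteq> group_center (G Mod H i)))"

definition locally_nilpotent_group :: "('a, 'b) monoid_scheme \<Rightarrow> bool" where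
  "locally_nilpotent_group G \<longleftrightarrow>
     (\<forall>S. finite S \<and> S \<subseteq> carrier G \<longrightarrow> nilpotent_group (subgroup_generated G S))"

definition locally_finite_group :: "('a, 'b) monoid_scheme \<Rightarrow> bool" where
  "locally_finite_group G \<longleftrightarrow>
     (\<forall>S. finite S \<and> S \<subseteq> carrier G \<longrightarrow> finite (carrier (subgroup_generated G S)))"

definition polycyclic_group :: "('a, 'b) monoid_scheme \<Rightarrow> bool" where
  "polycyclic_group G \<longleftrightarrow>
     (\<exists>(n::nat) H. H 0 = {\<one>\<^bsub>G\<^esub>} \<and> H n = carrier G \<and> (\<forall>i\<le>n. subgroup (H i) G) \<and>
        (\<forall>i<n. H i \<lhd> G\<lparr>carrier := H (Suc i)\<rparr> \<and>
           cyclic_group (G\<lparr>carrier := H (Suc i)\<rparr> Mod H i)))"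

definition polycyclic_by_finite_group :: "('a, 'b) monoid_scheme \<Rightarrow> bool" where
  "polycyclic_by_finite_group G \<longleftrightarrow>
     (\<exists>N. N \<lhd> G \<and> polycyclic_group (G\<lparr>carrier := N\<rparr>) \<and> finite (carrier (G Mod N)))"

text \<open>A well-order \<open>r\<close> plays the role of the ordinals up to and including the length of a series.
  An element \<open>j\<close> is the successor of \<open>i\<close> iff the elements strictly below \<open>j\<close> are those up to
  and including \<open>i\<close>.\<close>

definition is_succ :: "'i rel \<Rightarrow> 'i \<Rightarrow> 'i \<Rightarrow> bool" where
  "is_succ r i j \<longleftrightarrow> i \<in> Field r \<and> j \<in> Field r \<and> underS r j = under r i"

definition is_limit :: "'i rel \<Rightarrow> 'i \<Rightarrow> bool" where
  "is_limit r j \<longleftrightarrow> j \<in> Field r \<and> underS r j \<noteq> {} \<and> (\<nexists>i. is_succ r i j)"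

text \<open>Normal series in the strict sense: every term is normal in the whole group.\<close>

definition ascending_normal_series ::
    "('a, 'b) monoid_scheme \<Rightarrow> 'i rel \<Rightarrow> ('i \<Rightarrow> 'a set) \<Rightarrow> bool" where
  "ascending_normal_series G r H \<longleftrightarrow>
     Well_order r \<and>
     (\<forall>i\<in>Field r. H i \<lhd> G) \<and>
     (\<forall>i j. (i, j) \<in> r \<longrightarrow> H i \<subseteq> H j) \<and>
     (\<forall>i\<in>Field r. underS r i = {} \<longrightarrow> H i = {\<one>\<^bsub>G\<^esub>}) \<and>
     (\<forall>j. is_limit r j \<longrightarrow> H j = (\<Union>i\<in>underS r j. H i)) \<and>
     (\<exists>l\<in>Field r. (\<forall>i\<in>Field r. (i, l) \<in> r) \<and> H l = carrier G)"

definition factors_locally_nilpotent_or_finite ::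
    "('a, 'b) monoid_scheme \<Rightarrow> 'i rel \<Rightarrow> ('i \<Rightarrow> 'a set) \<Rightarrow> bool" where
  "factors_locally_nilpotent_or_finite G r H \<longleftrightarrow>
     (\<forall>i j. is_succ r i j \<longrightarrow>
        locally_nilpotent_group (G\<lparr>carrier := H j\<rparr> Mod H i) \<or>
        locally_finite_group (G\<lparr>carrier := H j\<rparr> Mod H i))"

text \<open>An existential quantifier cannot range over index types. Indexing by \<^typ>\<open>'a set\<close> is no loss
  of generality, see \<open>generalized_radicalI\<close> below.\<close>

definition generalized_radical :: "('a, 'b) monoid_scheme \<Rightarrow> bool" where
  "generalized_radical G \<longleftrightarrow>
     (\<exists>(r :: 'a set rel) H. ascending_normal_series G r H \<and>
        factors_locally_nilpotent_or_finite G r H)"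

text \<open>Dropping repeated terms turns a series over an arbitrary index type into one that is
  indexed by its own terms, ordered by inclusion.\<close>

lemma generalized_radicalI:
  fixes G :: "('a, 'b) monoid_scheme" and r :: "'i rel" and H :: "'i \<Rightarrow> 'a set"
  assumes ser: "ascending_normal_series G r H"
    and fac: "factors_locally_nilpotent_or_finite G r H"
  shows "generalized_radical G"
proof -
  have wo: "Well_order r" and nrm: "\<And>i. i \<in> Field r \<Longrightarrow> H i \<lhd> G"
    and mono: "\<And>i j. (i, j) \<in> r \<Longrightarrow> H i \<subseteq> H j"
    and zero: "\<And>i. i \<in> Field r \<Longrightarrow> underS r i = {} \<Longrightarrow> H i = {\<one>\<^bsub>G\<^esub>}"
    and lim: "\<And>j. is_limit r j \<Longrightarrow> H j = (\<Union>i\<in>underS r j. H i)"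
    using ser unfolding ascending_normal_series_def by auto
  obtain l where l: "l \<in> Field r" "\<And>i. i \<in> Field r \<Longrightarrow> (i, l) \<in> r" "H l = carrier G"
    using ser unfolding ascending_normal_series_def by auto
  interpret w: wo_rel r by (simp add: wo_rel_def wo)
  have tot: "(i, j) \<in> r \<or> (j, i) \<in> r" if "i \<in> Field r" "j \<in> Field r" for i j
    using that w.TOTALS by blast
  have below: "(i, j) \<in> r \<and> i \<noteq> j" if "i \<in> Field r" "j \<in> Field r" "H i \<subset> H j" for i j
    using that tot mono by blast
  define C where "C = H ` Field r"
  define s where "s = {(A, B). A \<in> C \<and> B \<in> C \<and> A \<subseteq> B}"
  have FieldS: "Field s = C" unfolding s_def Field_def by auto
  have "\<exists>i\<in>Field r. H i = B \<and> (\<forall>k\<in>underS r i. H k \<subset> B)" if "B \<in> C" for B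
  proof -
    let ?K = "{i \<in> Field r. H i = B}"
    have ne: "?K \<subseteq> Field r" "?K \<noteq> {}" using that unfolding C_def by auto
    define i where "i = w.minim ?K"
    have i: "i \<in> ?K" unfolding i_def using ne by (rule w.minim_in)
    have least: "(i, k) \<in> r" if "k \<in> ?K" for k
      unfolding i_def using ne(1) that by (rule w.minim_least)
    have "H k \<subset> B" if k: "k \<in> underS r i" for k
    proof -
      have *: "k \<noteq> i" "(k, i) \<in> r" using k by (auto simp: underS_def)
      then have "H k \<subseteq> B" "k \<in> Field r" using mono i by (auto simp: Field_def)
      moreover have "H k \<noteq> B"
        using least[of k] * \<open>k \<in> Field r\<close> w.ANTISYM by (auto simp: antisym_def)
      ultimately show ?thesis by blast
    qed
    with i show ?thesis by blast
  qed
  then obtain f where f: "\<And>B. B \<in> C \<Longrightarrow> f B \<in> Field r" "\<And>B. B \<in> C \<Longrightarrow> H (f B) = B"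
      "\<And>B k. B \<in> C \<Longrightarrow> k \<in> underS r (f B) \<Longrightarrow> H k \<subset> B"
    by metis
  have underSC: "k \<in> Field r \<and> H k \<in> underS s B" if "B \<in> C" "k \<in> underS r (f B)" for B k
  proof -
    have "k \<in> Field r" using that(2) by (auto simp: underS_def Field_def)
    then show ?thesis using that f(3)[OF that] by (auto simp: underS_def s_def C_def)
  qed
  have chain: "A \<subseteq> B \<or> B \<subseteq> A" if "A \<in> C" "B \<in> C" for A B
    using that tot mono unfolding C_def by blast
  have "wf (s - Id)"
  proof (rule wf_subset)
    show "wf (inv_image (r - Id) f)" using wo unfolding well_order_on_def by auto
    show "s - Id \<subseteq> inv_image (r - Id) f"
    proof
      fix p assume p: "p \<in> s - Id"
      obtain A B where [simp]: "p = (A, B)" by force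
      have "A \<in> C" "B \<in> C" "A \<subset> B" using p by (auto simp: s_def)
      then have "(f A, f B) \<in> r \<and> f A \<noteq> f B" using below f(1,2) by metis
      then show "p \<in> inv_image (r - Id) f" by simp
    qed
  qed
  moreover have "Linear_order s"
    unfolding order_on_defs FieldS
    by (auto simp: refl_on_def trans_def antisym_def total_on_def s_def dest: chain)
  ultimately have woS: "Well_order s" by (simp add: well_order_on_def)

  have zeroS: "B = {\<one>\<^bsub>G\<^esub>}" if "B \<in> C" "underS s B = {}" for B
    using zero[OF f(1)[OF that(1)]] underSC[OF that(1)] f(2) that by auto
  have succ_case: "is_succ s (H k) B" if B: "B \<in> C" and k: "is_succ r k (f B)" for B k
  proof -
    have kf: "k \<in> Field r" and eq: "underS r (f B) = under r k" using k by (auto simp: is_succ_def)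
    have "k \<in> under r k" using kf w.REFL by (auto simp: refl_on_def under_def)
    then have lt: "H k \<subset> B" using f(3)[OF B] eq by blast
    have "underS s B = under s (H k)"
    proof (intro equalityI subsetI)
      fix A assume "A \<in> underS s B"
      then have A: "A \<in> C" "A \<subset> B" by (auto simp: underS_def s_def)
      have "f A \<in> underS r (f B)" using below[of "f A" "f B"] f(1,2) A B by (auto simp: underS_def)
      then have "(f A, k) \<in> r" using eq by (auto simp: under_def)
      then have "A \<subseteq> H k" using mono f(2) A by metis
      then show "A \<in> under s (H k)" using A kf by (auto simp: under_def s_def C_def)
    next
      fix A assume "A \<in> under s (H k)"
      then show "A \<in> underS s B" using lt B by (auto simp: under_def underS_def s_def)
    qed
    then show ?thesis using kf B by (auto simp: is_succ_def FieldS C_def)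
  qed
  have limS: "B = (\<Union>A\<in>underS s B. A)" if L: "is_limit s B" for B
  proof -
    have B: "B \<in> C" "underS s B \<noteq> {}" "\<nexists>A. is_succ s A B"
      using L by (auto simp: is_limit_def FieldS)
    obtain A where "A \<in> C" "A \<subset> B" using B(2) by (auto simp: underS_def s_def)
    then have "f A \<in> underS r (f B)" using below[of "f A" "f B"] f(1,2) B by (auto simp: underS_def)
    then have "is_limit r (f B)" using f(1) B succ_case by (auto simp: is_limit_def)
    then have "B = (\<Union>i\<in>underS r (f B). H i)" using lim f(2) B(1) by metis
    then have "B \<subseteq> (\<Union>A\<in>underS s B. A)" using underSC[OF B(1)] by blast
    moreover have "(\<Union>A\<in>underS s B. A) \<subseteq> B" by (auto simp: underS_def s_def)
    ultimately show ?thesis by blast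
  qed
  have succS: "\<exists>k. is_succ r k (f B) \<and> H k = A" if S: "is_succ s A B" for A B
  proof -
    have A: "A \<in> C" "B \<in> C" "underS s B = under s A" using S by (auto simp: is_succ_def FieldS)
    have "A \<in> under s A" using A by (auto simp: under_def s_def)
    then have lt: "A \<subset> B" using A(3) by (auto simp: underS_def s_def)
    then have fA: "f A \<in> underS r (f B)" 
      using below[of "f A" "f B"] f(1,2) A by (auto simp: underS_def)
    have leA: "H k \<subseteq> A" if "k \<in> underS r (f B)" for k
      using underSC[OF A(2) that] A(3) by (auto simp: under_def s_def)
    have "\<not> is_limit r (f B)"
    proof
      assume "is_limit r (f B)"
      then have "B = (\<Union>i\<in>underS r (f B). H i)" using lim f(2) A(2) by metis
      then show False using leA lt by blast
    qed
    then obtain k where k: "is_succ r k (f B)"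
      using fA f(1) A(2) by (auto simp: is_limit_def)
    have "is_succ s (H k) B" by (rule succ_case[OF A(2) k])
    then have "under s (H k) = under s A" "H k \<in> C" using A(3) by (auto simp: is_succ_def FieldS)
    then have "H k = A" using A(1) by (auto simp: under_def s_def)
    with k show ?thesis by blast
  qed
  have "ascending_normal_series G s (\<lambda>A. A)"
    unfolding ascending_normal_series_def
  proof (intro conjI ballI allI impI)
    show "Well_order s" by (rule woS)
    show "A \<lhd> G" if "A \<in> Field s" for A using that nrm by (auto simp: FieldS C_def)
    show "A \<subseteq> B" if "(A, B) \<in> s" for A B using that by (auto simp: s_def)
    show "A = {\<one>\<^bsub>G\<^esub>}" if "A \<in> Field s" "underS s A = {}" for A using that zeroS FieldS by auto
    show "B = (\<Union>A\<in>underS s B. A)" if "is_limit s B" for B by (rule limS[OF that])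
    show "\<exists>L\<in>Field s. (\<forall>A\<in>Field s. (A, L) \<in> s) \<and> L = carrier G"
    proof (intro bexI conjI ballI)
      show "H l = carrier G" by (rule l(3))
      show "H l \<in> Field s" using l(1) by (auto simp: FieldS C_def)
      show "(A, H l) \<in> s" if "A \<in> Field s" for A
      proof -
        obtain k where "k \<in> Field r" "A = H k" using \<open>A \<in> Field s\<close> unfolding FieldS C_def by blast
        then show ?thesis using l(1) l(2)[of k] mono[of k l] by (auto simp: s_def C_def)
      qed
    qed
  qed
  moreover have "factors_locally_nilpotent_or_finite G s (\<lambda>A. A)"
    unfolding factors_locally_nilpotent_or_finite_def
  proof (intro allI impI)
    fix A B assume S: "is_succ s A B"
    then obtain k where k: "is_succ r k (f B)" "H k = A" using succS by blast
    have "H (f B) = B" using S f(2) by (auto simp: is_succ_def FieldS)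
    then show "locally_nilpotent_group (G\<lparr>carrier := B\<rparr> Mod A) \<or>
               locally_finite_group (G\<lparr>carrier := B\<rparr> Mod A)"
      using fac k unfolding factors_locally_nilpotent_or_finite_def by metis
  qed
  ultimately show ?thesis unfolding generalized_radical_def by blast
qed

definition GL_int :: "nat \<Rightarrow> int mat monoid" where
  "GL_int n = units_of (ring_mat TYPE(int) n ())"

end

theory Submission
  imports Defs "HOL-Computational_Algebra.Polynomial"
begin

text \<open>The passage from \<open>G\<close> to polycyclic-by-finite is formal: by the maximal condition the given
  series may be taken finite, a finitely generated locally finite group is finite, and a finitely
  generated nilpotent group is polycyclic.

  A noetherian polycyclic-by-finite group \<open>H\<close> is embedded into some \<open>GL\<^sub>n(\<int>)\<close> as follows.
  Some subgroup of finite index is nilpotent-by-abelian (Mal'cev). To pass from \<open>N\<close> to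
  \<open>N\<langle>t\<rangle>\<close> one refines a central series of the nilpotent kernel by sections on which \<open>\<int>N\<close> acts
  through an integral domain. The conjugates of \<open>x \<in> N\<close> under powers of \<open>t\<close> act as
  roots of one monic polynomial, and a domain contains only finitely many of those, so by pigeonhole
  a power of \<open>t\<close> centralises \<open>N\<close> modulo a nilpotent normal subgroup.

  For a nilpotent-by-abelian \<open>M\<close> consider the integer valued functions on \<open>M\<close> with right
  translation. Those annihilated by all \<open>k\<close>-fold products of the operators \<open>d - 1\<close>, \<open>d\<close> in
  the nilpotent kernel, and \<open>p(s)\<close>, \<open>s\<close> in a finite set of coset generators and \<open>p\<close> monic,
  form an invariant module that restricts injectively to a finite set, hence a lattice. It is kept
  faithful while the group grows by one infinite cyclic factor \<open>\<langle>t\<rangle>\<close> at a time, because a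
  function on \<open>N\<close> extends to \<open>\<langle>t\<rangle>N\<close> as one that is invariant under left translation by
  \<open>t\<close>, while the exponent of \<open>t\<close> is itself a function killed by second differences. Inducing
  from \<open>M\<close> to \<open>H\<close> and choosing a basis gives the matrices.

  Groups are written additively, although they need not be commutative.\<close>

section \<open>Subgroups of additively written groups\<close>

text \<open>The sections on which \<int>N acts through a domain stand in for the eigenspaces of the
  classical triangularisation: an operator is zero or injective there, which is all that root
  counting and the detection of unipotent elements need. The obstacle is that their chain is stable
  under \<open>N\<close> but not under \<open>t\<close>. So the monic polynomial is found on factors
  of the upper central series, which \<open>t\<close> does preserve, and the nilpotent normal
  subgroup is defined by unipotent action, without mention of the chain. In the second half every
  cyclic factor must be infinite, or else the exponent of \<open>t\<close> would not be an integer
  valued function. Left invariance under \<open>t\<close> fits badly with right differences: inside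
  the nilpotent kernel an extended function may have a higher degree, which a weight count bounds.
  Above the kernel no degree is bounded; but left invariant functions are determined by their values
  on \<open>N\<close>, hence still form a lattice, and so \<open>t\<close> satisfies a monic
  polynomial on them. This is why the filtration mixes differences with polynomials
  \<open>p(s)\<close>.\<close>

lemmas group_word_simps = diff_conv_add_uminus minus_add add.assoc

definition subgp :: "'g::group_add set \<Rightarrow> bool" where
  "subgp H \<longleftrightarrow> 0 \<in> H \<and> (\<forall>x\<in>H. \<forall>y\<in>H. x + y \<in> H) \<and> (\<forall>x\<in>H. - x \<in> H)"

definition conjg :: "'g::group_add \<Rightarrow> 'g \<Rightarrow> 'g" where
  "conjg x y = x + y - x"

definition comm :: "'g::group_add \<Rightarrow> 'g \<Rightarrow> 'g" where
  "comm x y = x + y - x - y"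

definition imul :: "int \<Rightarrow> 'g::group_add \<Rightarrow> 'g" where
  "imul z x = (if 0 \<le> z then ((+) x ^^ nat z) 0 else - (((+) x ^^ nat (- z)) 0))"

definition gen :: "'g::group_add set \<Rightarrow> 'g set" where
  "gen S = \<Inter> {H. subgp H \<and> S \<subseteq> H}"

lemma subgpI:
  "0 \<in> H \<Longrightarrow> (\<And>x y. x \<in> H \<Longrightarrow> y \<in> H \<Longrightarrow> x + y \<in> H) \<Longrightarrow> (\<And>x. x \<in> H \<Longrightarrow> - x \<in> H) \<Longrightarrow> subgp H"
  by (auto simp: subgp_def)

lemma subgp_zero: "subgp H \<Longrightarrow> 0 \<in> H"
  and subgp_add: "subgp H \<Longrightarrow> x \<in> H \<Longrightarrow> y \<in> H \<Longrightarrow> x + y \<in> H"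
  and subgp_minus: "subgp H \<Longrightarrow> x \<in> H \<Longrightarrow> - x \<in> H"
  by (auto simp: subgp_def)

lemma subgp_diff: "subgp H \<Longrightarrow> x \<in> H \<Longrightarrow> y \<in> H \<Longrightarrow> x - y \<in> H"
  by (metis add_uminus_conv_diff subgp_add subgp_minus)

lemma subgp_add_iff: "subgp H \<Longrightarrow> x \<in> H \<Longrightarrow> x + y \<in> H \<longleftrightarrow> y \<in> H"
  by (metis minus_add_cancel subgp_add subgp_minus)

lemma subgp_add_iff': "subgp H \<Longrightarrow> y \<in> H \<Longrightarrow> x + y \<in> H \<longleftrightarrow> x \<in> H"
  by (metis add_diff_cancel subgp_add subgp_diff)

lemma subgp_minus_iff: "subgp H \<Longrightarrow> - x \<in> H \<longleftrightarrow> x \<in> H"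
  by (metis minus_minus subgp_minus)

lemma subgp_diff_swap: "subgp H \<Longrightarrow> x - y \<in> H \<longleftrightarrow> y - x \<in> H"
  by (metis minus_diff_eq subgp_minus)

lemma subgp_trivial [simp]: "subgp {0}"
  by (auto simp: subgp_def)

lemma subgp_Int: "subgp H \<Longrightarrow> subgp K \<Longrightarrow> subgp (H \<inter> K)"
  by (auto simp: subgp_def)

lemma subgp_Inter: "(\<And>H. H \<in> \<A> \<Longrightarrow> subgp H) \<Longrightarrow> subgp (\<Inter>\<A>)"
  by (auto simp: subgp_def)

lemma subgp_gen [simp]: "subgp (gen S)"
  unfolding gen_def by (rule subgp_Inter) auto

lemma gen_superset: "S \<subseteq> gen S"
  unfolding gen_def by auto

lemma gen_incl: "s \<in> S \<Longrightarrow> s \<in> gen S"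
  using gen_superset by blast

lemma gen_least: "subgp H \<Longrightarrow> S \<subseteq> H \<Longrightarrow> gen S \<subseteq> H"
  unfolding gen_def by auto

lemma gen_mono: "S \<subseteq> T \<Longrightarrow> gen S \<subseteq> gen T"
  by (meson gen_least gen_superset order_trans subgp_gen)

text \<open>\<open>gen S\<close> is an intersection, not a set of words. The \<open>y\<close> such
  that adding or subtracting \<open>y\<close> on the right preserves \<open>P\<close> throughout
  \<open>gen S\<close> form a subgroup containing \<open>S\<close>.\<close>

lemma gen_induct_right:
  assumes x: "x \<in> gen S" and zero: "P 0"
    and step: "\<And>x s. x \<in> gen S \<Longrightarrow> P x \<Longrightarrow> s \<in> S \<Longrightarrow> P (x + s) \<and> P (x - s)"
  shows "P x"
proof -
  define K where "K = {y \<in> gen S. \<forall>x\<in>gen S. P x \<longrightarrow> P (x + y) \<and> P (x - y)}"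
  have "subgp K"
  proof (rule subgpI)
    show "0 \<in> K" by (auto simp: K_def subgp_zero)
    show "a + b \<in> K" if "a \<in> K" "b \<in> K" for a b
    proof -
      have "P (x + (a + b)) \<and> P (x - (a + b))" if "x \<in> gen S" "P x" for x
      proof -
        have "x + (a + b) = x + a + b" "x - (a + b) = x - b - a" by (simp_all add: add.assoc diff_add_eq_diff_diff_swap)
        moreover have "x + a \<in> gen S" "x - b \<in> gen S"
          using \<open>a \<in> K\<close> \<open>b \<in> K\<close> that by (auto simp: K_def subgp_add subgp_diff)
        ultimately show ?thesis using \<open>a \<in> K\<close> \<open>b \<in> K\<close> that by (auto simp: K_def)
      qed
      then show ?thesis using that by (auto simp: K_def subgp_add)
    qed
    show "- a \<in> K" if "a \<in> K" for a using that by (auto simp: K_def subgp_minus)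
  qed
  moreover have "S \<subseteq> K" using step by (auto simp: K_def gen_incl)
  ultimately have "x \<in> K" using x gen_least by blast
  then show ?thesis using zero by (auto simp: K_def subgp_zero dest: bspec[of _ _ 0])
qed

section \<open>Conjugation and commutators\<close>

lemma conjg_add: "conjg x (a + b) = conjg x a + conjg x b"
  and conjg_zero [simp]: "conjg x 0 = 0"
  and conjg_minus: "conjg x (- a) = - conjg x a"
  and conjg_diff: "conjg x (a - b) = conjg x a - conjg x b"
  and conjg_conjg: "conjg x (conjg y a) = conjg (x + y) a"
  and conjg_by_zero [simp]: "conjg 0 a = a"
  and conjg_inv [simp]: "conjg (- x) (conjg x a) = a" "conjg x (conjg (- x) a) = a"
  and conjg_add_swap: "conjg x a + x = x + a"
  and conjg_self [simp]: "conjg x x = x"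
  by (simp_all add: conjg_def group_word_simps del: add_uminus_conv_diff)

lemma subgp_conjg: "subgp H \<Longrightarrow> x \<in> H \<Longrightarrow> a \<in> H \<Longrightarrow> conjg x a \<in> H"
  by (simp add: conjg_def subgp_add subgp_diff)

lemma subgp_conjg_image: "subgp H \<Longrightarrow> subgp (conjg x ` H)"
proof -
  assume H: "subgp H"
  then have "conjg x 0 \<in> conjg x ` H" by (intro imageI subgp_zero)
  then show ?thesis
    using H by (auto intro!: subgpI simp flip: conjg_add conjg_minus intro: imageI subgp_add subgp_minus)
qed

text \<open>Both signs are needed: in an infinite group conjugation by \<open>x\<close> may map
  \<open>H\<close> onto a proper subset of itself.\<close>

lemma conjg_image_eq_iff: "conjg x ` H = H \<longleftrightarrow> (\<forall>h\<in>H. conjg x h \<in> H \<and> conjg (- x) h \<in> H)"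
proof
  assume H: "conjg x ` H = H"
  then have "conjg (- x) h \<in> H" if "h \<in> H" for h using that by (metis conjg_inv(1) imageE)
  then show "\<forall>h\<in>H. conjg x h \<in> H \<and> conjg (- x) h \<in> H" using H by blast
next
  assume H: "\<forall>h\<in>H. conjg x h \<in> H \<and> conjg (- x) h \<in> H"
  have "h \<in> conjg x ` H" if "h \<in> H" for h
    by (rule image_eqI[where x = "conjg (- x) h"]) (use that H in simp_all)
  then show "conjg x ` H = H" using H by auto
qed

lemma conjg_image_minus: "conjg x ` H = H \<Longrightarrow> conjg (- x) ` H = H"
  by (simp add: conjg_image_eq_iff)

lemma conjg_image_add: "conjg x ` H = H \<Longrightarrow> conjg y ` H = H \<Longrightarrow> conjg (x + y) ` H = H"
  unfolding conjg_image_eq_iff minus_add conjg_conjg[symmetric] by blast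

lemma conjg_image_self: "subgp H \<Longrightarrow> x \<in> H \<Longrightarrow> conjg x ` H = H"
  by (auto simp: conjg_image_eq_iff subgp_conjg subgp_minus)

lemma comm_conjg: "comm x y = conjg x y - y"
  by (simp add: comm_def conjg_def)

lemma comm_minus: "- comm x y = comm y x"
  by (simp add: comm_def group_word_simps del: add_uminus_conv_diff)

lemma conjg_comm: "conjg a (comm x y) = comm (conjg a x) (conjg a y)"
  by (simp add: comm_def conjg_def group_word_simps del: add_uminus_conv_diff)

lemma comm_zero [simp]: "comm x 0 = 0" "comm 0 x = 0"
  by (simp_all add: comm_def)

lemma comm_add_left: "comm (x + y) a = conjg x (comm y a) + comm x a"
  by (simp add: comm_def conjg_def group_word_simps del: add_uminus_conv_diff)

lemma comm_add_right: "comm x (a + b) = comm x a + conjg a (comm x b)"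
  by (simp add: comm_def conjg_def group_word_simps del: add_uminus_conv_diff)

lemma comm_minus_left: "comm (- x) a = - conjg (- x) (comm x a)"
  by (simp add: comm_def conjg_def group_word_simps del: add_uminus_conv_diff)

lemma comm_minus_right: "comm x (- a) = - conjg (- a) (comm x a)"
  by (simp add: comm_def conjg_def group_word_simps del: add_uminus_conv_diff)

lemma subgp_comm: "subgp H \<Longrightarrow> x \<in> H \<Longrightarrow> y \<in> H \<Longrightarrow> comm x y \<in> H"
  by (simp add: comm_def subgp_add subgp_diff)

section \<open>Integer multiples\<close>

lemma imul_zero [simp]: "imul 0 x = 0"
  and imul_one [simp]: "imul 1 x = x"
  by (simp_all add: imul_def)

lemma imul_succ_nat: "imul (int (Suc n)) x = x + imul (int n) x"
  by (simp add: imul_def nat_add_distrib)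

lemma imul_succ_nat': "imul (int (Suc n)) x = imul (int n) x + x"
proof (induction n)
  case (Suc n)
  have "imul (int (Suc (Suc n))) x = x + (imul (int n) x + x)"
    unfolding imul_succ_nat[of "Suc n"] by (rule arg_cong[OF Suc])
  then show ?case by (simp only: imul_succ_nat[of n] add.assoc)
qed (simp add: imul_succ_nat del: of_nat_Suc)

lemma imul_neg: "imul (- z) x = - imul z x"
  by (cases "z = 0") (auto simp: imul_def)

lemma imul_add_one: "imul (z + 1) x = imul z x + x"
proof (cases z)
  case (nonneg n)
  then show ?thesis using imul_succ_nat'[of n x] by (simp add: add.commute)
next
  case (neg n)
  have "z + 1 = - int n" using neg by auto
  then show ?thesis
    unfolding neg by (simp only: imul_neg imul_succ_nat minus_add add.assoc left_minus add_0_right)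
qed

lemma imul_add_nat: "imul (z + int n) x = imul z x + imul (int n) x"
proof (induction n)
  case (Suc n)
  have "z + int (Suc n) = z + int n + 1" by simp
  then have "imul (z + int (Suc n)) x = imul (z + int n + 1) x" by (rule arg_cong)
  also have "\<dots> = imul z x + imul (int n) x + x" by (simp only: imul_add_one Suc)
  finally show ?case by (simp only: imul_succ_nat' add.assoc)
qed simp

lemma imul_add: "imul (y + z) x = imul y x + imul z x"
proof (cases z)
  case (nonneg n)
  then show ?thesis by (simp add: imul_add_nat)
next
  case (neg n)
  have "imul (y + z + int (Suc n)) x = imul (y + z) x + imul (int (Suc n)) x" by (rule imul_add_nat)
  then have "imul y x = imul (y + z) x - imul z x" using neg by (simp add: imul_neg del: of_nat_Suc)
  then show ?thesis by (metis diff_add_cancel)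
qed

lemma imul_mult: "imul (y * z) x = imul y (imul z x)"
proof -
  have *: "imul (int n * z) x = imul (int n) (imul z x)" for n
    by (induction n) (simp_all add: ring_distribs imul_add)
  show ?thesis
    by (cases y) (use * in \<open>auto simp: imul_neg simp del: of_nat_Suc\<close>)
qed

lemma conjg_imul: "conjg a (imul z x) = imul z (conjg a x)"
proof -
  have *: "conjg a (imul (int n) x) = imul (int n) (conjg a x)" for n
    by (induction n) (simp_all add: imul_succ_nat conjg_add del: of_nat_Suc)
  show ?thesis
    by (cases z) (use * in \<open>auto simp: imul_neg conjg_minus simp del: of_nat_Suc\<close>)
qed

lemma subgp_imul: "subgp H \<Longrightarrow> x \<in> H \<Longrightarrow> imul z x \<in> H"
proof -
  assume H: "subgp H" "x \<in> H"
  have *: "imul (int n) x \<in> H" for n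
    by (induction n) (simp_all add: imul_succ_nat H subgp_zero subgp_add del: of_nat_Suc)
  show ?thesis
    by (cases z) (use * H in \<open>auto simp: imul_neg subgp_minus simp del: of_nat_Suc\<close>)
qed

lemma conjg_image_imul: "conjg x ` H = H \<Longrightarrow> conjg (imul z x) ` H = H"
proof -
  assume H: "conjg x ` H = H"
  have *: "conjg (imul (int n) x) ` H = H" for n
    by (induction n) (auto simp: imul_succ_nat H conjg_image_add simp del: of_nat_Suc)
  show ?thesis
    by (cases z) (use * in \<open>auto simp: imul_neg conjg_image_minus simp del: of_nat_Suc\<close>)
qed

text \<open>The product of \<open>N\<close> and the cyclic group of \<open>t\<close>; it is a
  subgroup once \<open>t\<close> normalises \<open>N\<close>. A nonzero multiple of \<open>t\<close>
  may lie in \<open>N\<close>.\<close>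

definition ext :: "'g::group_add set \<Rightarrow> 'g \<Rightarrow> 'g set" where
  "ext N t = {n + imul z t |n z. n \<in> N}"

lemma ext_iff: "x \<in> ext N t \<longleftrightarrow> (\<exists>n\<in>N. \<exists>z. x = n + imul z t)"
  by (auto simp: ext_def)

lemma subgp_ext:
  assumes N: "subgp N" and t: "conjg t ` N = N"
  shows "subgp (ext N t)"
proof (rule subgpI)
  have inv: "conjg (imul z t) n \<in> N" if "n \<in> N" for n z
    using conjg_image_imul[OF t, of z] that by blast
  show "0 \<in> ext N t" using subgp_zero[OF N] by (metis add.right_neutral ext_iff imul_zero)
  show "x + y \<in> ext N t" if "x \<in> ext N t" "y \<in> ext N t" for x y
  proof -
    obtain n z m w where "n \<in> N" "m \<in> N" "x = n + imul z t" "y = m + imul w t"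
      using \<open>x \<in> ext N t\<close> \<open>y \<in> ext N t\<close> by (auto simp: ext_iff)
    then have "x + y = (n + conjg (imul z t) m) + imul (z + w) t" "n + conjg (imul z t) m \<in> N"
      using inv subgp_add[OF N]
      by (simp_all add: imul_add conjg_def group_word_simps del: add_uminus_conv_diff)
    then show ?thesis by (auto simp: ext_iff)
  qed
  show "- x \<in> ext N t" if "x \<in> ext N t" for x
  proof -
    obtain n z where "n \<in> N" "x = n + imul z t" using \<open>x \<in> ext N t\<close> by (auto simp: ext_iff)
    then have "- x = conjg (imul (- z) t) (- n) + imul (- z) t"
      by (simp add: imul_neg conjg_def group_word_simps del: add_uminus_conv_diff)
    moreover have "conjg (imul (- z) t) (- n) \<in> N" using inv subgp_minus[OF N] \<open>n \<in> N\<close> by blast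
    ultimately have "\<exists>m\<in>N. \<exists>w. - x = m + imul w t" by blast
    then show ?thesis by (auto simp: ext_iff)
  qed
qed

lemma ext_superset: "N \<subseteq> ext N t"
  by (metis add.right_neutral ext_iff imul_zero subsetI)

lemma ext_gen: "subgp N \<Longrightarrow> t \<in> ext N t"
  by (metis add.left_neutral ext_iff imul_one subgp_zero)

lemma ext_subset: "subgp H \<Longrightarrow> N \<subseteq> H \<Longrightarrow> t \<in> H \<Longrightarrow> ext N t \<subseteq> H"
  by (auto simp: ext_iff intro!: subgp_add subgp_imul)

lemma ext_mono: "N \<subseteq> M \<Longrightarrow> ext N t \<subseteq> ext M t"
  unfolding ext_def by blast

section \<open>The maximal condition and subgroups of finite index\<close>

definition noeth :: "'g::group_add set \<Rightarrow> bool" where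
  "noeth G \<longleftrightarrow> subgp G \<and> (\<forall>\<S>. \<S> \<noteq> {} \<and> (\<forall>H\<in>\<S>. subgp H \<and> H \<subseteq> G) \<longrightarrow> (\<exists>M\<in>\<S>. \<forall>H\<in>\<S>. M \<subseteq> H \<longrightarrow> H = M))"

lemma noeth_subgp: "noeth G \<Longrightarrow> subgp G"
  by (simp add: noeth_def)

lemma noeth_maximal:
  assumes "noeth G" "H0 \<in> \<S>" "\<And>H. H \<in> \<S> \<Longrightarrow> subgp H" "\<And>H. H \<in> \<S> \<Longrightarrow> H \<subseteq> G"
  obtains M where "M \<in> \<S>" "\<And>H. H \<in> \<S> \<Longrightarrow> M \<subseteq> H \<Longrightarrow> H = M"
proof -
  have "\<S> \<noteq> {} \<and> (\<forall>H\<in>\<S>. subgp H \<and> H \<subseteq> G)" using assms(2-4) by blast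
  then have "\<exists>M\<in>\<S>. \<forall>H\<in>\<S>. M \<subseteq> H \<longrightarrow> H = M" using assms(1) unfolding noeth_def by simp
  then show ?thesis using that by blast
qed

text \<open>A maximal member among the finitely generated subgroups of \<open>H\<close> absorbs
  every further element of \<open>H\<close>.\<close>

lemma noeth_fg:
  assumes "noeth G" "subgp H" "H \<subseteq> G"
  obtains S where "finite S" "S \<subseteq> H" "gen S = H"
proof -
  let ?A = "gen ` {S. finite S \<and> S \<subseteq> H}"
  have sub: "K \<subseteq> H" if "K \<in> ?A" for K using that gen_least[OF assms(2)] by auto
  obtain M where M: "M \<in> ?A" "\<And>K. K \<in> ?A \<Longrightarrow> M \<subseteq> K \<Longrightarrow> K = M"
  proof (rule noeth_maximal[OF assms(1), of "gen {}" ?A])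
    show "gen {} \<in> ?A" by blast
    show "K \<subseteq> G" if "K \<in> ?A" for K using sub[OF that] assms(3) by blast
  qed auto
  obtain S where S: "M = gen S" "finite S" "S \<subseteq> H" using M(1) by auto
  have "x \<in> M" if "x \<in> H" for x
  proof -
    have "gen (insert x S) = M"
      using S that by (intro M(2)) (auto intro: gen_mono[THEN subsetD])
    then show ?thesis using gen_incl[of x "insert x S"] by auto
  qed
  then show ?thesis using that S sub[OF M(1)] by blast
qed

lemma noeth_chain_stable:
  assumes "noeth G" "\<And>n::nat. subgp (H n)" "\<And>n. H n \<subseteq> G" "\<And>n. H n \<subseteq> H (Suc n)"
  obtains n where "H (Suc n) = H n"
proof -
  obtain M where M: "M \<in> range H" "\<And>K. K \<in> range H \<Longrightarrow> M \<subseteq> K \<Longrightarrow> K = M"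
  proof (rule noeth_maximal[OF assms(1), of "H 0" "range H"])
    show "K \<subseteq> G" if "K \<in> range H" for K using that assms(3) by blast
  qed (use assms(2) in auto)
  obtain n where n: "M = H n" using M(1) by auto
  have "H (Suc n) = M" by (rule M(2)) (use n assms(4) in auto)
  then show thesis using that[of n] n by simp
qed

text \<open>\<open>h - t \<in> K\<close> places \<open>h\<close> in the right coset of
  \<open>t\<close>. \<open>T\<close> only has to meet every coset; several of its elements may share
  one.\<close>

definition fin_index :: "'g::group_add set \<Rightarrow> 'g set \<Rightarrow> bool" where
  "fin_index K H \<longleftrightarrow> subgp K \<and> subgp H \<and> K \<subseteq> H \<and> (\<exists>T. finite T \<and> T \<subseteq> H \<and> (\<forall>h\<in>H. \<exists>t\<in>T. h - t \<in> K))"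

lemma fin_indexD: "fin_index K H \<Longrightarrow> subgp K" "fin_index K H \<Longrightarrow> subgp H" "fin_index K H \<Longrightarrow> K \<subseteq> H"
  by (auto simp: fin_index_def)

lemma fin_indexE:
  assumes "fin_index K H"
  obtains T where "finite T" "T \<subseteq> H" "\<And>h. h \<in> H \<Longrightarrow> \<exists>t\<in>T. h - t \<in> K"
  using assms unfolding fin_index_def by meson

lemma fin_index_refl: "subgp H \<Longrightarrow> fin_index H H"
  by (auto simp: fin_index_def subgp_zero intro!: exI[of _ "{0}"])

lemma fin_index_trans:
  assumes "fin_index K L" "fin_index L H"
  shows "fin_index K H"
proof -
  obtain T where T: "finite T" "T \<subseteq> L" "\<And>h. h \<in> L \<Longrightarrow> \<exists>t\<in>T. h - t \<in> K"
    using fin_indexE[OF assms(1)] by metis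
  obtain U where U: "finite U" "U \<subseteq> H" "\<And>h. h \<in> H \<Longrightarrow> \<exists>t\<in>U. h - t \<in> L"
    using fin_indexE[OF assms(2)] by metis
  let ?V = "(\<lambda>(t, u). t + u) ` (T \<times> U)"
  have "\<exists>v\<in>?V. h - v \<in> K" if "h \<in> H" for h
  proof -
    obtain u where u: "u \<in> U" "h - u \<in> L" using U(3) \<open>h \<in> H\<close> by blast
    obtain t where "t \<in> T" "h - u - t \<in> K" using T(3) u(2) by blast
    then show ?thesis using u(1) by (intro bexI[of _ "t + u"]) (auto simp: diff_add_eq_diff_diff_swap)
  qed
  moreover have "finite ?V" using T(1) U(1) by simp
  moreover have "?V \<subseteq> H"
    using T(2) U(2) fin_indexD(3)[OF assms(2)]
    by (auto intro!: subgp_add[OF fin_indexD(2)[OF assms(2)]])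
  ultimately have "\<exists>T. finite T \<and> T \<subseteq> H \<and> (\<forall>h\<in>H. \<exists>t\<in>T. h - t \<in> K)"
    by (intro exI[of _ ?V] conjI ballI)
  then show ?thesis using assms unfolding fin_index_def by blast
qed

lemma fin_index_Int:
  assumes "fin_index K H" "subgp L"
  shows "fin_index (K \<inter> L) (H \<inter> L)"
proof -
  note K = fin_indexD(1)[OF assms(1)]
  obtain T where T: "finite T" "T \<subseteq> H" "\<And>h. h \<in> H \<Longrightarrow> \<exists>t\<in>T. h - t \<in> K"
    using fin_indexE[OF assms(1)] by metis
  \<comment> \<open>The representatives in \<open>T\<close> need not lie in \<open>L\<close>; each
    coset that meets \<open>H \<inter> L\<close> gets a new one there.\<close>
  define f where "f t = (SOME h. h \<in> H \<inter> L \<and> h - t \<in> K)" for t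
  let ?T = "{t \<in> T. \<exists>h. h \<in> H \<inter> L \<and> h - t \<in> K}"
  have f: "f t \<in> H \<inter> L \<and> f t - t \<in> K" if "t \<in> ?T" for t
    unfolding f_def by (rule someI_ex) (use that in blast)
  have "\<exists>u\<in>f ` ?T. h - u \<in> K \<inter> L" if h: "h \<in> H \<inter> L" for h
  proof -
    obtain t where t: "t \<in> T" "h - t \<in> K" using T(3) h by blast
    then have tT: "t \<in> ?T" using h by blast
    have "h - f t = (h - t) - (f t - t)" by (simp add: group_word_simps del: add_uminus_conv_diff)
    then have "h - f t \<in> K" using f[OF tT] t(2) subgp_diff[OF K] by metis
    moreover have "h - f t \<in> L" using f[OF tT] h subgp_diff[OF assms(2)] by blast
    ultimately show ?thesis using tT by blast
  qed
  moreover have "finite (f ` ?T)" using T(1) by simp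
  moreover have "f ` ?T \<subseteq> H \<inter> L" using f by (intro image_subsetI) blast
  ultimately have "\<exists>T. finite T \<and> T \<subseteq> H \<inter> L \<and> (\<forall>h\<in>H \<inter> L. \<exists>t\<in>T. h - t \<in> K \<inter> L)"
    by (intro exI[of _ "f ` ?T"] conjI ballI)
  moreover have "subgp (K \<inter> L)" "subgp (H \<inter> L)" "K \<inter> L \<subseteq> H \<inter> L"
    using subgp_Int assms(2) fin_indexD[OF assms(1)] by auto
  ultimately show ?thesis unfolding fin_index_def by blast
qed

lemma fin_index_inter:
  assumes "fin_index K H" "fin_index L H"
  shows "fin_index (K \<inter> L) H"
proof -
  have "H \<inter> L = L" using fin_indexD(3)[OF assms(2)] by auto
  then have "fin_index (K \<inter> L) L" using fin_index_Int[OF assms(1) fin_indexD(1)[OF assms(2)]] by simp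
  then show ?thesis using assms(2) by (rule fin_index_trans)
qed

lemma fin_index_Inter:
  assumes "finite \<A>" "subgp H" "\<And>K. K \<in> \<A> \<Longrightarrow> fin_index K H"
  shows "fin_index (H \<inter> \<Inter>\<A>) H"
  using assms(1,3)
proof (induction \<A>)
  case empty
  then show ?case using assms(2) by (simp add: fin_index_refl)
next
  case (insert K \<A>)
  have "fin_index (H \<inter> \<Inter>\<A>) H" "fin_index K H"
    using insert.IH insert.prems by blast+
  then have "fin_index ((H \<inter> \<Inter>\<A>) \<inter> K) H" by (rule fin_index_inter)
  moreover have "(H \<inter> \<Inter>\<A>) \<inter> K = H \<inter> \<Inter>(insert K \<A>)" by blast
  ultimately show ?case by simp
qed

definition index_le :: "nat \<Rightarrow> 'g::group_add set \<Rightarrow> 'g set \<Rightarrow> bool" where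
  "index_le n K H \<longleftrightarrow> subgp K \<and> K \<subseteq> H \<and> (\<exists>T. finite T \<and> card T \<le> n \<and> T \<subseteq> H \<and> (\<forall>h\<in>H. \<exists>t\<in>T. h - t \<in> K))"

text \<open>Several elements of \<open>T\<close> may represent the same coset. Colouring by the
  least suitable index makes the colour depend on the coset alone.\<close>

lemma index_le_colouring:
  assumes "index_le n K H"
  obtains c :: "'g::group_add \<Rightarrow> nat"
  where "\<And>x. x \<in> H \<Longrightarrow> c x < n" "\<And>x y. x \<in> H \<Longrightarrow> y \<in> H \<Longrightarrow> c x = c y \<longleftrightarrow> x - y \<in> K"
proof -
  obtain T where K: "subgp K" and T: "finite T" "card T \<le> n" "\<forall>h\<in>H. \<exists>t\<in>T. h - t \<in> K"
    using assms unfolding index_le_def by auto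
  obtain e where e: "bij_betw e {..<card T} T"
    using T(1) by (metis ex_bij_betw_nat_finite atLeast0LessThan)
  define c where "c x = (LEAST i. i < card T \<and> x - e i \<in> K)" for x
  have c: "c x < card T \<and> x - e (c x) \<in> K" if "x \<in> H" for x
  proof -
    obtain t where "t \<in> T" "x - t \<in> K" using T(3) \<open>x \<in> H\<close> by blast
    then obtain i where "i < card T \<and> x - e i \<in> K"
      using e by (metis bij_betw_iff_bijections lessThan_iff)
    then show ?thesis unfolding c_def by (rule LeastI)
  qed
  have "c x = c y \<longleftrightarrow> x - y \<in> K" if xy: "x \<in> H" "y \<in> H" for x y
  proof
    assume "c x = c y"
    then have "x - e (c x) \<in> K" "y - e (c x) \<in> K" using c[OF xy(1)] c[OF xy(2)] by simp_all
    moreover have "x - y = (x - e (c x)) - (y - e (c x))"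
      by (simp add: group_word_simps del: add_uminus_conv_diff)
    ultimately show "x - y \<in> K" using subgp_diff[OF K] by metis
  next
    assume *: "x - y \<in> K"
    have "x - t \<in> K \<longleftrightarrow> y - t \<in> K" for t
    proof -
      have "x - t = (x - y) + (y - t)" by (simp add: group_word_simps del: add_uminus_conv_diff)
      then show ?thesis using subgp_add_iff[OF K *] by metis
    qed
    then show "c x = c y" unfolding c_def by simp
  qed
  moreover have "c x < n" if "x \<in> H" for x using c[OF that] T(2) by simp
  ultimately show ?thesis using that by blast
qed

text \<open>A subgroup of index at most \<open>n\<close> is recovered from the transition table of the action of
  the generators on its numbered cosets, and there are finitely many such tables.\<close>

lemma finite_index_le:
  assumes S: "finite S" and H: "gen S = H"
  shows "finite {K. index_le n K H}"
proof -
  let ?L = "{K. index_le n K H}" and ?S = "S \<union> uminus ` S"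
  have "\<forall>K\<in>?L. \<exists>c. (\<forall>x\<in>H. c x < n) \<and> (\<forall>x\<in>H. \<forall>y\<in>H. c x = c y \<longleftrightarrow> x - y \<in> K)"
  proof
    fix K assume "K \<in> ?L"
    then have "index_le n K H" by simp
    then show "\<exists>c. (\<forall>x\<in>H. c x < n) \<and> (\<forall>x\<in>H. \<forall>y\<in>H. c x = c y \<longleftrightarrow> x - y \<in> K)"
      by (rule index_le_colouring) blast
  qed
  then obtain c where "\<forall>K\<in>?L. (\<forall>x\<in>H. c K x < n) \<and> (\<forall>x\<in>H. \<forall>y\<in>H. c K x = c K y \<longleftrightarrow> x - y \<in> K)"
    by (rule bchoice[THEN exE])
  then have c: "\<And>K x. K \<in> ?L \<Longrightarrow> x \<in> H \<Longrightarrow> c K x < n"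
    "\<And>K x y. K \<in> ?L \<Longrightarrow> x \<in> H \<Longrightarrow> y \<in> H \<Longrightarrow> c K x = c K y \<longleftrightarrow> x - y \<in> K"
    by blast+
  have HS: "subgp H" "?S \<subseteq> H"
    using H gen_superset[of S] subgp_gen[of S] by (auto intro: subgp_minus)
  define code where
    "code K = (c K 0, {(s, i, j). s \<in> ?S \<and> (\<exists>x\<in>H. i = c K x \<and> j = c K (x + s))})" for K
  have step: "c K (x + s) = c L (x + s)"
    if KL: "K \<in> ?L" "L \<in> ?L" "code K = code L" and x: "x \<in> H" "c K x = c L x" and s: "s \<in> ?S" for K L x s
  proof -
    have "(s, c K x, c K (x + s)) \<in> snd (code K)" using x(1) s unfolding code_def by auto
    then have "(s, c K x, c K (x + s)) \<in> snd (code L)" using KL by simp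
    then obtain y where y: "y \<in> H" "c K x = c L y" "c K (x + s) = c L (y + s)"
      by (auto simp: code_def)
    \<comment> \<open>The table of \<open>L\<close> may record the transition at another element
      \<open>y\<close>, but \<open>y\<close> lies in the coset of \<open>x\<close>, and adding
      \<open>s\<close> on the right respects right cosets.\<close>
    have "x - y \<in> L" using y x c(2)[OF KL(2)] by metis
    moreover have "(x + s) - (y + s) = x - y" by (simp add: group_word_simps del: add_uminus_conv_diff)
    moreover have "x + s \<in> H" "y + s \<in> H" using x y s HS by (auto intro: subgp_add)
    ultimately have "c L (x + s) = c L (y + s)" using c(2)[OF KL(2)] by metis
    then show ?thesis using y by simp
  qed
  have "inj_on code ?L"
  proof (rule inj_onI)
    fix K L assume KL: "K \<in> ?L" "L \<in> ?L" "code K = code L"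
    have eq: "c K x = c L x" if "x \<in> H" for x
    proof -
      have "x \<in> gen S" using that H by simp
      then show ?thesis
      proof (rule gen_induct_right[where P = "\<lambda>x. c K x = c L x"])
        show "c K 0 = c L 0" using KL(3) by (simp add: code_def)
        fix x s assume "x \<in> gen S" "c K x = c L x" "s \<in> S"
        then show "c K (x + s) = c L (x + s) \<and> c K (x - s) = c L (x - s)"
          using step[OF KL, of x s] step[OF KL, of x "- s"] H by auto
      qed
    qed
    have mem: "A = {x \<in> H. c A x = c A 0}" if "A \<in> ?L" for A
      using c(2)[OF that _ subgp_zero[OF HS(1)]] that by (auto simp: index_le_def)
    have "{x \<in> H. c K x = c K 0} = {x \<in> H. c L x = c L 0}"
      using eq subgp_zero[OF HS(1)] by auto
    then show "K = L" using mem[OF KL(1)] mem[OF KL(2)] by simp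
  qed
  moreover have "code ` ?L \<subseteq> {..<n} \<times> Pow (?S \<times> {..<n} \<times> {..<n})"
  proof (rule image_subsetI)
    fix K assume K: "K \<in> ?L"
    show "code K \<in> {..<n} \<times> Pow (?S \<times> {..<n} \<times> {..<n})"
      using c(1)[OF K] subgp_zero[OF HS(1)] subgp_add[OF HS(1)] HS(2)
      unfolding code_def by (simp add: subset_iff) blast
  qed
  moreover have "finite ({..<n} \<times> Pow (?S \<times> {..<n} \<times> {..<n}))" using S by simp
  ultimately show ?thesis by (meson finite_imageD finite_subset)
qed

lemma index_le_conjg:
  assumes "index_le n K H" "conjg x ` H = H"
  shows "index_le n (conjg x ` K) H"
proof -
  obtain T where K: "subgp K" "K \<subseteq> H" and T: "finite T" "card T \<le> n" "T \<subseteq> H" "\<forall>h\<in>H. \<exists>t\<in>T. h - t \<in> K"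
    using assms unfolding index_le_def by auto
  have "\<exists>t\<in>conjg x ` T. h - t \<in> conjg x ` K" if "h \<in> H" for h
  proof -
    have "conjg (- x) h \<in> H" using assms(2) that by (simp add: conjg_image_eq_iff)
    then obtain t where t: "t \<in> T" "conjg (- x) h - t \<in> K" using T(4) by blast
    have "h - conjg x t = conjg x (conjg (- x) h - t)" by (simp add: conjg_diff)
    then show ?thesis using t by blast
  qed
  moreover have "conjg x ` T \<subseteq> H" "conjg x ` K \<subseteq> H" using T(3) K(2) assms(2) by blast+
  ultimately show ?thesis
    using T(1,2) K card_image_le[OF T(1), of "conjg x"] unfolding index_le_def
    by (intro conjI exI[of _ "conjg x ` T"] ballI) (simp_all add: subgp_conjg_image)
qed

text \<open>Finitely many subgroups of \<open>H\<close> have index at most \<open>card T\<close>,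
  and every conjugation that stabilises \<open>H\<close> permutes them, so their intersection is
  stable. It replaces a subgroup of finite index by one that the next generator \<open>t\<close>
  normalises.\<close>

lemma fin_index_core:
  assumes G: "noeth G" "H \<subseteq> G" and K: "fin_index K H"
  obtains K' where "fin_index K' H" "K' \<subseteq> K" "\<And>x. conjg x ` H = H \<Longrightarrow> conjg x ` K' = K'"
proof -
  obtain T where T: "finite T" "T \<subseteq> H" "\<And>h. h \<in> H \<Longrightarrow> \<exists>t\<in>T. h - t \<in> K"
    using fin_indexE[OF K] by metis
  define \<L> where "\<L> = {K. index_le (card T) K H}"
  have "index_le (card T) K H"
    unfolding index_le_def using T fin_indexD[OF K] by (intro conjI exI[of _ T] ballI) simp_all
  then have "K \<in> \<L>" by (simp add: \<L>_def)
  note H = fin_indexD(2)[OF K]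
  obtain S where "finite S" "gen S = H" using noeth_fg[OF G(1) H G(2)] by metis
  then have fin: "finite \<L>" unfolding \<L>_def by (rule finite_index_le)
  have fi: "fin_index L H" if "L \<in> \<L>" for L
  proof -
    have "subgp L" "L \<subseteq> H" "\<exists>T. finite T \<and> T \<subseteq> H \<and> (\<forall>h\<in>H. \<exists>t\<in>T. h - t \<in> L)"
      using that unfolding \<L>_def index_le_def by auto
    then show ?thesis using H unfolding fin_index_def by simp
  qed
  define K' where "K' = H \<inter> \<Inter>\<L>"
  have "conjg x k \<in> K'" if x: "conjg x ` H = H" and k: "k \<in> K'" for x k
  proof -
    have "conjg x k \<in> L" if "L \<in> \<L>" for L
    proof -
      have "conjg (- x) ` L \<in> \<L>" using index_le_conjg[OF _ conjg_image_minus[OF x]] that by (simp add: \<L>_def)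
      then have "k \<in> conjg (- x) ` L" using k by (simp add: K'_def)
      then show ?thesis by auto
    qed
    moreover have "conjg x k \<in> H" using x k by (auto simp: K'_def)
    ultimately show ?thesis by (simp add: K'_def)
  qed
  then have "conjg x ` K' = K'" if "conjg x ` H = H" for x
    using that conjg_image_minus[OF that] by (simp add: conjg_image_eq_iff)
  moreover have "fin_index K' H" unfolding K'_def using fin H fi by (rule fin_index_Inter)
  moreover have "K' \<subseteq> K" using \<open>K \<in> \<L>\<close> by (auto simp: K'_def)
  ultimately show ?thesis using that by blast
qed

lemma conjg_image_Int: "conjg x ` A = A \<Longrightarrow> conjg x ` B = B \<Longrightarrow> conjg x ` (A \<inter> B) = A \<inter> B"
  by (auto simp: conjg_image_eq_iff)

lemma conjg_image_ext: "subgp N \<Longrightarrow> conjg t ` N = N \<Longrightarrow> x \<in> ext N t \<Longrightarrow> conjg x ` N = N"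
  unfolding ext_iff by (metis conjg_image_add conjg_image_self conjg_image_imul)

text \<open>\<open>x - imul z t \<in> N\<close> says that \<open>z\<close> is an exponent of
  \<open>t\<close> in \<open>x\<close> modulo \<open>N\<close>. It is used as a relation because
  \<open>t\<close> may have finite order modulo \<open>N\<close>, and then \<open>z\<close> is not
  unique.\<close>

lemma ext_degree_add:
  assumes N: "subgp N" "conjg t ` N = N" and "x - imul z t \<in> N" "y - imul w t \<in> N"
  shows "x + y - imul (z + w) t \<in> N"
proof -
  have "x + y - imul (z + w) t = (x - imul z t) + conjg (imul z t) (y - imul w t)"
    by (simp add: imul_add conjg_def group_word_simps del: add_uminus_conv_diff)
  moreover have "conjg (imul z t) (y - imul w t) \<in> N"
    using conjg_image_imul[OF N(2), of z] assms(4) by blast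
  ultimately show ?thesis using subgp_add[OF N(1)] assms(3) by simp
qed

lemma ext_degree_minus:
  assumes N: "subgp N" "conjg t ` N = N" and "x - imul z t \<in> N"
  shows "- x - imul (- z) t \<in> N"
proof -
  have "- x - imul (- z) t = conjg (- imul z t) (- (x - imul z t))"
    by (simp add: imul_neg conjg_def group_word_simps del: add_uminus_conv_diff)
  moreover have "conjg (- imul z t) (- (x - imul z t)) \<in> N"
    using conjg_image_minus[OF conjg_image_imul[OF N(2), of z]] subgp_minus[OF N(1) assms(3)] by blast
  ultimately show ?thesis by metis
qed

lemma ext_degree_imul:
  assumes N: "subgp N" "conjg t ` N = N" and x: "x - imul z t \<in> N"
  shows "imul q x - imul (q * z) t \<in> N"
proof -
  have *: "imul (int n) x - imul (int n * z) t \<in> N" for n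
  proof (induction n)
    case (Suc n)
    have "x + imul (int n) x - imul (z + int n * z) t \<in> N" by (rule ext_degree_add[OF N x Suc])
    moreover have "z + int n * z = int (Suc n) * z" by (simp add: algebra_simps)
    ultimately show ?case unfolding imul_succ_nat by (simp only:)
  qed (simp add: subgp_zero N)
  show ?thesis
  proof (cases q)
    case (neg n)
    then show ?thesis using ext_degree_minus[OF N *[of "Suc n"]] by (simp only: imul_neg minus_mult_left)
  qed (use * in auto)
qed

lemma ext_iff_degree: "x \<in> ext N t \<longleftrightarrow> (\<exists>z. x - imul z t \<in> N)"
proof
  show "x \<in> ext N t \<Longrightarrow> \<exists>z. x - imul z t \<in> N" by (auto simp: ext_iff) (metis add_diff_cancel)
  show "\<exists>z. x - imul z t \<in> N \<Longrightarrow> x \<in> ext N t" by (metis diff_add_cancel ext_iff)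
qed

text \<open>The exponents of \<open>t\<close> in elements of \<open>L\<close> form a subgroup of
  \<int>. If a positive one occurs, the least such \<open>d\<close>, attained at \<open>u\<close>,
  divides all others, and subtracting a multiple of \<open>u\<close> leads into
  \<open>N\<close>.\<close>

lemma subgp_ext_cases:
  assumes N: "subgp N" "conjg t ` N = N" and L: "subgp L" "L \<subseteq> ext N t"
  obtains "L \<subseteq> N" | u d where "u \<in> L" "d \<noteq> 0" "u - imul d t \<in> N" "conjg u ` (N \<inter> L) = N \<inter> L" "L = ext (N \<inter> L) u"
proof (cases "\<exists>d>0. \<exists>u\<in>L. u - imul (int d) t \<in> N")
  case False
  have "x \<in> N" if x: "x \<in> L" for x
  proof -
    obtain z where z: "x - imul z t \<in> N" using L(2) x ext_iff_degree by blast
    consider "z = 0" | n where "n > 0" "z = int n" | n where "n > 0" "- z = int n"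
      by (metis int_cases4 minus_minus of_nat_0_less_iff zero_less_imp_eq_int neg_0_less_iff_less linorder_neqE)
    then show ?thesis
    proof cases
      case 1
      then show ?thesis using z by simp
    next
      case 2
      then show ?thesis using False x z by blast
    next
      case 3
      then have "- x \<in> L" "- x - imul (int n) t \<in> N"
        using subgp_minus[OF L(1) x] ext_degree_minus[OF N z] by simp_all
      then show ?thesis using False 3(1) by blast
    qed
  qed
  then show ?thesis using that(1) by blast
next
  case True
  define d where "d = (LEAST d. d > 0 \<and> (\<exists>u\<in>L. u - imul (int d) t \<in> N))"
  have "d > 0 \<and> (\<exists>u\<in>L. u - imul (int d) t \<in> N)" unfolding d_def by (rule LeastI_ex) (use True in blast)
  then obtain u where d: "d > 0" and u: "u \<in> L" "u - imul (int d) t \<in> N" by blast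
  have least: "d \<le> e" if "e > 0" "v \<in> L" "v - imul (int e) t \<in> N" for e v
    unfolding d_def by (rule Least_le) (use that in blast)
  have "x \<in> ext (N \<inter> L) u" if x: "x \<in> L" for x
  proof -
    obtain z where z: "x - imul z t \<in> N" using L(2) x ext_iff_degree by blast
    define q where "q = z div int d"
    have "x + imul (- q) u - imul (z + (- q) * int d) t \<in> N"
      by (rule ext_degree_add[OF N z ext_degree_imul[OF N u(2)]])
    moreover have "z + (- q) * int d = z mod int d"
      unfolding q_def by (simp add: minus_div_mult_eq_mod)
    ultimately have *: "x - imul q u - imul (z mod int d) t \<in> N" by (simp add: imul_neg)
    have xL: "x - imul q u \<in> L" using subgp_diff[OF L(1) x] subgp_imul[OF L(1) u(1)] by blast
    have "z mod int d = 0"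
    proof (rule ccontr)
      assume ne: "z mod int d \<noteq> 0"
      have "0 \<le> z mod int d" "z mod int d < int d" using d by auto
      then obtain e where "z mod int d = int e" "e > 0" "e < d" using ne by (metis nat_eq_iff2 of_nat_0_less_iff of_nat_less_iff order_le_less nonneg_int_cases)
      then show False using least[of e "x - imul q u"] * xL by simp
    qed
    then have "x - imul q u \<in> N \<inter> L" using * xL by simp
    then show ?thesis using ext_iff_degree by blast
  qed
  moreover have "ext (N \<inter> L) u \<subseteq> L" using L(1) u(1) by (intro ext_subset) auto
  moreover have "conjg u ` (N \<inter> L) = N \<inter> L"
    using conjg_image_ext[OF N] conjg_image_self[OF L(1) u(1)] L(2) u(1) by (intro conjg_image_Int) auto
  ultimately show ?thesis using that(2)[of u "int d"] u d by auto
qed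

section \<open>Polycyclic and central series\<close>

text \<open>Cyclic and finite steps may alternate. \<open>pcf_fin\<close> does not ask
  \<open>K\<close> to be normal in \<open>H\<close>, and in \<open>pcf_ext\<close> the cyclic factor
  may be finite.\<close>

inductive pcf :: "'g::group_add set \<Rightarrow> bool" where
  pcf_zero: "pcf {0}"
| pcf_ext: "pcf K \<Longrightarrow> conjg t ` K = K \<Longrightarrow> pcf (ext K t)"
| pcf_fin: "pcf K \<Longrightarrow> fin_index K H \<Longrightarrow> pcf H"

text \<open>A transversal of \<open>M\<close> in \<open>N\<close> serves for the extensions as well:
  once an element is written as \<open>imul z t + n'\<close>, only \<open>n'\<close> has to be
  matched, and \<open>M\<close> is stable under \<open>t\<close>.\<close>

lemma fin_index_ext:
  assumes M: "fin_index M N" "conjg t ` M = M" and N: "conjg t ` N = N"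
  shows "fin_index (ext M t) (ext N t)"
proof -
  note sub = fin_indexD[OF M(1)]
  obtain T where T: "finite T" "T \<subseteq> N" "\<And>h. h \<in> N \<Longrightarrow> \<exists>t\<in>T. h - t \<in> M"
    using fin_indexE[OF M(1)] by metis
  have "\<exists>\<tau>\<in>T. h - \<tau> \<in> ext M t" if "h \<in> ext N t" for h
  proof -
    obtain n z where h: "n \<in> N" "h = n + imul z t" using \<open>h \<in> ext N t\<close> by (auto simp: ext_iff)
    have "conjg (- imul z t) n \<in> N"
      using conjg_image_minus[OF conjg_image_imul[OF N, of z]] h(1) by (auto simp: conjg_image_eq_iff)
    then obtain \<tau> where \<tau>: "\<tau> \<in> T" "conjg (- imul z t) n - \<tau> \<in> M" using T(3) by blast
    have "conjg (imul z t) (conjg (- imul z t) n - \<tau>) \<in> M"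
      using conjg_image_imul[OF M(2), of z] \<tau>(2) by blast
    moreover have "h - \<tau> = conjg (imul z t) (conjg (- imul z t) n - \<tau>) + imul z t"
      by (simp add: h conjg_def group_word_simps del: add_uminus_conv_diff)
    ultimately show ?thesis using \<tau>(1) ext_iff by metis
  qed
  moreover have "T \<subseteq> ext N t" using T(2) ext_superset by blast
  ultimately have "\<exists>T. finite T \<and> T \<subseteq> ext N t \<and> (\<forall>h\<in>ext N t. \<exists>\<tau>\<in>T. h - \<tau> \<in> ext M t)"
    using T(1) by (intro exI[of _ T] conjI ballI)
  then show ?thesis
    using subgp_ext[OF sub(1) M(2)] subgp_ext[OF sub(2) N] ext_mono[OF sub(3)]
    unfolding fin_index_def by simp
qed

text \<open>The principle by which virtual properties climb a series: before each cyclic step the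
  subgroup found so far is replaced by one stable under \<open>t\<close>, and \<open>hered\<close>
  carries \<open>P\<close> over to it.\<close>

lemma pcf_virtually:
  assumes G: "noeth G" and H: "pcf H" "H \<subseteq> G"
    and zero: "P {0}"
    and hered: "\<And>N L. P N \<Longrightarrow> subgp L \<Longrightarrow> L \<subseteq> N \<Longrightarrow> P L"
    and step: "\<And>N t. P N \<Longrightarrow> subgp N \<Longrightarrow> conjg t ` N = N \<Longrightarrow> ext N t \<subseteq> G \<Longrightarrow> \<exists>M. fin_index M (ext N t) \<and> P M"
  shows "\<exists>M. fin_index M H \<and> P M"
  using H
proof (induction rule: pcf.induct)
  case pcf_zero
  then show ?case using zero fin_index_refl subgp_trivial by blast
next
  case (pcf_ext K t)
  have K: "K \<subseteq> G" using pcf_ext.prems ext_superset by blast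
  obtain M where M: "fin_index M K" "P M" using pcf_ext.IH K by blast
  obtain M' where M': "fin_index M' K" "M' \<subseteq> M" "conjg t ` M' = M'"
    using fin_index_core[OF G K M(1)] pcf_ext.hyps(2) by metis
  have "P M'" using hered M(2) M'(2) fin_indexD(1)[OF M'(1)] by blast
  moreover have sub: "fin_index (ext M' t) (ext K t)"
    using fin_index_ext M'(1,3) pcf_ext.hyps(2) by blast
  ultimately show ?case
    using step[of M' t] fin_indexD[OF sub] pcf_ext.prems fin_indexD(1)[OF M'(1)] M'(3) fin_index_trans
    by (metis subset_trans)
next
  case (pcf_fin K H)
  then show ?case using fin_index_trans fin_indexD(3) by (metis subset_trans)
qed

lemma fin_index_ext_imul:
  assumes B: "subgp B" "conjg t ` B = B" and z: "z \<noteq> 0"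
  shows "fin_index (ext B (imul z t)) (ext B t)"
proof -
  let ?T = "(\<lambda>i. imul i t) ` {0..<\<bar>z\<bar>}"
  note inv = conjg_image_imul[OF B(2), of z]
  have "\<exists>u\<in>?T. h - u \<in> ext B (imul z t)" if "h \<in> ext B t" for h
  proof -
    obtain b i where h: "b \<in> B" "h = b + imul i t" using \<open>h \<in> ext B t\<close> by (auto simp: ext_iff)
    \<comment> \<open>Division is by the absolute value, as \<open>z\<close> may be negative; its
      sign moves into the quotient.\<close>
    have "sgn z * z = \<bar>z\<bar>" by (simp add: abs_sgn mult.commute)
    then have "imul i t = imul (i div \<bar>z\<bar> * sgn z * z + i mod \<bar>z\<bar>) t"
      by (simp only: mult.assoc div_mult_mod_eq)
    then have "imul i t = imul (i div \<bar>z\<bar> * sgn z) (imul z t) + imul (i mod \<bar>z\<bar>) t"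
      by (simp add: imul_add imul_mult)
    then have "h - imul (i mod \<bar>z\<bar>) t = b + imul (i div \<bar>z\<bar> * sgn z) (imul z t)"
      by (simp add: h group_word_simps del: add_uminus_conv_diff)
    then have "h - imul (i mod \<bar>z\<bar>) t \<in> ext B (imul z t)" using h(1) unfolding ext_iff by blast
    moreover have "i mod \<bar>z\<bar> \<in> {0..<\<bar>z\<bar>}" using z by simp
    ultimately show ?thesis by blast
  qed
  moreover have tB: "imul i t \<in> ext B t" for i
    using ext_gen[OF B(1), of t] subgp_imul[OF subgp_ext[OF B]] by blast
  then have "?T \<subseteq> ext B t" by blast
  moreover have "ext B (imul z t) \<subseteq> ext B t"
    using ext_subset[OF subgp_ext[OF B] ext_superset tB] .
  ultimately show ?thesis
    using subgp_ext[OF B] subgp_ext[OF B(1) inv]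
    unfolding fin_index_def by (intro conjI exI[of _ ?T] ballI) simp_all
qed

section \<open>Polycyclic subgroups\<close>

inductive pcyc :: "'g::group_add set \<Rightarrow> bool" where
  pcyc_zero: "pcyc {0}"
| pcyc_ext: "pcyc K \<Longrightarrow> conjg t ` K = K \<Longrightarrow> pcyc (ext K t)"

lemma pcyc_subgp: "pcyc K \<Longrightarrow> subgp K"
  by (induction rule: pcyc.induct) (auto intro: subgp_ext)

lemma pcyc_subset: "pcyc N \<Longrightarrow> subgp L \<Longrightarrow> L \<subseteq> N \<Longrightarrow> pcyc L"
proof (induction arbitrary: L rule: pcyc.induct)
  case pcyc_zero
  then have "L = {0}" using subgp_zero by blast
  then show ?case by (simp add: pcyc.pcyc_zero)
next
  case (pcyc_ext K t)
  note K = pcyc_subgp[OF pcyc_ext.hyps(1)]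
  have KL: "pcyc (K \<inter> L)" using pcyc_ext.IH subgp_Int[OF K pcyc_ext.prems(1)] by blast
  from K pcyc_ext.hyps(2) pcyc_ext.prems show ?case
  proof (cases rule: subgp_ext_cases)
    case 1
    then show ?thesis using KL by (simp add: inf.absorb2)
  next
    case (2 u d)
    then show ?thesis using pcyc.pcyc_ext[OF KL, of u] by simp
  qed
qed

lemma pcf_virtually_pcyc:
  assumes "noeth G" "pcf H" "H \<subseteq> G"
  shows "\<exists>M. fin_index M H \<and> pcyc M"
  using assms pcyc.pcyc_zero pcyc_subset
proof (rule pcf_virtually)
  fix N :: "'a set" and t assume "pcyc N" "subgp N" "conjg t ` N = N"
  then have "fin_index (ext N t) (ext N t)" "pcyc (ext N t)"
    by (simp_all add: pcyc.pcyc_ext fin_index_refl subgp_ext)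
  then show "\<exists>M. fin_index M (ext N t) \<and> pcyc M" by blast
qed

text \<open>\<open>X\<close> is the group centralising the factors and \<open>C\<close> the bottom
  term. They are parameters because two series are stacked: one from \<open>{0}\<close> to
  \<open>D\<close>, centralised by \<open>D\<close>, and one from \<open>D\<close> to the whole
  group, centralised by the whole group.\<close>

inductive central_series :: "'g::group_add set \<Rightarrow> 'g set \<Rightarrow> 'g set \<Rightarrow> bool" for X C where
  central_series_refl: "central_series X C C"
| central_series_ext: "central_series X C B \<Longrightarrow> conjg t ` B = B \<Longrightarrow> (\<And>x b. x \<in> X \<Longrightarrow> b \<in> ext B t \<Longrightarrow> comm x b \<in> B) \<Longrightarrow> central_series X C (ext B t)"

inductive torsion_free_series :: "'g::group_add set \<Rightarrow> 'g set \<Rightarrow> 'g set \<Rightarrow> bool" for X C where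
  torsion_free_series_refl: "torsion_free_series X C C"
| torsion_free_series_ext: "torsion_free_series X C B \<Longrightarrow> conjg t ` B = B \<Longrightarrow> (\<And>x b. x \<in> X \<Longrightarrow> b \<in> ext B t \<Longrightarrow> comm x b \<in> B) \<Longrightarrow>
    (\<And>z. imul z t \<in> B \<Longrightarrow> z = 0) \<Longrightarrow> torsion_free_series X C (ext B t)"

lemma central_series_subgp: "central_series X C B \<Longrightarrow> subgp C \<Longrightarrow> subgp B \<and> C \<subseteq> B"
  by (induction rule: central_series.induct) (simp, metis subgp_ext ext_superset subset_trans)

lemma torsion_free_series_subgp: "torsion_free_series X C B \<Longrightarrow> subgp C \<Longrightarrow> subgp B \<and> C \<subseteq> B"
  by (induction rule: torsion_free_series.induct) (simp, metis subgp_ext ext_superset subset_trans)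

text \<open>\<open>B\<close> modulo \<open>C\<close> is a finitely generated abelian group. Instead
  of generators, a maximal subgroup reachable from \<open>C\<close> by central cyclic steps is
  taken; an element of \<open>B\<close> outside it would allow one more step.\<close>

lemma central_series_central:
  assumes G: "noeth G" "B \<subseteq> G" and B: "subgp B" "B \<subseteq> X" and C: "subgp C" "C \<subseteq> B"
    and cent: "\<And>x b. x \<in> X \<Longrightarrow> b \<in> B \<Longrightarrow> comm x b \<in> C"
    and C0: "central_series X C0 C"
  shows "central_series X C0 B"
proof -
  let ?\<S> = "{M. subgp M \<and> C \<subseteq> M \<and> M \<subseteq> B \<and> central_series X C0 M}"
  obtain M where M: "M \<in> ?\<S>" "\<And>K. K \<in> ?\<S> \<Longrightarrow> M \<subseteq> K \<Longrightarrow> K = M"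
  proof (rule noeth_maximal[OF G(1), of C ?\<S>])
    show "C \<in> ?\<S>" using C C0 by simp
    show "K \<subseteq> G" if "K \<in> ?\<S>" for K using that G(2) by blast
  qed auto
  have "t \<in> M" if t: "t \<in> B" for t
  proof -
    have cM: "comm x b \<in> M" if "x \<in> X" "b \<in> B" for x b using cent[OF that] M(1) by blast
    have "conjg x m \<in> M" if "x \<in> B" "m \<in> M" for x m
    proof -
      have "comm x m + m \<in> M" using that cM[of x m] B(2) M(1) by (intro subgp_add) auto
      then show ?thesis by (simp add: comm_conjg)
    qed
    then have inv: "conjg t ` M = M" using t subgp_minus[OF B(1) t] by (simp add: conjg_image_eq_iff)
    have sub: "ext M t \<subseteq> B" using ext_subset[OF B(1) _ t] M(1) by blast
    have "central_series X C0 (ext M t)" using M(1) inv cM sub by (intro central_series_ext) auto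
    then have "ext M t = M" using M(1) sub subgp_ext[OF _ inv] ext_superset[of M t]
      by (intro M(2)) auto
    then show ?thesis using ext_gen[of M t] M(1) by simp
  qed
  then have "M = B" using M(1) by blast
  then show ?thesis using M(1) by blast
qed

definition nilp :: "'g::group_add set \<Rightarrow> bool" where
  "nilp D \<longleftrightarrow> (\<exists>W q. W 0 = {0} \<and> W q = D \<and> (\<forall>a. subgp (W a)) \<and> (\<forall>a<q::nat. W a \<subseteq> W (Suc a)) \<and>
     (\<forall>a<q. \<forall>w\<in>W (Suc a). \<forall>d\<in>D. comm d w \<in> W a))"

lemma nilp_central_series:
  assumes G: "noeth G" "D \<subseteq> G" and D: "nilp D"
  shows "central_series D {0} D"
proof -
  obtain W q where W: "W 0 = {0}" "W q = D" "\<And>a. subgp (W a)" "\<And>a. a < q \<Longrightarrow> W a \<subseteq> W (Suc a)"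
    "\<And>a w d. a < q \<Longrightarrow> w \<in> W (Suc a) \<Longrightarrow> d \<in> D \<Longrightarrow> comm d w \<in> W a"
    using D unfolding nilp_def by (elim exE conjE) blast
  have sub: "W a \<subseteq> D" if "a \<le> q" for a
    using that by (induction rule: inc_induct) (use W(2,4) in auto)
  have "central_series D {0} (W a)" if "a \<le> q" for a
    using that
  proof (induction a)
    case 0
    then show ?case by (simp add: W central_series_refl)
  next
    case (Suc a)
    have WD: "W (Suc a) \<subseteq> D" using sub Suc.prems by blast
    show ?case
    proof (rule central_series_central[OF G(1) _ W(3) WD W(3)])
      show "W (Suc a) \<subseteq> G" using WD G(2) by blast
      show "W a \<subseteq> W (Suc a)" using W(4) Suc.prems by auto
      show "comm x b \<in> W a" if "x \<in> D" "b \<in> W (Suc a)" for x b using W(5) Suc.prems that by auto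
      show "central_series D {0} (W a)" using Suc by simp
    qed
  qed
  then show ?thesis using W(2) by auto
qed

text \<open>A cyclic factor of finite order is dropped by staying with the old subgroup, whose index
  remains finite; an infinite one is kept. The claim covers all subgroups \<open>L\<close> of
  \<open>M\<close> closed under commutation with \<open>Y\<close>, so that it survives the passage
  to smaller subgroups; \<open>M0\<close> transports a choice already made inside
  \<open>C\<close>.\<close>

lemma central_series_virtually_torsion_free_series:
  assumes G: "noeth G" and B: "central_series X C B" "B \<subseteq> G" and C: "subgp C" "fin_index M0 C"
  shows "\<exists>M. fin_index M B \<and> M \<inter> C \<subseteq> M0 \<and>
    (\<forall>L Y. subgp L \<longrightarrow> L \<subseteq> M \<longrightarrow> Y \<subseteq> X \<longrightarrow> (\<forall>y\<in>Y. \<forall>l\<in>L. comm y l \<in> L) \<longrightarrow> torsion_free_series Y (C \<inter> L) L)"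
  using B
proof (induction rule: central_series.induct)
  case central_series_refl
  have "C \<inter> L = L" if "L \<subseteq> M0" for L using that fin_indexD(3)[OF C(2)] by blast
  then show ?case using C(2) by (intro exI[of _ M0]) (auto intro: torsion_free_series_refl)
next
  case (central_series_ext B t)
  have BG: "B \<subseteq> G" using central_series_ext.prems ext_superset by blast
  have sB: "subgp B" "C \<subseteq> B" using central_series_subgp[OF central_series_ext.hyps(1) C(1)] by auto
  obtain M where M: "fin_index M B" "M \<inter> C \<subseteq> M0"
    and zs: "\<And>L Y. subgp L \<Longrightarrow> L \<subseteq> M \<Longrightarrow> Y \<subseteq> X \<Longrightarrow> (\<And>y l. y \<in> Y \<Longrightarrow> l \<in> L \<Longrightarrow> comm y l \<in> L) \<Longrightarrow> torsion_free_series Y (C \<inter> L) L"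
    using central_series_ext.IH BG by metis
  show ?case
  proof (cases "\<forall>z. imul z t \<in> B \<longrightarrow> z = 0")
    case False
    then obtain z where z: "imul z t \<in> B" "z \<noteq> 0" by blast
    have "ext B (imul z t) = B"
      using ext_subset[OF sB(1) subset_refl z(1)] ext_superset by blast
    then have "fin_index B (ext B t)" using fin_index_ext_imul[OF sB(1) central_series_ext.hyps(2) z(2)] by simp
    then have "fin_index M (ext B t)" using M(1) fin_index_trans by blast
    then show ?thesis using M(2) zs by (intro exI[of _ M]) simp
  next
    case True
    obtain M' where M': "fin_index M' B" "M' \<subseteq> M" "conjg t ` M' = M'"
      using fin_index_core[OF G BG M(1)] central_series_ext.hyps(2) by metis
    \<comment> \<open>No nonzero multiple of \<open>t\<close> lies in \<open>B\<close>, so the new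
      generator adds nothing inside \<open>B\<close>.\<close>
    have M'B: "ext M' t \<inter> B \<subseteq> M'"
    proof
      fix x assume x: "x \<in> ext M' t \<inter> B"
      then obtain n z where n: "n \<in> M'" "x = n + imul z t" by (auto simp: ext_iff)
      then have "imul z t \<in> B" using x fin_indexD(3)[OF M'(1)] subgp_add_iff[OF sB(1), of n] by auto
      then show "x \<in> M'" using True n by auto
    qed
    have "torsion_free_series Y (C \<inter> L) L" if L: "subgp L" "L \<subseteq> ext M' t" and Y: "Y \<subseteq> X" "\<And>y l. y \<in> Y \<Longrightarrow> l \<in> L \<Longrightarrow> comm y l \<in> L" for L Y
    proof -
      have LM: "B \<inter> L \<subseteq> M" using L(2) M'B M'(2) by blast
      have LB: "L \<subseteq> ext B t" using L(2) ext_mono[OF fin_indexD(3)[OF M'(1)]] by blast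
      have cB: "comm y l \<in> B" if "y \<in> Y" "l \<in> L" for y l
        using central_series_ext.hyps(3)[of y l] that Y(1) LB by blast
      have "torsion_free_series Y (C \<inter> (B \<inter> L)) (B \<inter> L)"
        using cB Y by (intro zs[OF subgp_Int[OF sB(1) L(1)] LM]) auto
      moreover have "C \<inter> (B \<inter> L) = C \<inter> L" using sB(2) by blast
      ultimately have IH: "torsion_free_series Y (C \<inter> L) (B \<inter> L)" by simp
      from sB(1) central_series_ext.hyps(2) L(1) LB show ?thesis
      proof (cases rule: subgp_ext_cases)
        case 1
        then show ?thesis using IH by (simp add: inf.absorb2)
      next
        case (2 u d)
        have "z = 0" if "imul z u \<in> B \<inter> L" for z
        proof -
          have "imul z u - imul (z * d) t \<in> B" by (rule ext_degree_imul[OF sB(1) central_series_ext.hyps(2) 2(3)])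
          then have "imul (z * d) t \<in> B"
            using that subgp_diff_swap[OF sB(1)] subgp_add[OF sB(1), of _ "imul z u"] by (metis IntD1 diff_add_cancel)
          then show ?thesis using True 2(2) by auto
        qed
        then have "torsion_free_series Y (C \<inter> L) (ext (B \<inter> L) u)"
          using IH 2(4,5) cB Y by (intro torsion_free_series_ext) auto
        then show ?thesis using 2(5) by simp
      qed
    qed
    moreover have "ext M' t \<inter> C \<subseteq> M0" using M'B M'(2) M(2) sB(2) by blast
    moreover have "fin_index (ext M' t) (ext B t)" using fin_index_ext M'(1,3) central_series_ext.hyps(2) by blast
    ultimately show ?thesis by (intro exI[of _ "ext M' t"]) simp
  qed
qed

section \<open>Operators on abelian sections\<close>

text \<open>Sums of conjugation maps need not be endomorphisms. On an abelian section on which commutators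
  of \<open>N\<close> act trivially they form a commutative ring, the image of \<open>\<int>N\<close>.\<close>

inductive ops :: "'g::group_add set \<Rightarrow> ('g \<Rightarrow> 'g) \<Rightarrow> bool" for N where
  ops_conjg: "x \<in> N \<Longrightarrow> ops N (conjg x)"
| ops_plus: "ops N r \<Longrightarrow> ops N s \<Longrightarrow> ops N (\<lambda>v. r v + s v)"
| ops_neg: "ops N r \<Longrightarrow> ops N (\<lambda>v. - r v)"
| ops_comp: "ops N r \<Longrightarrow> ops N s \<Longrightarrow> ops N (\<lambda>v. r (s v))"

lemma ops_closed:
  assumes "ops N r" "subgp M" "\<And>x m. x \<in> N \<Longrightarrow> m \<in> M \<Longrightarrow> conjg x m \<in> M" "v \<in> M"
  shows "r v \<in> M"
  using assms(1,4) by (induction arbitrary: v) (auto intro: assms(2,3) subgp_add subgp_minus)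

lemma ops_at_0: "ops N r \<Longrightarrow> r 0 = 0"
  by (induction rule: ops.induct) auto

lemma ops_id: "0 \<in> N \<Longrightarrow> ops N (\<lambda>v. v)"
proof -
  assume "0 \<in> N"
  then have "ops N (conjg 0)" by (rule ops_conjg)
  moreover have "conjg 0 = (\<lambda>v::'a. v)" by (rule ext) (rule conjg_by_zero)
  ultimately show ?thesis by (simp only:)
qed

lemma ops_zero: "0 \<in> N \<Longrightarrow> ops N (\<lambda>v. 0)"
proof -
  assume N: "0 \<in> N"
  have "ops N (\<lambda>v. v + - v)" by (rule ops_plus[OF ops_id[OF N] ops_neg[OF ops_id[OF N]]])
  then show ?thesis by simp
qed

lemma ops_imul: "0 \<in> N \<Longrightarrow> ops N (imul z)"
proof -
  assume N: "0 \<in> N"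
  have *: "ops N (imul (int n))" for n
  proof (induction n)
    case 0
    have "imul (int 0) = (\<lambda>v::'a. 0)" by auto
    then show ?case using ops_zero[OF N] by simp
  next
    case (Suc n)
    have "imul (int (Suc n)) = (\<lambda>v::'a. v + imul (int n) v)" by (rule ext) (rule imul_succ_nat)
    then show ?case using ops_plus[OF ops_id[OF N] Suc] by simp
  qed
  show ?thesis
  proof (cases z)
    case (nonneg n)
    then show ?thesis using * by simp
  next
    case (neg n)
    have "imul z = (\<lambda>v::'a. - imul (int (Suc n)) v)" by (rule ext) (simp only: neg imul_neg)
    then show ?thesis using ops_neg[OF *[of "Suc n"]] by simp
  qed
qed

text \<open>Operators are not additive outside an abelian section, yet they respect congruence
  modulo a subgroup stable under \<open>N\<close>: reordering the summands only conjugates the error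
  terms by elements of \<open>N\<close>. This serves where \<open>W\<close> is not the lower term of
  the abelian section at hand.\<close>

lemma ops_mod:
  assumes r: "ops N r" and W: "subgp W" "\<And>x w. x \<in> N \<Longrightarrow> w \<in> W \<Longrightarrow> conjg x w \<in> W"
    and N: "subgp N" and wu: "w \<in> W" "u \<in> N"
  shows "r (w + u) - r u \<in> W"
  using r wu
proof (induction arbitrary: w u)
  case (ops_conjg x)
  have "conjg x (w + u) - conjg x u = conjg x w" by (simp add: conjg_add)
  then show ?case using W(2) ops_conjg by simp
next
  case (ops_plus r s)
  have "r u \<in> N" using ops_closed[OF ops_plus.hyps(1) N] subgp_conjg[OF N] ops_plus.prems by blast
  have "r (w + u) + s (w + u) - (r u + s u) = (r (w + u) - r u) + conjg (r u) (s (w + u) - s u)"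
    by (simp add: conjg_def group_word_simps del: add_uminus_conv_diff)
  then show ?case
    using ops_plus.IH(1)[OF ops_plus.prems] W(2)[OF \<open>r u \<in> N\<close> ops_plus.IH(2)[OF ops_plus.prems]] subgp_add[OF W(1)]
    by simp
next
  case (ops_neg r)
  have "r u \<in> N" using ops_closed[OF ops_neg.hyps(1) N] subgp_conjg[OF N] ops_neg.prems by blast
  have "- r (w + u) - (- r u) = conjg (- r u) (- (r (w + u) - r u))"
    by (simp add: conjg_def group_word_simps del: add_uminus_conv_diff)
  then show ?case
    using W(2)[OF subgp_minus[OF N \<open>r u \<in> N\<close>] subgp_minus[OF W(1) ops_neg.IH[OF ops_neg.prems]]] by simp
next
  case (ops_comp r s)
  have "s u \<in> N" using ops_closed[OF ops_comp.hyps(2) N] subgp_conjg[OF N] ops_comp.prems by blast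
  have "s (w + u) = (s (w + u) - s u) + s u" by simp
  then show ?case using ops_comp.IH(1)[OF ops_comp.IH(2)[OF ops_comp.prems] \<open>s u \<in> N\<close>] by simp
qed

text \<open>Horner evaluation at \<open>y\<close> of a polynomial with operators as coefficients, lowest degree first,
  and its quotient by \<open>X - y\<close>.\<close>

primrec horner :: "('g::group_add \<Rightarrow> 'g) list \<Rightarrow> ('g \<Rightarrow> 'g) \<Rightarrow> 'g \<Rightarrow> 'g" where
  "horner [] y v = 0"
| "horner (c # cs) y v = c v + y (horner cs y v)"

primrec horner_div :: "('g::group_add \<Rightarrow> 'g) list \<Rightarrow> ('g \<Rightarrow> 'g) \<Rightarrow> ('g \<Rightarrow> 'g) list" where
  "horner_div [] y = []"
| "horner_div (c # cs) y = (if cs = [] then [] else horner cs y # horner_div cs y)"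

lemma ops_horner: "0 \<in> N \<Longrightarrow> (\<And>c. c \<in> set cs \<Longrightarrow> ops N c) \<Longrightarrow> ops N y \<Longrightarrow> ops N (horner cs y)"
proof (induction cs)
  case Nil
  have "horner [] y = (\<lambda>v. 0)" by (rule ext) simp
  then show ?case using ops_zero Nil by simp
next
  case (Cons c cs)
  have "horner (c # cs) y = (\<lambda>v. c v + y (horner cs y v))" by (rule ext) simp
  then show ?case using Cons ops_plus[of N c] ops_comp[of N y "horner cs y"] by simp
qed

lemma ops_horner_div: "0 \<in> N \<Longrightarrow> (\<And>c. c \<in> set cs \<Longrightarrow> ops N c) \<Longrightarrow> ops N y \<Longrightarrow> c \<in> set (horner_div cs y) \<Longrightarrow> ops N c"
  by (induction cs) (auto split: if_splits intro: ops_horner)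

lemma length_horner_div: "length (horner_div cs y) = length cs - 1"
  by (induction cs) auto

text \<open>The quotient of a monic polynomial is monic. Its last entry arises as
  \<open>c v + y 0\<close>, hence the assumption on \<open>y\<close>; below length two the quotient
  is empty.\<close>

lemma last_horner_div: "y 0 = 0 \<Longrightarrow> length cs \<ge> 2 \<Longrightarrow> last (horner_div cs y) = last cs"
proof (induction cs)
  case (Cons c cs)
  show ?case
  proof (cases "length cs \<ge> 2")
    case True
    then have "horner_div cs y \<noteq> []" "cs \<noteq> []" using length_horner_div[of cs y] by auto
    then show ?thesis using Cons True by simp
  next
    case False
    then have "length cs = 1" using Cons.prems(2) by simp
    then obtain d where "cs = [d]" by (auto simp: length_Suc_conv)
    then show ?thesis using Cons.prems(1) by (auto simp: fun_eq_iff)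
  qed
qed simp

locale abelian_section =
  fixes N B C :: "'g::group_add set"
  assumes subN: "subgp N" and subB: "subgp B" and subC: "subgp C" and CB: "C \<subseteq> B"
    and invB: "x \<in> N \<Longrightarrow> b \<in> B \<Longrightarrow> conjg x b \<in> B"
    and invC: "x \<in> N \<Longrightarrow> c \<in> C \<Longrightarrow> conjg x c \<in> C"
    and ab: "a \<in> B \<Longrightarrow> b \<in> B \<Longrightarrow> comm a b \<in> C"
    and act: "x \<in> N \<Longrightarrow> y \<in> N \<Longrightarrow> b \<in> B \<Longrightarrow> comm (comm x y) b \<in> C"
begin

definition eqv (infix "\<approx>" 50) where "a \<approx> b \<longleftrightarrow> a - b \<in> C"

lemma N0: "0 \<in> N" by (rule subgp_zero[OF subN])

lemma eqv_refl [simp]: "a \<approx> a"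
  by (simp add: eqv_def subgp_zero[OF subC])

lemma eqv_sym: "a \<approx> b \<Longrightarrow> b \<approx> a"
  using subgp_diff_swap[OF subC] by (simp add: eqv_def)

lemma eqv_trans [trans]: "a \<approx> b \<Longrightarrow> b \<approx> c \<Longrightarrow> a \<approx> c"
proof -
  assume "a \<approx> b" "b \<approx> c"
  then have "(a - b) + (b - c) \<in> C" unfolding eqv_def by (rule subgp_add[OF subC])
  then show ?thesis by (simp add: eqv_def group_word_simps del: add_uminus_conv_diff)
qed

lemma eqv_zero: "a \<approx> 0 \<longleftrightarrow> a \<in> C"
  by (simp add: eqv_def)

lemma eqv_mem: "a \<approx> b \<Longrightarrow> a \<in> C \<longleftrightarrow> b \<in> C"
  using eqv_zero eqv_sym eqv_trans by blast

lemma conjg_B_C: "b \<in> B \<Longrightarrow> c \<in> C \<Longrightarrow> conjg b c \<in> C"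
proof -
  assume "b \<in> B" "c \<in> C"
  then have "comm b c + c \<in> C" using ab CB by (intro subgp_add[OF subC]) auto
  then show ?thesis by (simp add: comm_conjg)
qed

lemma eqv_add:
  assumes "a' \<in> B" "a \<approx> a'" "b \<approx> b'"
  shows "a + b \<approx> a' + b'"
proof -
  have "a + b - (a' + b') = (a - a') + conjg a' (b - b')"
    by (simp add: conjg_def group_word_simps del: add_uminus_conv_diff)
  then show ?thesis using assms conjg_B_C subgp_add[OF subC] by (simp add: eqv_def)
qed

lemma eqv_minus:
  assumes "a' \<in> B" "a \<approx> a'"
  shows "- a \<approx> - a'"
proof -
  have "- a - (- a') = conjg (- a') (a' - a)"
    by (simp add: conjg_def group_word_simps del: add_uminus_conv_diff)
  moreover have "a' - a \<in> C" using assms(2) subgp_diff_swap[OF subC] by (simp add: eqv_def)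
  ultimately show ?thesis using assms(1) conjg_B_C subgp_minus[OF subB] by (simp add: eqv_def)
qed

lemma eqv_comm: "a \<in> B \<Longrightarrow> b \<in> B \<Longrightarrow> a + b \<approx> b + a"
  using ab[of a b] by (simp add: eqv_def comm_def group_word_simps del: add_uminus_conv_diff)

lemmas addB = subgp_add[OF subB] and minusB = subgp_minus[OF subB]

lemma eqv_swap:
  assumes "p \<in> B" "q \<in> B" "r \<in> B" "s \<in> B"
  shows "(p + q) + (r + s) \<approx> (p + r) + (q + s)"
proof -
  have "p + ((q + r) + s) \<approx> p + ((r + q) + s)"
    by (intro eqv_add eqv_comm eqv_refl addB assms)
  then show ?thesis by (simp add: add.assoc)
qed

lemma eqv_rotate:
  assumes "p \<in> B" "q \<in> B" "r \<in> B" "s \<in> B"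
  shows "(p + q) + (r + s) \<approx> (s + p) + (r + q)"
proof -
  have "(p + q) + (r + s) \<approx> (p + q) + (s + r)" 
    by (intro eqv_add eqv_comm eqv_refl addB assms)
  also have "\<dots> \<approx> (p + s) + (q + r)" by (intro eqv_swap assms)
  also have "\<dots> \<approx> (s + p) + (r + q)" by (intro eqv_add eqv_comm eqv_refl addB assms)
  finally show ?thesis .
qed

lemma opsB: "ops N r \<Longrightarrow> b \<in> B \<Longrightarrow> r b \<in> B"
  using ops_closed subB invB by blast

lemma opsC: "ops N r \<Longrightarrow> b \<in> C \<Longrightarrow> r b \<in> C"
  using ops_closed subC invC by blast

text \<open>Both properties are proved at once: additivity of a composite needs the congruence
  property of the outer operator. Sums of operators are additive only modulo \<open>C\<close>, where
  values may be interchanged.\<close>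

lemma ops_add_cong:
  "ops N r \<Longrightarrow> (\<forall>a\<in>B. \<forall>b\<in>B. r (a + b) \<approx> r a + r b) \<and> (\<forall>a\<in>B. \<forall>a'. a' \<approx> a \<longrightarrow> r a' \<approx> r a)"
proof (induction rule: ops.induct)
  case (ops_conjg x)
  have "conjg x a' \<approx> conjg x a" if "a' \<approx> a" for a a'
    using invC[OF ops_conjg, of "a' - a"] that by (simp add: eqv_def conjg_diff)
  then show ?case by (simp add: conjg_add)
next
  case (ops_plus r s)
  note r = ops_plus.IH(1)[THEN conjunct1, rule_format] ops_plus.IH(1)[THEN conjunct2, rule_format]
  note s = ops_plus.IH(2)[THEN conjunct1, rule_format] ops_plus.IH(2)[THEN conjunct2, rule_format]
  note B = opsB[OF ops_plus.hyps(1)] opsB[OF ops_plus.hyps(2)]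
  have "r (a + b) + s (a + b) \<approx> (r a + s a) + (r b + s b)" if ab: "a \<in> B" "b \<in> B" for a b
  proof -
    have "r (a + b) + s (a + b) \<approx> (r a + r b) + (s a + s b)"
      by (intro eqv_add addB r s B ab)
    also have "\<dots> \<approx> (r a + s a) + (r b + s b)" by (intro eqv_swap B ab)
    finally show ?thesis .
  qed
  moreover have "r a' + s a' \<approx> r a + s a" if "a \<in> B" "a' \<approx> a" for a a'
    by (intro eqv_add r s B that)
  ultimately show ?case by blast
next
  case (ops_neg r)
  note r = ops_neg.IH[THEN conjunct1, rule_format] ops_neg.IH[THEN conjunct2, rule_format]
  note B = opsB[OF ops_neg.hyps]
  have "- r (a + b) \<approx> - r a + - r b" if ab: "a \<in> B" "b \<in> B" for a b
  proof -
    have "- r (a + b) \<approx> - (r a + r b)" by (intro eqv_minus addB r B ab)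
    also have "\<dots> = - r b + - r a" by (simp only: minus_add)
    also have "\<dots> \<approx> - r a + - r b" by (intro eqv_comm minusB B ab)
    finally show ?thesis .
  qed
  moreover have "- r a' \<approx> - r a" if "a \<in> B" "a' \<approx> a" for a a'
    by (intro eqv_minus r B that)
  ultimately show ?case by blast
next
  case (ops_comp r s)
  note r = ops_comp.IH(1)[THEN conjunct1, rule_format] ops_comp.IH(1)[THEN conjunct2, rule_format]
  note s = ops_comp.IH(2)[THEN conjunct1, rule_format] ops_comp.IH(2)[THEN conjunct2, rule_format]
  note B = opsB[OF ops_comp.hyps(2)]
  have "r (s (a + b)) \<approx> r (s a) + r (s b)" if ab: "a \<in> B" "b \<in> B" for a b
  proof -
    have "r (s (a + b)) \<approx> r (s a + s b)" by (intro r(2) s(1) addB B ab)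
    also have "\<dots> \<approx> r (s a) + r (s b)" by (intro r(1) B ab)
    finally show ?thesis .
  qed
  moreover have "r (s a') \<approx> r (s a)" if "a \<in> B" "a' \<approx> a" for a a'
    by (intro r(2) s(2) B that)
  ultimately show ?case by blast
qed

lemma ops_add: "ops N r \<Longrightarrow> a \<in> B \<Longrightarrow> b \<in> B \<Longrightarrow> r (a + b) \<approx> r a + r b"
  and ops_cong: "ops N r \<Longrightarrow> a \<in> B \<Longrightarrow> a' \<approx> a \<Longrightarrow> r a' \<approx> r a"
  using ops_add_cong by blast+

lemma ops_minus: "ops N r \<Longrightarrow> a \<in> B \<Longrightarrow> r (- a) \<approx> - r a"
proof -
  assume r: "ops N r" "a \<in> B"
  then have "r (- a + a) \<approx> r (- a) + r a" by (intro ops_add minusB)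
  then have "- (r (- a) + r a) \<in> C" by (simp add: ops_at_0[OF r(1)] eqv_def)
  then have "r (- a) + r a \<in> C" by (simp only: subgp_minus_iff[OF subC])
  then show ?thesis by (simp add: eqv_def)
qed

lemma ops_commute_conjg: "ops N s \<Longrightarrow> x \<in> N \<Longrightarrow> b \<in> B \<Longrightarrow> conjg x (s b) \<approx> s (conjg x b)"
proof (induction arbitrary: b rule: ops.induct)
  case (ops_conjg y)
  \<comment> \<open>As \<open>comm x y + (y + x) = x + y\<close>, the two orders of conjugation
    differ by the action of \<open>comm x y\<close>, which is trivial modulo
    \<open>C\<close>.\<close>
  have "comm (comm x y) (conjg (y + x) b) \<in> C"
    by (intro act invB subgp_add[OF subN] ops_conjg)
  moreover have "comm (comm x y) (conjg (y + x) b) = conjg x (conjg y b) - conjg y (conjg x b)"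
    by (simp add: conjg_def comm_def group_word_simps del: add_uminus_conv_diff)
  ultimately show ?case by (simp add: eqv_def)
next
  case (ops_plus r s)
  have "conjg x (r b) + conjg x (s b) \<approx> r (conjg x b) + s (conjg x b)"
    by (intro eqv_add ops_plus.IH ops_plus.prems opsB[OF ops_plus.hyps(1)] invB)
  then show ?case by (simp add: conjg_add)
next
  case (ops_neg r)
  have "- conjg x (r b) \<approx> - r (conjg x b)"
    by (intro eqv_minus ops_neg.IH ops_neg.prems opsB[OF ops_neg.hyps(1)] invB)
  then show ?case by (simp add: conjg_minus)
next
  case (ops_comp r s)
  have "conjg x (r (s b)) \<approx> r (conjg x (s b))"
    by (intro ops_comp.IH(1) ops_comp.prems opsB[OF ops_comp.hyps(2)])
  also have "\<dots> \<approx> r (s (conjg x b))"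
    by (intro ops_cong[OF ops_comp.hyps(1)] ops_comp.IH(2) ops_comp.prems opsB[OF ops_comp.hyps(2)] invB)
  finally show ?case .
qed

lemma ops_commute: "ops N r \<Longrightarrow> ops N s \<Longrightarrow> b \<in> B \<Longrightarrow> r (s b) \<approx> s (r b)"
proof (induction arbitrary: b rule: ops.induct)
  case (ops_conjg x)
  then show ?case by (intro ops_commute_conjg)
next
  case (ops_plus r r')
  note s = ops_plus.prems(1) and B = opsB[OF ops_plus.hyps(1)] opsB[OF ops_plus.hyps(2)] ops_plus.prems(2)
  have "r (s b) + r' (s b) \<approx> s (r b) + s (r' b)"
    by (intro eqv_add ops_plus.IH s opsB[OF s] B)
  also have "\<dots> \<approx> s (r b + r' b)" by (intro eqv_sym[OF ops_add[OF s]] B)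
  finally show ?case .
next
  case (ops_neg r)
  note s = ops_neg.prems(1) and B = opsB[OF ops_neg.hyps(1)] ops_neg.prems(2)
  have "- r (s b) \<approx> - s (r b)" by (intro eqv_minus ops_neg.IH s opsB[OF s] B)
  also have "\<dots> \<approx> s (- r b)" by (intro eqv_sym[OF ops_minus[OF s]] B)
  finally show ?case .
next
  case (ops_comp r r')
  note s = ops_comp.prems(1) and B = opsB[OF ops_comp.hyps(2)] ops_comp.prems(2)
  have "r (r' (s b)) \<approx> r (s (r' b))"
    by (intro ops_cong[OF ops_comp.hyps(1)] ops_comp.IH s opsB[OF s] B)
  also have "\<dots> \<approx> s (r (r' b))" by (intro ops_comp.IH s B)
  finally show ?case .
qed

text \<open>This is \<open>p(y) - p(y0) = (y - y0) q(y)\<close> with the negative terms moved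
  across, where \<open>q\<close> is the quotient by \<open>X - y0\<close>.\<close>

lemma horner_div_eqv:
  assumes y: "ops N y" "ops N y0" and v: "v \<in> B"
  shows "(\<And>c. c \<in> set cs \<Longrightarrow> ops N c) \<Longrightarrow>
    y (horner (horner_div cs y0) y v) + horner cs y0 v \<approx> y0 (horner (horner_div cs y0) y v) + horner cs y v"
proof (induction cs)
  case Nil
  then show ?case by (simp add: ops_at_0[OF y(1)] ops_at_0[OF y(2)])
next
  case (Cons c cs)
  show ?case
  proof (cases "cs = []")
    case True
    then show ?thesis by (simp add: ops_at_0[OF y(1)] ops_at_0[OF y(2)])
  next
    case False
    define e where "e = horner cs y0 v"
    define E where "E = horner cs y v"
    define w where "w = horner (horner_div cs y0) y v"
    have IH: "y w + e \<approx> y0 w + E" unfolding e_def E_def w_def using Cons by simp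
    have cs: "\<And>c. c \<in> set cs \<Longrightarrow> ops N c" and c: "ops N c" using Cons.prems by auto
    have wB: "w \<in> B" "e \<in> B" "E \<in> B" "c v \<in> B" unfolding w_def e_def E_def
      using opsB[OF ops_horner[OF N0 ops_horner_div[OF N0 cs y(2)] y(1)] v]
        opsB[OF ops_horner[OF N0 cs y(2)] v] opsB[OF ops_horner[OF N0 cs y(1)] v] opsB[OF c v] by auto
    note [intro!] = opsB[OF y(1)] opsB[OF y(2)] addB wB
    have "y (e + y w) \<approx> y e + y (y w)" by (rule ops_add[OF y(1)]) auto
    also have "\<dots> \<approx> y (y w) + y e" by (rule eqv_comm) auto
    also have "\<dots> \<approx> y (y w + e)" by (rule eqv_sym[OF ops_add[OF y(1)]]) auto
    also have "\<dots> \<approx> y (y0 w + E)" by (rule ops_cong[OF y(1) _ IH]) auto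
    also have "\<dots> \<approx> y (y0 w) + y E" by (rule ops_add[OF y(1)]) auto
    also have "\<dots> \<approx> y0 (y w) + y E"
      by (rule eqv_add[OF _ ops_commute[OF y]]) auto
    finally have 1: "y (e + y w) \<approx> y0 (y w) + y E" .
    have 2: "y0 (e + y w) \<approx> y0 e + y0 (y w)" by (rule ops_add[OF y(2)]) auto
    have "y (e + y w) + (c v + y0 e) \<approx> (y0 (y w) + y E) + (c v + y0 e)"
      by (rule eqv_add[OF _ 1]) auto
    also have "\<dots> \<approx> (y0 e + y0 (y w)) + (c v + y E)" by (rule eqv_rotate) auto
    also have "\<dots> \<approx> y0 (e + y w) + (c v + y E)" by (rule eqv_add[OF _ eqv_sym[OF 2]]) auto
    finally show ?thesis using False by (simp add: e_def E_def w_def)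
  qed
qed

end

text \<open>\<open>W'\<close> modulo \<open>W\<close> is torsion-free over the operators acting on
  it; where these commute, they form an integral domain.\<close>

definition prime_section :: "'g::group_add set \<Rightarrow> 'g set \<Rightarrow> 'g set \<Rightarrow> bool" where
  "prime_section N W W' \<longleftrightarrow> (\<forall>r. ops N r \<longrightarrow> (\<forall>v\<in>W'. r v \<in> W) \<or> (\<forall>v\<in>W'. r v \<in> W \<longrightarrow> v \<in> W))"

context abelian_section
begin

text \<open>A monic polynomial has finitely many roots in an integral domain: divide by \<open>X - y\<close> for one
  root \<open>y\<close> and induct on the degree.\<close>

lemma prime_roots_finite:
  assumes P: "prime_section N C B" and v: "v \<in> B" "v \<notin> C" and x: "\<And>j::nat. x j \<in> N"
  shows "(\<And>c. c \<in> set cs \<Longrightarrow> ops N c) \<Longrightarrow> cs \<noteq> [] \<Longrightarrow> last cs = (\<lambda>v. v) \<Longrightarrow> infinite J \<Longrightarrow>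
    (\<And>j. j \<in> J \<Longrightarrow> horner cs (conjg (x j)) v \<in> C) \<Longrightarrow>
    \<exists>J'\<subseteq>J. infinite J' \<and> (\<exists>i. \<forall>j\<in>J'. \<forall>b\<in>B. conjg (x j) b - conjg (x i) b \<in> C)"
proof (induction "length cs" arbitrary: cs J)
  case (Suc n)
  obtain i where i: "i \<in> J" using Suc.prems(4) by fastforce
  let ?y = "\<lambda>j. conjg (x j)"
  have y: "ops N (?y j)" for j using x ops_conjg by blast
  define r where "r j = (\<lambda>b. ?y j b + - ?y i b)" for j
  have r: "ops N (r j)" for j unfolding r_def by (intro ops_plus ops_neg y)
  have len: "length cs \<ge> 2"
  proof (rule ccontr)
    assume "\<not> length cs \<ge> 2"
    then have "length cs = 1" using Suc.hyps(2) by simp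
    then obtain c where "cs = [c]" by (auto simp: length_Suc_conv)
    then show False using Suc.prems(3) Suc.prems(5)[OF i] v(2) by simp
  qed
  \<comment> \<open>The indices that act like \<open>i\<close> on the section. For the others
    \<open>r j\<close> is nonzero, hence injective by primality, and may be cancelled from
    \<open>(y j - y i) q(y j) v\<close> with \<open>q\<close> the quotient.\<close>
  define J1 where "J1 = {j \<in> J. \<forall>b\<in>B. r j b \<in> C}"
  show ?case
  proof (cases "infinite J1")
    case True
    then show ?thesis unfolding J1_def r_def by (intro exI[of _ J1]) (auto simp: J1_def r_def)
  next
    case False
    then have inf: "infinite (J - J1)" using Suc.prems(4) by (simp add: Diff_infinite_finite)
    let ?ds = "horner_div cs (?y i)"
    have dops: "c \<in> set ?ds \<Longrightarrow> ops N c" for c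
      using ops_horner_div[OF N0 _ y[of i]] Suc.prems(1) by blast
    have root: "horner ?ds (?y j) v \<in> C" if j: "j \<in> J - J1" for j
    proof -
      let ?w = "horner ?ds (?y j) v"
      have wB: "?w \<in> B" using opsB[OF ops_horner[OF N0 dops y] v(1)] .
      have e: "horner cs (?y i) v \<in> C" "horner cs (?y j) v \<in> C" using Suc.prems(5) i j by auto
      have "?y j ?w + 0 \<approx> ?y j ?w + horner cs (?y i) v"
        using eqv_sym[of "horner cs (?y i) v" 0] e eqv_zero opsB[OF y wB] by (intro eqv_add) auto
      also have "\<dots> \<approx> ?y i ?w + horner cs (?y j) v"
        using horner_div_eqv[OF y[of j] y[of i] v(1)] Suc.prems(1) by blast
      also have "\<dots> \<approx> ?y i ?w + 0"
        using e eqv_zero opsB[OF y wB] by (intro eqv_add) auto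
      finally have "r j ?w \<in> C" by (simp add: r_def eqv_def)
      then show ?thesis using P r[of j] j wB unfolding prime_section_def J1_def by blast
    qed
    have "\<exists>J'\<subseteq>J - J1. infinite J' \<and> (\<exists>i. \<forall>j\<in>J'. \<forall>b\<in>B. ?y j b - ?y i b \<in> C)"
    proof (rule Suc.hyps(1))
      show "n = length ?ds" using Suc.hyps(2) length_horner_div[of cs "?y i"] by simp
      show "?ds \<noteq> []" using len length_horner_div[of cs "?y i"] by auto
      show "last ?ds = (\<lambda>v. v)" using last_horner_div[OF _ len, of "?y i"] Suc.prems(3) by simp
      show "ops N c" if "c \<in> set ?ds" for c by (rule dops[OF that])
      show "horner ?ds (?y j) v \<in> C" if "j \<in> J - J1" for j by (rule root[OF that])
    qed (rule inf)
    then obtain J' i' where J': "J' \<subseteq> J - J1" "infinite J'"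
      "\<forall>j\<in>J'. \<forall>b\<in>B. ?y j b - ?y i' b \<in> C"
      by (elim exE conjE) (rule that)
    have "J' \<subseteq> J" using J'(1) by blast
    then show ?thesis using J'(2,3) by (intro exI[of _ J'] exI[of _ i'] conjI)
  qed
qed simp

end

section \<open>Integer polynomials in an operator\<close>

definition poly_map :: "int poly \<Rightarrow> ('g::group_add \<Rightarrow> 'g) \<Rightarrow> 'g \<Rightarrow> 'g" where
  "poly_map p y v = horner (map imul (coeffs p)) y v"

lemma poly_map_0 [simp]: "poly_map 0 y v = 0"
  by (simp add: poly_map_def)

lemma poly_map_pCons: "y 0 = 0 \<Longrightarrow> poly_map (pCons a p) y v = imul a v + y (poly_map p y v)"
  by (cases "a = 0 \<and> p = 0") (auto simp: poly_map_def cCons_def)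

text \<open>The coefficients are integers, so conjugation by \<open>t\<close> moves only
  \<open>x\<close> and the vector: the conjugates of \<open>x\<close> satisfy the polynomial of
  \<open>x\<close> on any section that \<open>t\<close> preserves.\<close>

lemma poly_map_conjg: "conjg t (poly_map p (conjg x) v) = poly_map p (conjg (conjg t x)) (conjg t v)"
proof (induction p)
  case (pCons a p)
  have *: "conjg t (conjg x u) = conjg (conjg t x) (conjg t u)" for u
    by (simp add: conjg_def group_word_simps del: add_uminus_conv_diff)
  show ?case by (simp add: poly_map_pCons conjg_add conjg_imul pCons.IH *)
qed simp

context abelian_section
begin

lemma ops_poly_map: "ops N y \<Longrightarrow> ops N (poly_map p y)"
  unfolding poly_map_def[abs_def] by (rule ops_horner) (auto intro: N0 ops_imul)

lemma poly_map_add: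
  assumes y: "ops N y" and v: "v \<in> B"
  shows "poly_map (p + q) y v \<approx> poly_map p y v + poly_map q y v"
proof (induction p q rule: poly_induct2)
  case (pCons a p b q)
  note y0 = ops_at_0[OF y] and gB = opsB[OF ops_poly_map[OF y] v] and yB = opsB[OF y] and iB = opsB[OF ops_imul[OF N0] v]
  have "y (poly_map (p + q) y v) \<approx> y (poly_map p y v + poly_map q y v)" by (intro ops_cong[OF y] pCons addB gB)
  also have "\<dots> \<approx> y (poly_map p y v) + y (poly_map q y v)" by (intro ops_add[OF y] gB)
  finally have "imul (a + b) v + y (poly_map (p + q) y v) \<approx> (imul a v + imul b v) + (y (poly_map p y v) + y (poly_map q y v))"
    unfolding imul_add by (intro eqv_add addB iB eqv_refl)
  also have "\<dots> \<approx> (imul a v + y (poly_map p y v)) + (imul b v + y (poly_map q y v))"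
    by (intro eqv_swap iB yB gB)
  finally show ?case by (simp add: poly_map_pCons[of y, OF y0])
qed simp

lemma poly_map_smult:
  assumes y: "ops N y" and v: "v \<in> B"
  shows "poly_map (smult a q) y v \<approx> imul a (poly_map q y v)"
proof (induction q)
  case 0
  then show ?case by (simp add: ops_at_0[OF ops_imul[OF N0]])
next
  case (pCons c q)
  note y0 = ops_at_0[OF y] and gB = opsB[OF ops_poly_map[OF y] v] and yB = opsB[OF y] and i = ops_imul[OF N0]
  have "y (poly_map (smult a q) y v) \<approx> y (imul a (poly_map q y v))" by (intro ops_cong[OF y] pCons opsB[OF i] gB)
  also have "\<dots> \<approx> imul a (y (poly_map q y v))" by (intro ops_commute y i gB)
  finally have "imul a (imul c v) + y (poly_map (smult a q) y v) \<approx> imul a (imul c v) + imul a (y (poly_map q y v))"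
    by (intro eqv_add opsB[OF i] v eqv_refl)
  also have "\<dots> \<approx> imul a (imul c v + y (poly_map q y v))"
    by (intro eqv_sym[OF ops_add[OF i]] opsB[OF i] v yB gB)
  finally show ?case by (simp add: poly_map_pCons[of y, OF y0] imul_mult)
qed

lemma poly_map_mult:
  assumes y: "ops N y" and v: "v \<in> B"
  shows "poly_map (p * q) y v \<approx> poly_map p y (poly_map q y v)"
proof (induction p)
  case (pCons a p)
  note y0 = ops_at_0[OF y] and gB = opsB[OF ops_poly_map[OF y] v] and yB = opsB[OF y] and i = ops_imul[OF N0]
  have "poly_map (smult a q + pCons 0 (p * q)) y v \<approx> poly_map (smult a q) y v + poly_map (pCons 0 (p * q)) y v"
    by (rule poly_map_add[OF y v])
  also have "\<dots> = poly_map (smult a q) y v + y (poly_map (p * q) y v)" by (simp add: poly_map_pCons[of y, OF y0])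
  also have "\<dots> \<approx> imul a (poly_map q y v) + y (poly_map p y (poly_map q y v))"
    by (intro eqv_add poly_map_smult[OF y v] ops_cong[OF y] pCons opsB[OF i] opsB[OF ops_poly_map[OF y]] v)
  finally show ?case by (simp add: poly_map_pCons[of y, OF y0])
qed simp

text \<open>The subgroups spanned modulo \<open>C\<close> by \<open>v, y v, \<dots>, y\<^sup>m v\<close> stabilise, and equality of two
  consecutive ones is a monic relation.\<close>

lemma monic_annihilator_vector:
  assumes G: "noeth G" "B \<subseteq> G" and y: "ops N y" and v: "v \<in> B"
  shows "\<exists>p. lead_coeff p = 1 \<and> poly_map p y v \<in> C"
proof -
  define H where "H m = {b \<in> B. \<exists>q. (\<forall>i\<ge>m. coeff q i = 0) \<and> b \<approx> poly_map q y v}" for m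
  have gB: "poly_map q y v \<in> B" for q by (rule opsB[OF ops_poly_map[OF y] v])
  obtain m where m: "H (Suc m) = H m"
  proof (rule noeth_chain_stable[OF G(1), of H])
    show "subgp (H n)" for n
    proof (rule subgpI)
      show "0 \<in> H n" unfolding H_def using subgp_zero[OF subB]
        by (intro CollectI conjI exI[of _ 0]) simp_all
    next
      fix a b assume "a \<in> H n" "b \<in> H n"
      then obtain p q where pq: "a \<in> B" "b \<in> B" "\<forall>i\<ge>n. coeff p i = 0" "\<forall>i\<ge>n. coeff q i = 0"
        "a \<approx> poly_map p y v" "b \<approx> poly_map q y v" unfolding H_def by blast
      have "a + b \<approx> poly_map p y v + poly_map q y v" by (intro eqv_add gB pq)
      also have "\<dots> \<approx> poly_map (p + q) y v" by (rule eqv_sym[OF poly_map_add[OF y v]])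
      finally show "a + b \<in> H n" unfolding H_def using pq addB
        by (intro CollectI conjI exI[of _ "p + q"]) simp_all
    next
      fix a assume "a \<in> H n"
      then obtain p where p: "a \<in> B" "\<forall>i\<ge>n. coeff p i = 0" "a \<approx> poly_map p y v" unfolding H_def by blast
      have "- a \<approx> - poly_map p y v" by (intro eqv_minus gB p)
      also have "\<dots> = imul (-1) (poly_map p y v)" by (simp only: imul_neg imul_one)
      also have "\<dots> \<approx> poly_map (smult (-1) p) y v" by (rule eqv_sym[OF poly_map_smult[OF y v]])
      finally show "- a \<in> H n" unfolding H_def using p minusB
        by (intro CollectI conjI exI[of _ "smult (-1) p"]) simp_all
    qed
    show "H n \<subseteq> G" for n using G(2) by (auto simp: H_def)
    show "H n \<subseteq> H (Suc n)" for n unfolding H_def by (auto intro!: exI)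
  qed
  have "poly_map (monom 1 m) y v \<in> H (Suc m)"
    unfolding H_def using gB by (intro CollectI conjI exI[of _ "monom 1 m"]) simp_all
  then obtain q where q: "\<forall>i\<ge>m. coeff q i = 0" "poly_map (monom 1 m) y v \<approx> poly_map q y v"
    unfolding m unfolding H_def by blast
  define p where "p = monom 1 m + smult (-1) q"
  have "poly_map p y v \<approx> poly_map (monom 1 m) y v + poly_map (smult (-1) q) y v" unfolding p_def by (rule poly_map_add[OF y v])
  also have "\<dots> \<approx> poly_map q y v + imul (-1) (poly_map q y v)" by (intro eqv_add gB q poly_map_smult[OF y v])
  also have "\<dots> = 0" by (simp add: imul_neg)
  finally have "poly_map p y v \<in> C" by (simp add: eqv_zero)
  moreover have "coeff p m = 1" "\<forall>i>m. coeff p i = 0" using q(1) by (auto simp: p_def)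
  then have "degree p = m"
    by (metis degree_le le_degree le_antisym zero_neq_one)
  then have "lead_coeff p = 1" using \<open>coeff p m = 1\<close> by simp
  ultimately show ?thesis by blast
qed

text \<open>Polynomials in one operator commute modulo \<open>C\<close>, so the product of
  annihilators of finitely many generators of \<open>B\<close> kills them all, and the elements
  killed form a subgroup.\<close>

lemma monic_annihilator:
  assumes G: "noeth G" "B \<subseteq> G" and y: "ops N y"
  shows "\<exists>p. lead_coeff p = 1 \<and> (\<forall>b\<in>B. poly_map p y b \<in> C)"
proof -
  obtain S where S: "finite S" "S \<subseteq> B" "gen S = B" using noeth_fg[OF G(1) subB G(2)] by metis
  have "\<exists>p. lead_coeff p = 1 \<and> (\<forall>b\<in>S. poly_map p y b \<in> C)"
    using S(1,2)
  proof (induction S)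
    case empty
    show ?case by (intro exI[of _ 1]) simp
  next
    case (insert s S)
    then obtain p where p: "lead_coeff p = 1" "\<And>b. b \<in> S \<Longrightarrow> poly_map p y b \<in> C" by auto
    obtain q where q: "lead_coeff q = 1" "poly_map q y s \<in> C"
      using monic_annihilator_vector[OF G y] insert.prems by blast
    have "poly_map (p * q) y b \<in> C" if "b \<in> insert s S" for b
    proof (cases "b = s")
      case True
      then have "poly_map p y (poly_map q y b) \<in> C" using opsC[OF ops_poly_map[OF y]] q(2) by simp
      then show ?thesis using eqv_mem[OF poly_map_mult[OF y]] insert.prems True by auto
    next
      case False
      then have b: "b \<in> S" "b \<in> B" using that insert.prems by auto
      then have "poly_map q y (poly_map p y b) \<in> C" using opsC[OF ops_poly_map[OF y]] p(2) by simp
      then show ?thesis using eqv_mem[OF poly_map_mult[OF y b(2), of q p]] by (simp add: mult.commute)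
    qed
    moreover have "lead_coeff (p * q) = 1" using p q by (simp add: lead_coeff_mult)
    ultimately show ?case by blast
  qed
  then obtain p where p: "lead_coeff p = 1" "\<And>b. b \<in> S \<Longrightarrow> poly_map p y b \<in> C" by auto
  note g = ops_poly_map[OF y, of p]
  have "subgp {b \<in> B. poly_map p y b \<in> C}"
  proof (rule subgpI)
    show "0 \<in> {b \<in> B. poly_map p y b \<in> C}" using subgp_zero[OF subB] subgp_zero[OF subC] ops_at_0[OF g] by simp
    show "a + b \<in> {b \<in> B. poly_map p y b \<in> C}" if "a \<in> {b \<in> B. poly_map p y b \<in> C}" "b \<in> {b \<in> B. poly_map p y b \<in> C}" for a b
      using that eqv_mem[OF ops_add[OF g, of a b]] addB subgp_add[OF subC] by simp
    show "- a \<in> {b \<in> B. poly_map p y b \<in> C}" if "a \<in> {b \<in> B. poly_map p y b \<in> C}" for a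
      using that eqv_mem[OF ops_minus[OF g, of a]] minusB subgp_minus[OF subC] by simp
  qed
  then have "B \<subseteq> {b \<in> B. poly_map p y b \<in> C}" using gen_least[of _ S] S p by blast
  then show ?thesis using p(1) by blast
qed

text \<open>Take an operator \<open>r\<close> on \<open>B\<close> with maximal kernel modulo \<open>W\<close>: composing with another
  operator then either enlarges the kernel to all of \<open>B\<close> or leaves it unchanged.\<close>

lemma prime_refinement:
  assumes G: "noeth G" "B \<subseteq> G" and BN: "B \<subseteq> N"
    and W: "subgp W" "\<And>x w. x \<in> N \<Longrightarrow> w \<in> W \<Longrightarrow> conjg x w \<in> W" "C \<subseteq> W" "\<not> B \<subseteq> W"
  obtains W' r where "ops N r" "W' = {w + r b |w b. w \<in> W \<and> b \<in> B}" "\<not> W' \<subseteq> W" "prime_section N W W'"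
proof -
  define ker where "ker r = {b \<in> B. r b \<in> W}" for r
  have eqW: "a \<approx> b \<Longrightarrow> a \<in> W \<longleftrightarrow> b \<in> W" for a b
    using W(3) subgp_add_iff'[OF W(1)] subgp_add_iff[OF W(1), of "a - b" b] by (auto simp: eqv_def)
  have opsW: "ops N r \<Longrightarrow> w \<in> W \<Longrightarrow> r w \<in> W" for r w using ops_closed W(1,2) by blast
  let ?\<S> = "{ker r |r. ops N r \<and> \<not> r ` B \<subseteq> W}"
  obtain K where K: "K \<in> ?\<S>" "\<And>H. H \<in> ?\<S> \<Longrightarrow> K \<subseteq> H \<Longrightarrow> H = K"
  proof (rule noeth_maximal[OF G(1), of "ker (\<lambda>v. v)" ?\<S>])
    show "ker (\<lambda>v. v) \<in> ?\<S>" using W(4) ops_id[OF N0] by (intro CollectI exI[of _ "\<lambda>v. v"]) auto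
    show "H \<subseteq> G" if "H \<in> ?\<S>" for H using that G(2) by (auto simp: ker_def)
    show "subgp H" if "H \<in> ?\<S>" for H
    proof -
      obtain r where r: "ops N r" "H = ker r" using \<open>H \<in> ?\<S>\<close> by blast
      show ?thesis unfolding r(2) ker_def
      proof (rule subgpI)
        show "0 \<in> {b \<in> B. r b \<in> W}" using subgp_zero[OF subB] subgp_zero[OF W(1)] ops_at_0[OF r(1)] by simp
        show "a + b \<in> {b \<in> B. r b \<in> W}" if "a \<in> {b \<in> B. r b \<in> W}" "b \<in> {b \<in> B. r b \<in> W}" for a b
          using that eqW[OF ops_add[OF r(1), of a b]] addB subgp_add[OF W(1)] by simp
        show "- a \<in> {b \<in> B. r b \<in> W}" if "a \<in> {b \<in> B. r b \<in> W}" for a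
          using that eqW[OF ops_minus[OF r(1), of a]] minusB subgp_minus[OF W(1)] by simp
      qed
    qed
  qed (rule that)
  obtain r0 where r0: "ops N r0" "K = ker r0" "\<not> r0 ` B \<subseteq> W" using K(1) by blast
  define W' where "W' = {w + r0 b |w b. w \<in> W \<and> b \<in> B}"
  have mem: "r (w + r0 b) \<in> W \<longleftrightarrow> r0 (r b) \<in> W" if r: "ops N r" and "w \<in> W" "b \<in> B" for r w b
  proof -
    have "r (w + r0 b) - r (r0 b) \<in> W"
      using that BN opsB[OF r0(1)] by (intro ops_mod[OF r W(1,2) subN]) auto
    then have "r (w + r0 b) \<in> W \<longleftrightarrow> r (r0 b) \<in> W"
      using subgp_add_iff[OF W(1), of "r (w + r0 b) - r (r0 b)" "r (r0 b)"] by simp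
    also have "\<dots> \<longleftrightarrow> r0 (r b) \<in> W" using eqW[OF ops_commute[OF r r0(1)]] that by blast
    finally show ?thesis .
  qed
  have "(\<forall>v\<in>W'. r v \<in> W) \<or> (\<forall>v\<in>W'. r v \<in> W \<longrightarrow> v \<in> W)" if r: "ops N r" for r
  proof (cases "(\<lambda>v. r0 (r v)) ` B \<subseteq> W")
    case True
    then show ?thesis using mem[OF r] unfolding W'_def by blast
  next
    case False
    have "K \<subseteq> ker (\<lambda>v. r0 (r v))"
    proof
      fix k assume "k \<in> K"
      then have k: "k \<in> B" "r0 k \<in> W" by (auto simp: r0(2) ker_def)
      then have "r (r0 k) \<in> W" using opsW[OF r] by blast
      then show "k \<in> ker (\<lambda>v. r0 (r v))" using k eqW[OF ops_commute[OF r r0(1)]] by (simp add: ker_def)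
    qed
    moreover have "ker (\<lambda>v. r0 (r v)) \<in> ?\<S>" using ops_comp[OF r0(1) r] False by blast
    ultimately have eq: "ker (\<lambda>v. r0 (r v)) = ker r0" using K(2) r0(2) by blast
    have "v \<in> W" if v: "v \<in> W'" "r v \<in> W" for v
    proof -
      obtain w b where wb: "v = w + r0 b" "w \<in> W" "b \<in> B" using v(1) unfolding W'_def by blast
      then have "b \<in> ker r0" using mem[OF r wb(2,3)] v(2) eq unfolding ker_def by auto
      then show ?thesis using wb subgp_add[OF W(1)] by (simp add: ker_def)
    qed
    then show ?thesis by blast
  qed
  moreover have "\<not> W' \<subseteq> W"
  proof -
    obtain b where b: "b \<in> B" "r0 b \<notin> W" using r0(3) by blast
    have "0 + r0 b \<in> W'" unfolding W'_def using b(1) subgp_zero[OF W(1)] by blast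
    then show ?thesis using b(2) by auto
  qed
  ultimately show ?thesis using that[OF r0(1) W'_def] unfolding prime_section_def by blast
qed

end

section \<open>Nilpotent-by-abelian subgroups of finite index\<close>

primrec upper_central :: "'g::group_add set \<Rightarrow> nat \<Rightarrow> 'g set" where
  "upper_central E 0 = {0}"
| "upper_central E (Suc n) = {z \<in> E. \<forall>e\<in>E. comm e z \<in> upper_central E n}"

lemma upper_central_conjg: "conjg x ` E = E \<Longrightarrow> conjg x ` upper_central E n = upper_central E n"
proof (induction n)
  case (Suc n)
  have *: "conjg a z \<in> upper_central E (Suc n)"
    if a: "conjg a ` E = E" "conjg a ` upper_central E n = upper_central E n" and z: "z \<in> upper_central E (Suc n)" for a z
  proof -
    have "comm e (conjg a z) \<in> upper_central E n" if e: "e \<in> E" for e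
    proof -
      have "conjg (- a) e \<in> E" using a(1) e by (simp add: conjg_image_eq_iff)
      then have "comm (conjg (- a) e) z \<in> upper_central E n" using z by simp
      then have "conjg a (comm (conjg (- a) e) z) \<in> upper_central E n" using a(2) by blast
      then show ?thesis by (simp add: conjg_comm)
    qed
    moreover have "conjg a z \<in> E" using a(1) z by auto
    ultimately show ?thesis by simp
  qed
  have IH: "conjg x ` upper_central E n = upper_central E n" using Suc by blast
  show ?case unfolding conjg_image_eq_iff
    using *[OF Suc.prems IH] *[OF conjg_image_minus[OF Suc.prems] conjg_image_minus[OF IH]] by blast
qed simp

lemma upper_central_subgp: "subgp E \<Longrightarrow> subgp (upper_central E n) \<and> upper_central E n \<subseteq> E"
proof (induction n)
  case 0
  then show ?case by (simp add: subgp_zero)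
next
  case (Suc n)
  then have Z: "subgp (upper_central E n)" by blast
  have inv: "conjg a z \<in> upper_central E n" if "a \<in> E" "z \<in> upper_central E n" for a z
    using upper_central_conjg[OF conjg_image_self[OF Suc.prems that(1)], of n] that(2) by blast
  have "subgp (upper_central E (Suc n))"
  proof (rule subgpI)
    show "0 \<in> upper_central E (Suc n)" using subgp_zero[OF Suc.prems] subgp_zero[OF Z] by simp
    show "a + b \<in> upper_central E (Suc n)" if "a \<in> upper_central E (Suc n)" "b \<in> upper_central E (Suc n)" for a b
      using that inv subgp_add[OF Suc.prems] subgp_add[OF Z] by (simp add: comm_add_right)
    show "- a \<in> upper_central E (Suc n)" if "a \<in> upper_central E (Suc n)" for a
      using that inv subgp_minus[OF Suc.prems] subgp_minus[OF Z] by (simp add: comm_minus_right)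
  qed
  then show ?case by auto
qed

lemma upper_central_Suc: "subgp E \<Longrightarrow> upper_central E n \<subseteq> upper_central E (Suc n)"
proof
  fix z assume E: "subgp E" and z: "z \<in> upper_central E n"
  note Z = upper_central_subgp[OF E, of n]
  have "comm e z \<in> upper_central E n" if "e \<in> E" for e
    using upper_central_conjg[OF conjg_image_self[OF E that], of n] z subgp_diff[OF conjunct1[OF Z]]
    by (auto simp: comm_conjg)
  then show "z \<in> upper_central E (Suc n)" using z Z by auto
qed

lemma nilp_subgp: "nilp D \<Longrightarrow> subgp D"
  unfolding nilp_def by metis

lemma nilp_upper_central: "nilp E \<Longrightarrow> \<exists>c. upper_central E c = E"
proof -
  assume nil: "nilp E"
  then obtain W q where W: "W 0 = {0}" "W q = E" "\<forall>a. subgp (W a)" "\<forall>a<q. W a \<subseteq> W (Suc a)"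
    "\<forall>a<q. \<forall>w\<in>W (Suc a). \<forall>d\<in>E. comm d w \<in> W a"
    unfolding nilp_def by (elim exE conjE) (rule that)
  have sub: "W a \<subseteq> E" if "a \<le> q" for a
    using that by (induction rule: inc_induct) (use W(2,4) in auto)
  have "W a \<subseteq> upper_central E a" if "a \<le> q" for a
    using that
  proof (induction a)
    case (Suc a)
    then show ?case using W(5) sub[of "Suc a"] by (auto simp: subset_iff)
  qed (simp add: W)
  then show ?thesis using W(2) upper_central_subgp[OF nilp_subgp[OF nil], of q] by blast
qed

lemma nilp_subset: "nilp D \<Longrightarrow> subgp L \<Longrightarrow> L \<subseteq> D \<Longrightarrow> nilp L"
proof -
  assume nil: "nilp D" and L: "subgp L" "L \<subseteq> D"
  then obtain W q where W: "W 0 = {0}" "W q = D" "\<forall>a. subgp (W a)" "\<forall>a<q. W a \<subseteq> W (Suc a)"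
    "\<forall>a<q. \<forall>w\<in>W (Suc a). \<forall>d\<in>D. comm d w \<in> W a"
    unfolding nilp_def by (elim exE conjE) (rule that)
  show ?thesis unfolding nilp_def
  proof (intro exI[of _ "\<lambda>a. W a \<inter> L"] exI[of _ q] conjI allI impI ballI)
    show "W 0 \<inter> L = {0}" using W(1) subgp_zero[OF L(1)] by simp
    show "W q \<inter> L = L" using W(2) L(2) by blast
    show "subgp (W a \<inter> L)" for a using W(3) L(1) subgp_Int by blast
    show "W a \<inter> L \<subseteq> W (Suc a) \<inter> L" if "a < q" for a using W(4) that by blast
    show "comm d w \<in> W a \<inter> L" if "a < q" "w \<in> W (Suc a) \<inter> L" "d \<in> L" for a w d
      using that W(5) L subgp_comm[OF L(1)] by blast
  qed
qed

text \<open>A term \<open>W'\<close> above \<open>W\<close> is admissible if the section \<open>W'/W\<close> is prime, centralised by \<open>E\<close>, and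
  the conjugates of an element of \<open>N\<close> under the powers of \<open>t\<close> take finitely many values on it.\<close>

definition admissible :: "'g::group_add set \<Rightarrow> 'g set \<Rightarrow> 'g \<Rightarrow> 'g set \<Rightarrow> 'g set \<Rightarrow> bool" where
  "admissible N E t W W' \<longleftrightarrow> subgp W' \<and> W \<subseteq> W' \<and> W' \<subseteq> E \<and> (\<forall>x\<in>N. \<forall>w\<in>W'. conjg x w \<in> W') \<and>
     prime_section N W W' \<and> (\<forall>x\<in>E. \<forall>w\<in>W'. comm x w \<in> W) \<and>
     (\<forall>x\<in>N. \<forall>J. infinite J \<longrightarrow> (\<exists>J'\<subseteq>J. infinite J' \<and> (\<forall>i\<in>J'. \<forall>j\<in>J'. \<forall>w\<in>W'.
        conjg (conjg (imul (int i) t) x) w - conjg (conjg (imul (int j) t) x) w \<in> W)))"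

section \<open>Powers of \<open>t\<close> that centralise \<open>N\<close> modulo a nilpotent
  subgroup\<close>

locale malcev =
  fixes G N E :: "'g::group_add set" and t :: 'g
  assumes G: "noeth G" "N \<subseteq> G" and N: "subgp N" and E: "subgp E" "E \<subseteq> N" "nilp E"
    and EN: "x \<in> N \<Longrightarrow> e \<in> E \<Longrightarrow> conjg x e \<in> E"
    and der: "x \<in> N \<Longrightarrow> y \<in> N \<Longrightarrow> comm x y \<in> E"
    and t: "conjg t ` N = N" "conjg t ` E = E"
begin

lemma conjg_EN: "x \<in> N \<Longrightarrow> conjg x ` E = E"
  using EN subgp_minus[OF N] by (simp add: conjg_image_eq_iff)

text \<open>Let \<open>B\<close> over \<open>C\<close> be the first upper central factor of
  \<open>E\<close> whose upper term is not contained in \<open>W\<close>. \<open>E\<close>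
  centralises it, so \<open>N\<close> acts through commuting operators, and
  \<open>prime_refinement\<close> yields \<open>W' = W + r B\<close>. Since \<open>r\<close>
  commutes with conjugation modulo \<open>C\<close>, stability under \<open>N\<close>,
  centralisation by \<open>E\<close> and annihilating polynomials pass from \<open>B\<close> to
  \<open>W'\<close>.\<close>

lemma admissible_exists:
  assumes W: "subgp W" "W \<subseteq> E" "W \<noteq> E" "\<And>x w. x \<in> N \<Longrightarrow> w \<in> W \<Longrightarrow> conjg x w \<in> W"
  shows "\<exists>W'. admissible N E t W W' \<and> \<not> W' \<subseteq> W"
proof -
  let ?Z = "upper_central E"
  note Z = upper_central_subgp[OF E(1)]
  obtain c where "?Z c = E" using nilp_upper_central[OF E(3)] by blast
  then have ex: "\<not> ?Z c \<subseteq> W" using W(2,3) by blast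
  define l where "l = (LEAST c. \<not> ?Z c \<subseteq> W)"
  have l: "\<not> ?Z l \<subseteq> W" unfolding l_def by (rule LeastI[of _ c]) (rule ex)
  then have "l \<noteq> 0" using subgp_zero[OF W(1)] by (intro notI) simp
  then obtain k where k: "l = Suc k" using not0_implies_Suc by blast
  have ZkW: "?Z k \<subseteq> W" using not_less_Least[of k "\<lambda>c. \<not> ?Z c \<subseteq> W"] k l_def by auto
  define B where "B = ?Z (Suc k)"
  define C where "C = ?Z k"
  have BE: "B \<subseteq> E" unfolding B_def using Z by blast
  have EB: "comm e b \<in> C" if "e \<in> E" "b \<in> B" for e b using that unfolding B_def C_def by simp
  have invZ: "conjg x z \<in> ?Z n" if "x \<in> N" "z \<in> ?Z n" for x z n
    using upper_central_conjg[OF conjg_EN[OF that(1)]] that(2) by blast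
  interpret s: abelian_section N B C
  proof
    show "subgp N" "subgp B" "subgp C" "C \<subseteq> B"
      using N Z upper_central_Suc[OF E(1)] unfolding B_def C_def by blast+
    show "x \<in> N \<Longrightarrow> b \<in> B \<Longrightarrow> conjg x b \<in> B" "x \<in> N \<Longrightarrow> b \<in> C \<Longrightarrow> conjg x b \<in> C" for x b
      unfolding B_def C_def by (fact invZ)+
    show "a \<in> B \<Longrightarrow> b \<in> B \<Longrightarrow> comm a b \<in> C" for a b using EB BE by blast
    show "x \<in> N \<Longrightarrow> y \<in> N \<Longrightarrow> b \<in> B \<Longrightarrow> comm (comm x y) b \<in> C" for x y b using EB der by blast
  qed
  have BN: "B \<subseteq> N" "B \<subseteq> G" using BE E(2) G(2) by auto
  have CW: "C \<subseteq> W" using ZkW by (simp add: C_def)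
  have BW: "\<not> B \<subseteq> W" using l by (simp add: B_def k)
  obtain W' r where r: "ops N r" and W': "W' = {w + r b |w b. w \<in> W \<and> b \<in> B}"
    and new: "\<not> W' \<subseteq> W" and prime: "prime_section N W W'"
    by (rule s.prime_refinement[OF G(1) BN(2,1) W(1,4) CW BW])
  have sub: "W \<subseteq> W'"
  proof
    fix w assume "w \<in> W"
    then have "w + r 0 \<in> W'" unfolding W' using subgp_zero[OF s.subB] by blast
    then show "w \<in> W'" by (simp add: ops_at_0[OF r])
  qed
  have CW': "c + r b \<in> W'" if "c \<in> W" "b \<in> B" for c b using that W' by blast
  have rE: "r b \<in> E" if "b \<in> B" for b using s.opsB[OF r that] BE by blast
  have eqW': "w + u \<in> W'" if "w \<in> W" "s.eqv u (r b)" "b \<in> B" for w u b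
  proof -
    have "(w + (u - r b)) + r b \<in> W'"
      using that CW s.eqv_def by (intro CW' subgp_add[OF W(1)]) auto
    then show ?thesis by (simp add: add.assoc)
  qed
  have W'E: "W' \<subseteq> E" using W' W(2) rE subgp_add[OF E(1)] by blast
  have inv: "conjg x w \<in> W'" if x: "x \<in> N" and w: "w \<in> W'" for x w
  proof -
    obtain v b where vb: "v \<in> W" "b \<in> B" "w = v + r b" using w W' by blast
    have "conjg x v + conjg x (r b) \<in> W'"
      by (rule eqW'[OF W(4)[OF x vb(1)] s.ops_commute_conjg[OF r x vb(2)] s.invB[OF x vb(2)]])
    then show ?thesis using vb(3) by (simp add: conjg_add)
  qed
  have W'sub: "subgp W'"
  proof (rule subgpI)
    show "0 \<in> W'" using sub subgp_zero[OF W(1)] by blast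
    show "a + a' \<in> W'" if a: "a \<in> W'" "a' \<in> W'" for a a'
    proof -
      obtain v b v' b' where vb: "v \<in> W" "b \<in> B" "a = v + r b" "v' \<in> W" "b' \<in> B" "a' = v' + r b'"
        using a W' by blast
      have "v + conjg (r b) v' \<in> W"
        using vb rE E(2) W(4) subgp_add[OF W(1)] by blast
      then have "(v + conjg (r b) v') + (r b + r b') \<in> W'"
        by (rule eqW'[OF _ s.eqv_sym[OF s.ops_add[OF r vb(2,5)]] s.addB[OF vb(2,5)]])
      moreover have "(v + conjg (r b) v') + (r b + r b') = a + a'"
        using vb by (simp add: conjg_def group_word_simps del: add_uminus_conv_diff)
      ultimately show ?thesis by simp
    qed
    show "- a \<in> W'" if a: "a \<in> W'" for a
    proof -
      obtain v b where vb: "v \<in> W" "b \<in> B" "a = v + r b" using a W' by blast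
      have "- r b \<in> N" using rE[OF vb(2)] E(2) subgp_minus[OF N] by blast
      then have "conjg (- r b) (- v) \<in> W" using W(4) subgp_minus[OF W(1) vb(1)] by blast
      then have "conjg (- r b) (- v) + - r b \<in> W'"
        by (rule eqW'[OF _ s.eqv_sym[OF s.ops_minus[OF r vb(2)]] s.minusB[OF vb(2)]])
      moreover have "conjg (- r b) (- v) + - r b = - a"
        using vb by (simp add: conjg_def group_word_simps del: add_uminus_conv_diff)
      ultimately show ?thesis by simp
    qed
  qed
  have triv: "comm x w \<in> W" if x: "x \<in> E" and w: "w \<in> W'" for x w
  proof -
    obtain v b where vb: "v \<in> W" "b \<in> B" "w = v + r b" using w W' by blast
    have "comm x (r b) \<in> W" using EB[OF x s.opsB[OF r vb(2)]] CW by blast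
    moreover have "comm x v \<in> W" using W(4) x E(2) vb(1) subgp_diff[OF W(1)] by (auto simp: comm_conjg)
    ultimately show ?thesis
      using vb W(2,4) E(2) subgp_add[OF W(1)] by (auto simp: comm_add_right)
  qed
  interpret q: abelian_section N W' W
  proof
    show "comm a b \<in> W" if "a \<in> W'" "b \<in> W'" for a b using triv[OF _ that(2)] that(1) W'E by blast
    show "comm (comm x y) b \<in> W" if "x \<in> N" "y \<in> N" "b \<in> W'" for x y b
      using triv[OF der[OF that(1,2)] that(3)] .
  qed (fact N W'sub W(1) sub inv W(4))+
  have "\<exists>J'\<subseteq>J. infinite J' \<and> (\<forall>i\<in>J'. \<forall>j\<in>J'. \<forall>w\<in>W'.
        conjg (conjg (imul (int i) t) x) w - conjg (conjg (imul (int j) t) x) w \<in> W)"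
    if x: "x \<in> N" and J: "infinite J" for x J
  proof -
    let ?x = "\<lambda>j. conjg (imul (int j) t) x"
    have xN: "?x j \<in> N" for j using conjg_image_imul[OF t(1)] x by blast
    \<comment> \<open>The polynomial is taken on \<open>B\<close> over \<open>C\<close>: these terms
      are stable under \<open>t\<close>, so it serves for all conjugates of \<open>x\<close>,
      whereas \<open>W\<close> and \<open>W'\<close> may fail to be stable under
      \<open>t\<close>.\<close>
    obtain p where p: "lead_coeff p = 1" "\<And>b. b \<in> B \<Longrightarrow> poly_map p (conjg x) b \<in> C"
      using s.monic_annihilator[OF G(1) BN(2) ops_conjg[OF x]] by blast
    have pj: "poly_map p (conjg (?x j)) b \<in> C" if b: "b \<in> B" for b j
    proof -
      note tZ = conjg_image_imul[OF upper_central_conjg[OF t(2)], of "int j"]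
      have "conjg (- imul (int j) t) b \<in> B" using tZ[unfolded conjg_image_eq_iff] b unfolding B_def by blast
      then have "conjg (imul (int j) t) (poly_map p (conjg x) (conjg (- imul (int j) t) b)) \<in> C"
        using p(2) tZ unfolding C_def by blast
      then show ?thesis by (simp add: poly_map_conjg)
    qed
    obtain v where v: "v \<in> W'" "v \<notin> W" using new by blast
    let ?cs = "map imul (coeffs p) :: ('g \<Rightarrow> 'g) list"
    have "\<exists>J'\<subseteq>J. infinite J' \<and> (\<exists>i. \<forall>j\<in>J'. \<forall>w\<in>W'. conjg (?x j) w - conjg (?x i) w \<in> W)"
    proof (rule q.prime_roots_finite[OF prime v, of ?x ?cs])
      show "?x j \<in> N" for j by (rule xN)
      show "ops N c" if "c \<in> set ?cs" for c using that ops_imul[OF s.N0] by auto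
      have "p \<noteq> 0" using p(1) by auto
      then show "?cs \<noteq> []" by simp
      have "last ?cs = imul 1" using \<open>p \<noteq> 0\<close> p(1) by (simp add: last_map last_coeffs_eq_coeff_degree)
      then show "last ?cs = (\<lambda>v. v)" by (simp add: fun_eq_iff)
      show "infinite J" by (rule J)
      show "horner ?cs (conjg (?x j)) v \<in> W" if "j \<in> J" for j
      proof -
        obtain w b where wb: "w \<in> W" "b \<in> B" "v = w + r b" using v(1) W' by blast
        note g = s.ops_poly_map[OF ops_conjg[OF xN[of j]], of p]
        have "poly_map p (conjg (?x j)) (w + r b) - poly_map p (conjg (?x j)) (r b) \<in> W"
          using rE[OF wb(2)] E(2) wb(1) by (intro ops_mod[OF g W(1,4) N]) auto
        moreover have "poly_map p (conjg (?x j)) (r b) \<in> W" using pj[OF s.opsB[OF r wb(2)]] CW by blast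
        ultimately have "poly_map p (conjg (?x j)) v \<in> W" using subgp_add[OF W(1)] wb(3) by fastforce
        then show ?thesis by (simp add: poly_map_def)
      qed
    qed
    then obtain J' i where J': "J' \<subseteq> J" "infinite J'" "\<forall>j\<in>J'. \<forall>w\<in>W'. conjg (?x j) w - conjg (?x i) w \<in> W"
      by (elim exE conjE) (rule that)
    have "conjg (?x j) w - conjg (?x k) w \<in> W" if "j \<in> J'" "k \<in> J'" "w \<in> W'" for j k w
    proof -
      have "q.eqv (conjg (?x j) w) (conjg (?x i) w)" "q.eqv (conjg (?x i) w) (conjg (?x k) w)"
        using J'(3) that q.eqv_def q.eqv_sym by auto
      then show ?thesis using q.eqv_trans q.eqv_def by blast
    qed
    then show ?thesis using J'(1,2) by (intro exI[of _ J'] conjI ballI) auto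
  qed
  then have "admissible N E t W W'"
    unfolding admissible_def using W'sub sub W'E inv prime triv by simp
  then show ?thesis using new by blast
qed

end

inductive reachable :: "'g::group_add set \<Rightarrow> 'g set \<Rightarrow> 'g \<Rightarrow> 'g set \<Rightarrow> bool" for N E t where
  reachable_zero: "reachable N E t {0}"
| reachable_step: "reachable N E t W \<Longrightarrow> admissible N E t W W' \<Longrightarrow> reachable N E t W'"

context malcev
begin

lemma reachable_props: "reachable N E t W \<Longrightarrow> subgp W \<and> W \<subseteq> E \<and> (\<forall>x\<in>N. \<forall>w\<in>W. conjg x w \<in> W)"
  by (induction rule: reachable.induct) (auto simp: admissible_def subgp_zero[OF E(1)])

lemma reachable_top: "reachable N E t E"
proof -
  let ?\<S> = "{W. reachable N E t W}"
  obtain W where W: "W \<in> ?\<S>" "\<And>W'. W' \<in> ?\<S> \<Longrightarrow> W \<subseteq> W' \<Longrightarrow> W' = W"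
  proof (rule noeth_maximal[OF G(1), of "{0}" ?\<S>])
    show "{0} \<in> ?\<S>" by (simp add: reachable_zero)
    show "subgp W" if "W \<in> ?\<S>" for W using reachable_props that by blast
    show "W \<subseteq> G" if "W \<in> ?\<S>" for W using reachable_props[of W] that E(2) G(2) by auto
  qed (rule that)
  have r: "reachable N E t W" using W(1) by simp
  have "W = E"
  proof (rule ccontr)
    assume "W \<noteq> E"
    then obtain W' where W': "admissible N E t W W'" "\<not> W' \<subseteq> W"
      using admissible_exists[of W] reachable_props[OF r] by blast
    then have "W' = W" using r by (intro W(2)) (auto simp: admissible_def intro: reachable_step)
    then show False using W'(2) by simp
  qed
  then show ?thesis using r by simp
qed

lemma reachable_chain:
  "reachable N E t W \<Longrightarrow> \<exists>V q. V 0 = {0} \<and> V q = W \<and> (\<forall>a. reachable N E t (V a)) \<and>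
     (\<forall>a<q::nat. admissible N E t (V a) (V (Suc a)))"
proof (induction rule: reachable.induct)
  case reachable_zero
  show ?case by (intro exI[of _ "\<lambda>_. {0}"] exI[of _ 0]) (simp add: reachable.reachable_zero)
next
  case (reachable_step W W')
  then obtain V q where V: "V 0 = {0}" "V q = W" "\<forall>a. reachable N E t (V a)"
    "\<forall>a<q::nat. admissible N E t (V a) (V (Suc a))"
    by (elim exE conjE) (rule that)
  have "reachable N E t W'" by (rule reachable.reachable_step[OF reachable_step.hyps])
  then show ?case using V reachable_step.hyps
    by (intro exI[of _ "\<lambda>a. if a \<le> q then V a else W'"] exI[of _ "Suc q"]) (auto simp: le_Suc_eq less_Suc_eq)
qed

text \<open>Unipotent action on \<open>E\<close>, phrased without a chain of sections so that
  conjugation by \<open>t\<close> visibly preserves it.\<close>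

definition stable :: "'g \<Rightarrow> bool" where
  "stable u \<longleftrightarrow> (\<exists>m. \<forall>e\<in>E. (comm u ^^ m) e = 0)"

lemma stable_conjg: "conjg s ` E = E \<Longrightarrow> stable u \<Longrightarrow> stable (conjg s u)"
proof -
  assume s: "conjg s ` E = E" and "stable u"
  then obtain m where m: "\<And>e. e \<in> E \<Longrightarrow> (comm u ^^ m) e = 0" unfolding stable_def by blast
  have *: "(comm (conjg s u) ^^ m) (conjg s e) = conjg s ((comm u ^^ m) e)" for e
    by (induction m) (simp_all add: conjg_comm)
  have "(comm (conjg s u) ^^ m) e = 0" if e: "e \<in> E" for e
  proof -
    have "conjg (- s) e \<in> E" using s e by (simp add: conjg_image_eq_iff)
    then show ?thesis using *[of "conjg (- s) e"] m by simp
  qed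
  then show ?thesis unfolding stable_def by blast
qed

lemma ops_commutator: "0 \<in> N \<Longrightarrow> u \<in> N \<Longrightarrow> ops N (comm u)"
proof -
  assume "0 \<in> N" "u \<in> N"
  then have "ops N (\<lambda>v. conjg u v + - v)" by (intro ops_plus ops_conjg ops_neg ops_id)
  moreover have "comm u = (\<lambda>v. conjg u v + - v)" by (rule ext) (simp add: comm_conjg)
  ultimately show ?thesis by simp
qed

text \<open>On a prime section the operator \<open>comm u\<close> is zero or injective, and if it is
  injective its powers never kill a vector outside the lower term. This turns \<open>stable\<close>
  into a condition that is closed under addition.\<close>

lemma stable_iff:
  assumes V: "V 0 = {0}" "V q = E" "\<And>a. reachable N E t (V a)"
    "\<And>a. a < q \<Longrightarrow> admissible N E t (V a) (V (Suc a))" and u: "u \<in> N"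
  shows "stable u \<longleftrightarrow> (\<forall>a<q. \<forall>w\<in>V (Suc a). comm u w \<in> V a)"
proof
  assume triv: "\<forall>a<q. \<forall>w\<in>V (Suc a). comm u w \<in> V a"
  have "a \<le> q \<Longrightarrow> \<forall>w\<in>V a. (comm u ^^ a) w = 0" for a
  proof (induction a)
    case (Suc a)
    then show ?case using triv by (simp add: funpow_swap1 del: funpow.simps add: funpow_Suc_right)
  qed (simp add: V(1))
  then show "stable u" unfolding stable_def using V(2) by blast
next
  assume "stable u"
  then obtain m where m: "\<And>e. e \<in> E \<Longrightarrow> (comm u ^^ m) e = 0" unfolding stable_def by blast
  show "\<forall>a<q. \<forall>w\<in>V (Suc a). comm u w \<in> V a"
  proof (intro allI impI)
    fix a assume a: "a < q"
    note P = reachable_props[OF V(3)]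
    have prime: "prime_section N (V a) (V (Suc a))" using V(4)[OF a] by (simp add: admissible_def)
    show "\<forall>w\<in>V (Suc a). comm u w \<in> V a"
    proof (rule ccontr)
      assume neg: "\<not> (\<forall>w\<in>V (Suc a). comm u w \<in> V a)"
      then have inj: "\<And>v. v \<in> V (Suc a) \<Longrightarrow> comm u v \<in> V a \<Longrightarrow> v \<in> V a"
        using prime ops_commutator[OF subgp_zero[OF N] u] unfolding prime_section_def by blast
      obtain v where v: "v \<in> V (Suc a)" "v \<notin> V a"
        using neg P subgp_diff u by (metis comm_conjg comm_minus inj)
      have "(comm u ^^ i) v \<in> V (Suc a) \<and> (comm u ^^ i) v \<notin> V a" for i
      proof (induction i)
        case (Suc i)
        then have "comm u ((comm u ^^ i) v) \<in> V (Suc a)"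
          unfolding comm_conjg using P[of "Suc a"] u by (intro subgp_diff) blast+
        then show ?case using Suc inj by auto
      qed (use v in simp)
      then have "(comm u ^^ m) v \<notin> V a" by blast
      moreover have "v \<in> E" using P v(1) by blast
      ultimately show False using m subgp_zero P by metis
    qed
  qed
qed

text \<open>\<open>U\<close> consists of the elements of \<open>N\<close> acting unipotently on
  \<open>E\<close>. Passing to an infinite set of exponents once per section leaves
  \<open>i < j\<close> for which the conjugates of \<open>x\<close> under these powers of
  \<open>t\<close> act alike on all sections; their difference then lies in \<open>U\<close>. A
  common multiple of such \<open>j - i\<close> serves finitely many generators at once.\<close>

lemma power_centralizes_modulo_nilpotent:
  obtains k U where "k > 0" "nilp U" "U \<subseteq> N" "E \<subseteq> U" "\<And>x. x \<in> N \<Longrightarrow> conjg x ` U = U" "conjg t ` U = U"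
    "\<And>x. x \<in> N \<Longrightarrow> comm (imul (int k) t) x \<in> U"
proof -
  obtain V q where V: "V 0 = {0}" "V q = E" "\<forall>a. reachable N E t (V a)"
    "\<forall>a<q::nat. admissible N E t (V a) (V (Suc a))"
    using reachable_chain[OF reachable_top] by (elim exE conjE) (rule that)
  note P = reachable_props[OF V(3)[rule_format]]
  have st: "stable u \<longleftrightarrow> (\<forall>a<q. \<forall>w\<in>V (Suc a). comm u w \<in> V a)" if "u \<in> N" for u
    using V(3,4) by (intro stable_iff[OF V(1,2) _ _ that]) auto
  define U where "U = {u \<in> N. stable u}"
  have U: "subgp U"
  proof (rule subgpI)
    have "0 \<in> V a" for a using P[of a] subgp_zero by blast
    then show "0 \<in> U" using subgp_zero[OF N] st[OF subgp_zero[OF N]] by (simp add: U_def)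
    show "u + v \<in> U" if "u \<in> U" "v \<in> U" for u v
    proof -
      have uv: "u \<in> N" "v \<in> N" "u + v \<in> N" using that subgp_add[OF N] by (auto simp: U_def)
      have "comm (u + v) w \<in> V a" if "a < q" "w \<in> V (Suc a)" for a w
        unfolding comm_add_left using that \<open>u \<in> U\<close> \<open>v \<in> U\<close> st uv P[of a]
        by (intro subgp_add) (auto simp: U_def)
      then show ?thesis using uv st by (simp add: U_def)
    qed
    show "- u \<in> U" if "u \<in> U" for u
    proof -
      have u: "u \<in> N" "- u \<in> N" using that subgp_minus[OF N] by (auto simp: U_def)
      have "comm (- u) w \<in> V a" if "a < q" "w \<in> V (Suc a)" for a w
        unfolding comm_minus_left using that \<open>u \<in> U\<close> st u P[of a]
        by (intro subgp_minus) (auto simp: U_def)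
      then show ?thesis using u st by (simp add: U_def)
    qed
  qed
  have EU: "E \<subseteq> U"
  proof
    fix e assume e: "e \<in> E"
    then have "\<forall>a<q. \<forall>w\<in>V (Suc a). comm e w \<in> V a" using V(4) unfolding admissible_def by blast
    then show "e \<in> U" using st e E(2) by (auto simp: U_def)
  qed
  have Uinv: "conjg s ` U = U" if s: "conjg s ` N = N" "conjg s ` E = E" for s
    using s stable_conjg[OF s(2)] stable_conjg[OF conjg_image_minus[OF s(2)]]
    unfolding conjg_image_eq_iff U_def by auto
  \<comment> \<open>The chain of sections reaches \<open>E\<close>, and one more step suffices since
    commutators of \<open>N\<close> lie in \<open>E\<close>.\<close>
  have nil: "nilp U" unfolding nilp_def
  proof (intro exI[of _ "\<lambda>a. if a \<le> q then V a else U"] exI[of _ "Suc q"] conjI allI impI ballI)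
    show "subgp (if a \<le> q then V a else U)" for a using P U by simp
    show "(if a \<le> q then V a else U) \<subseteq> (if Suc a \<le> q then V (Suc a) else U)" if "a < Suc q" for a
      using V(2,4) EU that by (auto simp: admissible_def less_Suc_eq subset_iff)
    show "comm d w \<in> (if a \<le> q then V a else U)"
      if "a < Suc q" "w \<in> (if Suc a \<le> q then V (Suc a) else U)" "d \<in> U" for a w d
    proof (cases "a = q")
      case True
      then show ?thesis using that der V(2) by (auto simp: U_def)
    next
      case False
      then show ?thesis using that st by (auto simp: U_def)
    qed
  qed (use V(1) in auto)
  let ?x = "\<lambda>x j. conjg (imul (int j) t) x"
  have tN: "conjg (imul z t) ` N = N" "conjg (imul z t) ` E = E" for z using conjg_image_imul t by blast+
  have key: "\<exists>k>0. comm (imul (int k) t) x \<in> U" if x: "x \<in> N" for x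
  proof -
    have "a \<le> q \<Longrightarrow> \<exists>J. infinite J \<and> (\<forall>b<a. \<forall>i\<in>J. \<forall>j\<in>J. \<forall>w\<in>V (Suc b). conjg (?x x i) w - conjg (?x x j) w \<in> V b)" for a
    proof (induction a)
      case 0
      show ?case by (intro exI[of _ UNIV]) simp
    next
      case (Suc a)
      then obtain J where J: "infinite J" "\<forall>b<a. \<forall>i\<in>J. \<forall>j\<in>J. \<forall>w\<in>V (Suc b). conjg (?x x i) w - conjg (?x x j) w \<in> V b"
        by auto
      have "\<exists>J'\<subseteq>J. infinite J' \<and> (\<forall>i\<in>J'. \<forall>j\<in>J'. \<forall>w\<in>V (Suc a). conjg (?x x i) w - conjg (?x x j) w \<in> V a)"
        using V(4) Suc.prems x J(1) unfolding admissible_def by (simp add: Suc_le_eq)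
      then obtain J' where J': "J' \<subseteq> J" "infinite J'" "\<forall>i\<in>J'. \<forall>j\<in>J'. \<forall>w\<in>V (Suc a). conjg (?x x i) w - conjg (?x x j) w \<in> V a"
        by (elim exE conjE) (rule that)
      then show ?case using J(2) by (intro exI[of _ J']) (auto simp: less_Suc_eq subset_iff)
    qed
    from this[OF order_refl] obtain J where J: "infinite J" "\<forall>b<q. \<forall>i\<in>J. \<forall>j\<in>J. \<forall>w\<in>V (Suc b). conjg (?x x i) w - conjg (?x x j) w \<in> V b"
      by (elim exE conjE) (rule that)
    obtain i where i: "i \<in> J" using J(1) by fastforce
    obtain j where j: "j \<in> J" "i < j" using J(1) by (meson infinite_nat_iff_unbounded)
    have xN: "?x x n \<in> N" for n using tN(1) x by blast
    have dN: "?x x j - ?x x i \<in> N" using subgp_diff[OF N] xN by blast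
    have "comm (?x x j - ?x x i) w \<in> V b" if b: "b < q" "w \<in> V (Suc b)" for b w
    proof -
      have "conjg (- ?x x i) w \<in> V (Suc b)" using P[of "Suc b"] subgp_minus[OF N xN[of i]] b(2) by blast
      then have "conjg (?x x j) (conjg (- ?x x i) w) - conjg (?x x i) (conjg (- ?x x i) w) \<in> V b"
        using J(2) i j(1) b(1) by blast
      then show ?thesis by (simp add: comm_conjg conjg_conjg)
    qed
    then have "?x x j - ?x x i \<in> U" using st[OF dN] dN by (simp add: U_def)
    \<comment> \<open>Conjugating back by \<open>imul (int i) t\<close> turns the difference of
      conjugates into a commutator with \<open>imul (int (j - i)) t\<close>.\<close>
    then have "conjg (imul (- int i) t) (?x x j - ?x x i) \<in> U"
      using Uinv[OF tN, of "- int i"] by blast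
    moreover have "conjg (imul (- int i) t) (?x x j - ?x x i) = comm (imul (int (j - i)) t) x"
      using j(2) by (simp add: conjg_diff conjg_conjg of_nat_diff comm_conjg flip: imul_add)
    ultimately show ?thesis using j(2) by (intro exI[of _ "j - i"]) simp
  qed
  have UN: "conjg x ` U = U" if "x \<in> N" for x
    using Uinv[OF conjg_image_self[OF N that] conjg_EN[OF that]] .
  have UNc: "conjg x u \<in> U" if "x \<in> N" "u \<in> U" for x u using UN[OF that(1)] that(2) by blast
  have mult: "comm (imul (int (n * k)) t) x \<in> U" if k: "comm (imul (int k) t) x \<in> U" for n k x
  proof -
    have "comm (imul (int n) (imul (int k) t)) x \<in> U"
    proof (induction n)
      case (Suc n)
      have "conjg (imul (int k) t) (comm (imul (int n) (imul (int k) t)) x) \<in> U"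
        using Uinv[OF tN, of "int k"] Suc by blast
      then show ?case
        using k subgp_add[OF U] unfolding imul_succ_nat comm_add_left by blast
    qed (simp add: subgp_zero[OF U])
    then show ?thesis by (simp add: imul_mult)
  qed
  obtain S where S: "finite S" "S \<subseteq> N" "gen S = N" using noeth_fg[OF G(1) N G(2)] by metis
  have "\<exists>k>0. \<forall>x\<in>S. comm (imul (int k) t) x \<in> U"
    using S(1,2)
  proof (induction S)
    case empty
    show ?case by (intro exI[of _ 1]) simp
  next
    case (insert s S)
    then obtain k where k: "k > 0" "\<forall>x\<in>S. comm (imul (int k) t) x \<in> U" by auto
    obtain l where l: "l > 0" "comm (imul (int l) t) s \<in> U" using key insert.prems by blast
    have "\<forall>x\<in>insert s S. comm (imul (int (k * l)) t) x \<in> U"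
      using mult[of k _ l] mult[of l _ k] k l by (auto simp: mult.commute)
    then show ?case using k l by (intro exI[of _ "k * l"]) simp
  qed
  then obtain k where k: "k > 0" "\<forall>x\<in>S. comm (imul (int k) t) x \<in> U" by blast
  have "subgp {x \<in> N. comm (imul (int k) t) x \<in> U}"
  proof (rule subgpI)
    show "0 \<in> {x \<in> N. comm (imul (int k) t) x \<in> U}" by (simp add: subgp_zero N U)
    show "a + b \<in> {x \<in> N. comm (imul (int k) t) x \<in> U}"
      if "a \<in> {x \<in> N. comm (imul (int k) t) x \<in> U}" "b \<in> {x \<in> N. comm (imul (int k) t) x \<in> U}" for a b
      using that UNc[of a] subgp_add[OF N] subgp_add[OF U] by (simp add: comm_add_right)
    show "- a \<in> {x \<in> N. comm (imul (int k) t) x \<in> U}" if "a \<in> {x \<in> N. comm (imul (int k) t) x \<in> U}" for a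
      using that UNc[of "- a"] subgp_minus[OF N] subgp_minus[OF U] by (simp add: comm_minus_right)
  qed
  then have "gen S \<subseteq> {x \<in> N. comm (imul (int k) t) x \<in> U}" by (rule gen_least) (use S(2) k(2) in blast)
  then have "\<And>x. x \<in> N \<Longrightarrow> comm (imul (int k) t) x \<in> U" using S(3) by blast
  moreover have "U \<subseteq> N" by (auto simp: U_def)
  ultimately show ?thesis using that[OF k(1) nil _ EU UN Uinv[OF t]] by simp
qed

end

definition nil_by_abelian :: "'g::group_add set \<Rightarrow> bool" where
  "nil_by_abelian M \<longleftrightarrow> (\<exists>D. nilp D \<and> D \<subseteq> M \<and> (\<forall>a\<in>M. \<forall>b\<in>M. comm a b \<in> D))"

lemma nil_by_abelian_subset:
  assumes "nil_by_abelian N" "subgp L" "L \<subseteq> N"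
  shows "nil_by_abelian L"
proof -
  obtain D where D: "nilp D" "D \<subseteq> N" "\<forall>a\<in>N. \<forall>b\<in>N. comm a b \<in> D"
    using assms(1) unfolding nil_by_abelian_def by blast
  have "nilp (D \<inter> L)" using nilp_subset[OF D(1)] subgp_Int[OF nilp_subgp[OF D(1)] assms(2)] by blast
  then show ?thesis
    unfolding nil_by_abelian_def using D assms(2,3) subgp_comm by (intro exI[of _ "D \<inter> L"]) blast
qed

text \<open>\<open>N\<close> is abelian modulo \<open>E \<subseteq> U\<close>, and the multiple
  \<open>imul (int k) t\<close> centralises \<open>N\<close> modulo \<open>U\<close>. So the
  extension by this multiple is abelian modulo the nilpotent \<open>U\<close>, and it has finite
  index.\<close>

lemma nil_by_abelian_ext:
  assumes G: "noeth G" and NA: "nil_by_abelian N" "subgp N" and t: "conjg t ` N = N" and sub: "ext N t \<subseteq> G"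
  shows "\<exists>M. fin_index M (ext N t) \<and> nil_by_abelian M"
proof -
  obtain D where D: "nilp D" "D \<subseteq> N" "\<forall>a\<in>N. \<forall>b\<in>N. comm a b \<in> D"
    using NA(1) unfolding nil_by_abelian_def by blast
  \<comment> \<open>\<open>D\<close> need not be stable under \<open>t\<close>; the derived subgroup
    of \<open>N\<close> is, and being contained in \<open>D\<close> it is nilpotent.\<close>
  define E where "E = gen {comm a b |a b. a \<in> N \<and> b \<in> N}"
  have Ecnj: "conjg x ` E = E" if "conjg x ` N = N" for x
  proof -
    have "conjg x e \<in> E" if x: "conjg x ` N = N" and e: "e \<in> E" for x e
    proof -
      have "subgp (conjg (- x) ` E)" unfolding E_def by (rule subgp_conjg_image) simp
      moreover have "comm a b \<in> conjg (- x) ` E" if "a \<in> N" "b \<in> N" for a b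
      proof -
        have "comm (conjg x a) (conjg x b) \<in> E" unfolding E_def using x that by (intro gen_incl) blast
        then have "conjg (- x) (conjg x (comm a b)) \<in> conjg (- x) ` E" unfolding conjg_comm[of x] by (rule imageI)
        then show ?thesis by (simp only: conjg_inv)
      qed
      ultimately have "E \<subseteq> conjg (- x) ` E" unfolding E_def by (intro gen_least) auto
      then show ?thesis using e by auto
    qed
    then show ?thesis using that conjg_image_minus[OF that] unfolding conjg_image_eq_iff[of x E] by blast
  qed
  have ED: "E \<subseteq> D" unfolding E_def using D(3) by (intro gen_least[OF nilp_subgp[OF D(1)]]) blast
  have nilE: "nilp E" using nilp_subset[OF D(1) _ ED] by (simp add: E_def)
  interpret malcev G N E t
  proof
    show "conjg x e \<in> E" if "x \<in> N" "e \<in> E" for x e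
      using Ecnj[OF conjg_image_self[OF NA(2) that(1)]] that(2) by blast
    show "comm x y \<in> E" if "x \<in> N" "y \<in> N" for x y unfolding E_def using that by (intro gen_incl) blast
    show "N \<subseteq> G" using ext_superset sub by blast
    show "E \<subseteq> N" using ED D(2) by blast
  qed (use G NA t Ecnj nilE in \<open>simp_all add: E_def\<close>)
  obtain k U where U: "k > 0" "nilp U" "U \<subseteq> N" "E \<subseteq> U" "\<And>x. x \<in> N \<Longrightarrow> conjg x ` U = U" "conjg t ` U = U"
    "\<And>x. x \<in> N \<Longrightarrow> comm (imul (int k) t) x \<in> U"
    by (rule power_centralizes_modulo_nilpotent) (rule that)
  let ?s = "imul (int k) t"
  note Us = nilp_subgp[OF U(2)]
  have s: "conjg ?s ` N = N" "conjg ?s ` U = U" using conjg_image_imul t U(6) by blast+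
  \<comment> \<open>The centre of the extension modulo \<open>U\<close>. It contains
    \<open>?s\<close> and \<open>N\<close>, hence everything.\<close>
  let ?Z = "{a \<in> ext N ?s. \<forall>b\<in>ext N ?s. comm a b \<in> U}"
  note ex = subgp_ext[OF NA(2) s(1)]
  have Uinv: "conjg x ` U = U" if x: "x \<in> ext N ?s" for x
  proof -
    obtain n z where "n \<in> N" "x = n + imul z ?s" using x by (auto simp: ext_iff)
    then show ?thesis using conjg_image_add[OF U(5) conjg_image_imul[OF s(2)]] by blast
  qed
  have Z: "subgp ?Z"
  proof (rule subgpI)
    show "0 \<in> ?Z" using subgp_zero[OF ex] subgp_zero[OF Us] by simp
    have Uc: "conjg x u \<in> U" if "x \<in> ext N ?s" "u \<in> U" for x u using Uinv[OF that(1)] that(2) by blast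
    show "a + b \<in> ?Z" if "a \<in> ?Z" "b \<in> ?Z" for a b
      using that Uc[of a] subgp_add[OF ex] subgp_add[OF Us] by (simp add: comm_add_left)
    show "- a \<in> ?Z" if "a \<in> ?Z" for a
      using that Uc[of "- a"] subgp_minus[OF ex] subgp_minus[OF Us] by (simp add: comm_minus_left)
  qed
  have sx: "comm ?s x \<in> U" if x: "x \<in> ext N ?s" for x
  proof -
    obtain n z where n: "n \<in> N" "x = n + imul z ?s" using x by (auto simp: ext_iff)
    have "conjg ?s (imul z ?s) = imul z ?s" by (simp add: conjg_imul)
    then have "comm ?s x = comm ?s n" using n(2) by (simp add: comm_conjg conjg_add group_word_simps del: add_uminus_conv_diff)
    then show ?thesis using U(7) n(1) by simp
  qed
  then have sZ: "?s \<in> ?Z" using ext_gen[OF NA(2)] by blast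
  have "n \<in> ?Z" if n: "n \<in> N" for n
  proof -
    have "comm n b \<in> U" if b: "b \<in> ext N ?s" for b
    proof -
      obtain m z where m: "m \<in> N" "b = m + imul z ?s" using b by (auto simp: ext_iff)
      have "n \<in> ext N ?s" using n ext_superset by blast
      then have "comm (imul z ?s) n \<in> U" using subgp_imul[OF Z sZ, of z] by blast
      then have "comm n (imul z ?s) \<in> U" using subgp_minus[OF Us] comm_minus by metis
      then have "conjg m (comm n (imul z ?s)) \<in> U" using U(5)[OF m(1)] by blast
      moreover have "comm n m \<in> U" using der[OF n m(1)] U(4) by blast
      ultimately show ?thesis using subgp_add[OF Us] by (simp add: m(2) comm_add_right)
    qed
    then show ?thesis using n ext_superset by blast
  qed
  then have "ext N ?s \<subseteq> ?Z" using ext_subset[OF Z _ sZ] by blast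
  then have "nil_by_abelian (ext N ?s)"
    unfolding nil_by_abelian_def using U(2,3) ext_superset[of N ?s] by (intro exI[of _ U]) blast
  moreover have "fin_index (ext N ?s) (ext N t)" using U(1) by (intro fin_index_ext_imul NA t) simp
  ultimately show ?thesis by blast
qed

theorem pcf_virtually_nil_by_abelian:
  assumes "noeth G" "pcf H" "H \<subseteq> G"
  shows "\<exists>M. fin_index M H \<and> nil_by_abelian M"
  using assms
proof (rule pcf_virtually)
  have "nilp ({0} :: 'a set)" unfolding nilp_def
    by (intro exI[of _ "\<lambda>_. {0}"] exI[of _ 0]) simp
  then show "nil_by_abelian ({0} :: 'a set)"
    unfolding nil_by_abelian_def by (intro exI[of _ "{0}"]) simp
  show "nil_by_abelian N \<Longrightarrow> subgp L \<Longrightarrow> L \<subseteq> N \<Longrightarrow> nil_by_abelian L" for N L :: "'a set"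
    by (rule nil_by_abelian_subset)
  show "\<exists>M. fin_index M (ext N t) \<and> nil_by_abelian M"
    if "nil_by_abelian N" "subgp N" "conjg t ` N = N" "ext N t \<subseteq> G" for N t
    by (rule nil_by_abelian_ext[OF assms(1) that])
qed

text \<open>Torsion is removed from the bottom up: first inside \<open>D\<close>, giving
  \<open>M1\<close>, then above \<open>D\<close> with an \<open>M\<close> that meets
  \<open>D\<close> within \<open>M1\<close>, so that \<open>D \<inter> M\<close> has a torsion-free
  series too.\<close>

theorem pcf_virtually_torsion_free_series:
  assumes G: "noeth G" and H: "pcf H" "H \<subseteq> G"
  obtains M D where "fin_index M H" "nilp D" "D \<subseteq> M" "\<And>a b. a \<in> M \<Longrightarrow> b \<in> M \<Longrightarrow> comm a b \<in> D"
    "torsion_free_series D {0} D" "torsion_free_series M D M"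
proof -
  obtain N where N: "fin_index N H" "nil_by_abelian N" using pcf_virtually_nil_by_abelian[OF assms] by blast
  obtain D where D: "nilp D" "D \<subseteq> N" "\<forall>a\<in>N. \<forall>b\<in>N. comm a b \<in> D"
    using N(2) unfolding nil_by_abelian_def by blast
  note sN = fin_indexD[OF N(1)] and sD = nilp_subgp[OF D(1)]
  have NG: "N \<subseteq> G" "D \<subseteq> G" using sN(3) D(2) H(2) by auto
  have cD: "central_series D {0} D" by (rule nilp_central_series[OF G NG(2) D(1)])
  have cN: "central_series N D N"
    by (rule central_series_central[OF G NG(1) sN(1) subset_refl sD D(2) _ central_series_refl]) (use D(3) in blast)
  from central_series_virtually_torsion_free_series[OF G cD NG(2) subgp_trivial fin_index_refl[OF subgp_trivial]]
  obtain M1 where M1: "fin_index M1 D"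
    "\<And>L Y. subgp L \<Longrightarrow> L \<subseteq> M1 \<Longrightarrow> Y \<subseteq> D \<Longrightarrow> \<forall>y\<in>Y. \<forall>l\<in>L. comm y l \<in> L \<Longrightarrow> torsion_free_series Y ({0} \<inter> L) L"
    by (elim exE conjE) (rule that, auto)
  from central_series_virtually_torsion_free_series[OF G cN NG(1) sD M1(1)]
  obtain M where M: "fin_index M N" "M \<inter> D \<subseteq> M1"
    "\<And>L Y. subgp L \<Longrightarrow> L \<subseteq> M \<Longrightarrow> Y \<subseteq> N \<Longrightarrow> \<forall>y\<in>Y. \<forall>l\<in>L. comm y l \<in> L \<Longrightarrow> torsion_free_series Y (D \<inter> L) L"
    by (elim exE conjE) (rule that, auto)
  note sM = fin_indexD[OF M(1)]
  have sDM: "subgp (D \<inter> M)" using sD sM(1) by (rule subgp_Int)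
  show ?thesis
  proof (rule that[of M "D \<inter> M"])
    show "fin_index M H" using M(1) N(1) by (rule fin_index_trans)
    show "nilp (D \<inter> M)" using nilp_subset[OF D(1) sDM] by blast
    show "comm a b \<in> D \<inter> M" if "a \<in> M" "b \<in> M" for a b
      using that D(3) sM(3) subgp_comm[OF sM(1)] by blast
    have "torsion_free_series (D \<inter> M) ({0} \<inter> (D \<inter> M)) (D \<inter> M)"
      using M(2) by (intro M1(2) sDM ballI subgp_comm) auto
    moreover have "{0} \<inter> (D \<inter> M) = {0}" using subgp_zero[OF sDM] by blast
    ultimately show "torsion_free_series (D \<inter> M) {0} (D \<inter> M)" by simp
    show "torsion_free_series M (D \<inter> M) M"
      using sM(3) by (intro M(3) sM(1) ballI subgp_comm) auto
  qed blast
qed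

section \<open>Modules of integer valued functions\<close>

text \<open>The group ring element \<open>p(s)\<close> applied to \<open>f\<close> under right
  translation, evaluated at \<open>x\<close>.\<close>

definition act :: "int poly \<Rightarrow> 'g::group_add \<Rightarrow> ('g \<Rightarrow> int) \<Rightarrow> 'g \<Rightarrow> int" where
  "act p s f x = (\<Sum>i\<le>degree p. coeff p i * f (x + imul (int i) s))"

lemma act_upto: "degree p \<le> n \<Longrightarrow> act p s f x = (\<Sum>i\<le>n. coeff p i * f (x + imul (int i) s))"
  unfolding act_def by (rule sum.mono_neutral_left) (auto simp: coeff_eq_0)

lemma act_0 [simp]: "act 0 s f x = 0"
  by (simp add: act_def)

lemma act_1 [simp]: "act 1 s f x = f x"
  by (simp add: act_def)

lemma act_pCons: "act (pCons a p) s f x = a * f x + act p s f (x + s)"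
proof -
  have "act (pCons a p) s f x = (\<Sum>i\<le>Suc (degree p). coeff (pCons a p) i * f (x + imul (int i) s))"
    by (rule act_upto) (rule degree_pCons_le)
  also have "\<dots> = a * f x + (\<Sum>i\<le>degree p. coeff p i * f (x + imul (int (Suc i)) s))"
    by (simp only: sum.atMost_Suc_shift coeff_pCons_0 coeff_pCons_Suc) simp
  also have "(\<Sum>i\<le>degree p. coeff p i * f (x + imul (int (Suc i)) s)) = act p s f (x + s)"
    unfolding act_def imul_succ_nat by (simp only: add.assoc)
  finally show ?thesis .
qed

lemma act_poly_add: "act (p + q) s f x = act p s f x + act q s f x"
proof -
  let ?n = "max (degree p) (degree q)"
  have "act (p + q) s f x = (\<Sum>i\<le>?n. coeff (p + q) i * f (x + imul (int i) s))"
    by (rule act_upto) (rule degree_add_le_max)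
  then show ?thesis by (simp add: act_upto[of p ?n] act_upto[of q ?n] ring_distribs sum.distrib)
qed

lemma act_poly_smult: "act (smult c p) s f x = c * act p s f x"
  unfolding act_upto[OF degree_smult_le] by (simp add: act_def sum_distrib_left mult.assoc)

lemma act_poly_diff: "act (p - q) s f x = act p s f x - act q s f x"
proof -
  have "act (p - q) s f x = act (p + smult (-1) q) s f x" by simp
  then show ?thesis unfolding act_poly_add act_poly_smult by simp
qed

lemma act_poly_sum: "act (\<Sum>j\<in>A. r j) s f x = (\<Sum>j\<in>A. act (r j) s f x)"
  by (induction A rule: infinite_finite_induct) (simp_all add: act_poly_add)

lemma act_mult: "act (p * q) s f x = act p s (act q s f) x"
proof (induction p arbitrary: x)
  case (pCons a p)
  have "act (pCons a p * q) s f x = act (smult a q + pCons 0 (p * q)) s f x" by simp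
  also have "\<dots> = a * act q s f x + act (p * q) s f (x + s)"
    by (simp add: act_poly_add act_poly_smult act_pCons)
  finally show ?case by (simp add: act_pCons pCons.IH)
qed simp

lemma act_fun_add: "act p s (\<lambda>y. f y + g y) = (\<lambda>x. act p s f x + act p s g x)"
  by (simp add: act_def ring_distribs sum.distrib fun_eq_iff)

lemma act_fun_scale: "act p s (\<lambda>y. c * f y) = (\<lambda>x. c * act p s f x)"
  by (simp add: act_def sum_distrib_left mult.left_commute fun_eq_iff)

lemma act_cong:
  "(\<And>i. f (x + imul (int i) s) = g (y + imul (int i) s)) \<Longrightarrow> act p s f x = act p s g y"
  by (simp add: act_def)

abbreviation delta :: "'g::group_add \<Rightarrow> ('g \<Rightarrow> int) \<Rightarrow> 'g \<Rightarrow> int" where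
  "delta d f \<equiv> \<lambda>x. f (x + d) - f x"

text \<open>For \<open>D = N\<close> and \<open>S = {}\<close> these are the polynomial functions of degree less than \<open>k\<close> on \<open>N\<close>.\<close>

primrec fil :: "'g::group_add set \<Rightarrow> 'g set \<Rightarrow> 'g set \<Rightarrow> int poly \<Rightarrow> nat \<Rightarrow> ('g \<Rightarrow> int) set" where
  "fil N D S p 0 = {f. \<forall>x\<in>N. f x = 0}"
| "fil N D S p (Suc k) = {f. (\<forall>d\<in>D. delta d f \<in> fil N D S p k) \<and> (\<forall>s\<in>S. act p s f \<in> fil N D S p k)}"

lemma fil_add: "f \<in> fil N D S p k \<Longrightarrow> g \<in> fil N D S p k \<Longrightarrow> (\<lambda>x. f x + g x) \<in> fil N D S p k"
proof (induction k arbitrary: f g)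
  case (Suc k)
  have "delta d (\<lambda>x. f x + g x) = (\<lambda>x. delta d f x + delta d g x)" for d by auto
  then show ?case using Suc by (simp add: act_fun_add)
qed simp

lemma fil_scale: "f \<in> fil N D S p k \<Longrightarrow> (\<lambda>x. c * f x) \<in> fil N D S p k"
proof (induction k arbitrary: f)
  case (Suc k)
  have "delta d (\<lambda>x. c * f x) = (\<lambda>x. c * delta d f x)" for d by (auto simp: algebra_simps)
  then show ?case using Suc by (simp add: act_fun_scale)
qed simp

lemma fil_diff: "f \<in> fil N D S p k \<Longrightarrow> g \<in> fil N D S p k \<Longrightarrow> (\<lambda>x. f x - g x) \<in> fil N D S p k"
  using fil_add[OF _ fil_scale[of g N D S p k "-1"], of f] by simp

lemma fil_zero: "(\<lambda>x. 0) \<in> fil N D S p k"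
proof (induction k)
  case (Suc k)
  have "act p s (\<lambda>x. 0) = (\<lambda>x. 0)" for s :: 'a by (auto simp: act_def)
  then show ?case using Suc by simp
qed simp

lemma fil_sum: "(\<And>i. i \<in> A \<Longrightarrow> f i \<in> fil N D S p k) \<Longrightarrow> (\<lambda>x. \<Sum>i\<in>A. f i x) \<in> fil N D S p k"
  by (induction A rule: infinite_finite_induct) (simp_all add: fil_zero fil_add)

lemma fil_restrict: "M \<subseteq> N \<Longrightarrow> f \<in> fil N D S p k \<Longrightarrow> f \<in> fil M D S p k"
  by (induction k arbitrary: f) auto

definition words :: "'g::group_add list \<Rightarrow> 'g set" where
  "words ss = foldr (\<lambda>s Y. {y + imul (int a) s |y a. y \<in> Y}) ss {0}"

lemma words_Nil [simp]: "words [] = {0}"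
  and words_Cons: "words (s # ss) = {y + imul (int a) s |y a. y \<in> words ss}"
  by (simp_all add: words_def)

definition short_words :: "nat \<Rightarrow> 'g::group_add list \<Rightarrow> 'g set" where
  "short_words m ss = foldr (\<lambda>s Y. (\<lambda>(y, a). y + imul (int a) s) ` (Y \<times> {..<m})) ss {0}"

lemma short_words_Nil [simp]: "short_words m [] = {0}"
  and short_words_Cons: "short_words m (s # ss) = (\<lambda>(y, a). y + imul (int a) s) ` (short_words m ss \<times> {..<m})"
  by (simp_all add: short_words_def)

lemma finite_short_words: "finite (short_words m ss)"
  by (induction ss) (simp_all add: short_words_Cons)

section \<open>The filtration of functions on a group that is abelian modulo
  \<open>D\<close>\<close>

locale filtration =
  fixes N D S :: "'g::group_add set"
  assumes N: "subgp N" and D: "subgp D" "D \<subseteq> N" and S: "S \<subseteq> N"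
    and der: "x \<in> N \<Longrightarrow> y \<in> N \<Longrightarrow> comm x y \<in> D"
begin

lemma conjgD: "x \<in> N \<Longrightarrow> d \<in> D \<Longrightarrow> conjg x d \<in> D"
proof -
  assume "x \<in> N" "d \<in> D"
  then have "comm x d + d \<in> D" using der D by (intro subgp_add[OF D(1)]) auto
  then show ?thesis by (simp add: comm_conjg)
qed

lemma SN: "s \<in> S \<Longrightarrow> imul z s \<in> N"
  using subgp_imul[OF N] S by blast

lemma act_null: "(\<And>x. x \<in> N \<Longrightarrow> f x = 0) \<Longrightarrow> s \<in> N \<Longrightarrow> x \<in> N \<Longrightarrow> act p s f x = 0"
  unfolding act_def using subgp_imul[OF N] subgp_add[OF N] by (intro sum.neutral) simp

lemma fil_null: "(\<And>x. x \<in> N \<Longrightarrow> f x = 0) \<Longrightarrow> f \<in> fil N D S p k"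
proof (induction k arbitrary: f)
  case (Suc k)
  have "delta d f \<in> fil N D S p k" if "d \<in> D" for d
    using Suc.prems D(2) that subgp_add[OF N] by (intro Suc.IH) (auto simp: subset_iff)
  moreover have "act p s f \<in> fil N D S p k" if "s \<in> S" for s
    using act_null[OF Suc.prems] S that by (intro Suc.IH) auto
  ultimately show ?case by simp
qed simp

lemma fil_cong: "f \<in> fil N D S p k \<Longrightarrow> (\<And>x. x \<in> N \<Longrightarrow> g x = f x) \<Longrightarrow> g \<in> fil N D S p k"
proof -
  assume f: "f \<in> fil N D S p k" and eq: "\<And>x. x \<in> N \<Longrightarrow> g x = f x"
  have "(\<lambda>x. f x + (g x - f x)) \<in> fil N D S p k" by (intro fil_add f fil_null) (simp add: eq)
  then show ?thesis by simp
qed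

text \<open>Right translation by \<open>g\<close> changes a difference operator only by conjugating
  \<open>d\<close> inside \<open>D\<close>. In \<open>p(s)\<close> it has to pass the multiples of
  \<open>s\<close>, which costs commutators \<open>e i\<close> in \<open>D\<close>; the correction
  terms are differences of \<open>f\<close> and so lie one level lower.\<close>

lemma fil_translate: "f \<in> fil N D S p k \<Longrightarrow> g \<in> N \<Longrightarrow> (\<lambda>x. f (x + g)) \<in> fil N D S p k"
proof (induction k arbitrary: f g)
  case 0
  then show ?case using subgp_add[OF N] by simp
next
  case (Suc k)
  have gN: "- g \<in> N" using Suc.prems subgp_minus[OF N] by blast
  have "delta d (\<lambda>x. f (x + g)) \<in> fil N D S p k" if d: "d \<in> D" for d
  proof -
    have "x + d + g = x + g + conjg (- g) d" for x
      by (simp add: conjg_def group_word_simps del: add_uminus_conv_diff)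
    then have "delta d (\<lambda>x. f (x + g)) = (\<lambda>x. delta (conjg (- g) d) f (x + g))" by simp
    moreover have "delta (conjg (- g) d) f \<in> fil N D S p k" using Suc.prems(1) conjgD[OF gN d] by simp
    then have "(\<lambda>x. delta (conjg (- g) d) f (x + g)) \<in> fil N D S p k" by (rule Suc.IH[OF _ Suc.prems(2)])
    ultimately show ?thesis by simp
  qed
  moreover have "act p s (\<lambda>x. f (x + g)) \<in> fil N D S p k" if s: "s \<in> S" for s
  proof -
    define e where "e i = comm (- imul (int i) s) (- g)" for i
    have e: "e i \<in> D" for i unfolding e_def using gN SN[OF s] subgp_minus[OF N] by (intro der) auto
    have w: "x + imul (int i) s + g = x + (g + imul (int i) s) + e i" for x i
      by (simp add: e_def comm_def group_word_simps del: add_uminus_conv_diff)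
    have "act p s (\<lambda>x. f (x + g)) =
      (\<lambda>x. act p s f (x + g) + (\<Sum>i\<le>degree p. coeff p i * delta (e i) f (x + (g + imul (int i) s))))"
      unfolding act_def w by (simp add: fun_eq_iff ring_distribs sum.distrib[symmetric] add.assoc)
    moreover have "(\<lambda>x. coeff p i * delta (e i) f (x + (g + imul (int i) s))) \<in> fil N D S p k" for i
      using Suc.prems e by (intro fil_scale Suc.IH subgp_add[OF N] SN[OF s]) auto
    moreover have "(\<lambda>x. act p s f (x + g)) \<in> fil N D S p k"
      using Suc.prems s by (intro Suc.IH) auto
    ultimately show ?thesis by (simp add: fil_add fil_sum)
  qed
  ultimately show ?case by simp
qed

lemma fil_act: "f \<in> fil N D S p k \<Longrightarrow> s \<in> N \<Longrightarrow> act q s f \<in> fil N D S p k"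
  unfolding act_def[abs_def] by (intro fil_sum fil_scale fil_translate subgp_imul[OF N])

lemma fil_Suc: "f \<in> fil N D S p k \<Longrightarrow> f \<in> fil N D S p (Suc k)"
  using fil_translate[of f p k] fil_act[of f p k] D(2) S by (auto intro!: fil_diff)

lemma fil_le: "k \<le> l \<Longrightarrow> f \<in> fil N D S p k \<Longrightarrow> f \<in> fil N D S p l"
  by (induction rule: dec_induct) (auto intro: fil_Suc simp del: fil.simps)

text \<open>\<open>p(s)\<close> multiplies a constant by \<open>p(1)\<close>. This is why the
  polynomial built for a cyclic extension contains the factor \<open>X - 1\<close>.\<close>

lemma fil_const_1: "poly p 1 = 0 \<or> S = {} \<Longrightarrow> (\<lambda>x. c) \<in> fil N D S p (Suc 0)"
proof -
  assume p: "poly p 1 = 0 \<or> S = {}"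
  have "act p s (\<lambda>x. c) = (\<lambda>x. poly p 1 * c)" for s :: 'g
    by (simp add: act_def fun_eq_iff poly_altdef sum_distrib_right)
  then show ?thesis using p by auto
qed

lemma words_subset: "set ss \<subseteq> N \<Longrightarrow> words ss \<subseteq> N"
  by (induction ss) (auto simp: words_Cons subgp_zero[OF N] intro!: subgp_add[OF N] subgp_imul[OF N])

lemma short_words_subset: "set ss \<subseteq> N \<Longrightarrow> short_words m ss \<subseteq> N"
  by (induction ss) (auto simp: short_words_Cons subgp_zero[OF N] intro!: subgp_add[OF N] subgp_imul[OF N])

lemma act_translate_right:
  assumes inv: "\<And>x d. x \<in> N \<Longrightarrow> d \<in> D \<Longrightarrow> f (x + d) = f x" and x: "x \<in> N" "g \<in> N" "s \<in> N"
  shows "act p s (\<lambda>x. f (x + g)) x = act p s f (x + g)"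
proof (rule act_cong)
  fix i
  have "comm (- imul (int i) s) (- g) \<in> D"
    using x subgp_minus[OF N] subgp_imul[OF N] by (intro der) auto
  moreover have "x + imul (int i) s + g = x + g + imul (int i) s + comm (- imul (int i) s) (- g)"
    by (simp add: comm_def group_word_simps del: add_uminus_conv_diff)
  moreover have "x + g + imul (int i) s \<in> N" using x by (intro subgp_add[OF N] subgp_imul[OF N])
  ultimately show "f (x + imul (int i) s + g) = f (x + g + imul (int i) s)" using inv by metis
qed

text \<open>Along the exponent of \<open>s\<close> the equation \<open>p(s) f = 0\<close> is a monic
  linear recurrence of order \<open>degree p\<close>, so the values at smaller exponents determine
  the rest. Invariance under \<open>D\<close> makes translates of \<open>f\<close> by multiples of
  \<open>s\<close> satisfy the same assumptions, which allows induction on the list of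
  generators.\<close>

lemma vanish_on_words:
  assumes p: "lead_coeff p = 1"
  shows "set ss \<subseteq> S \<Longrightarrow> (\<And>x d. x \<in> N \<Longrightarrow> d \<in> D \<Longrightarrow> f (x + d) = f x) \<Longrightarrow>
    (\<And>x s. x \<in> N \<Longrightarrow> s \<in> S \<Longrightarrow> act p s f x = 0) \<Longrightarrow>
    (\<And>e. e \<in> short_words (degree p) ss \<Longrightarrow> f e = 0) \<Longrightarrow> y \<in> words ss \<Longrightarrow> f y = 0"
proof (induction ss arbitrary: f y)
  case (Cons s ss)
  have s: "s \<in> S" "s \<in> N" using Cons.prems(1) S by auto
  obtain y0 a where y: "y = y0 + imul (int a) s" "y0 \<in> words ss" using Cons.prems(5) by (auto simp: words_Cons)
  have y0N: "y0 \<in> N" using words_subset[of ss] y(2) Cons.prems(1) S by auto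
  have base: "f (y0 + imul (int i) s) = 0" if i: "i < degree p" for i
  proof -
    let ?f = "\<lambda>x. f (x + imul (int i) s)"
    have "?f y0 = 0"
    proof (rule Cons.IH[of ?f])
      show "set ss \<subseteq> S" using Cons.prems(1) by simp
      show "?f (x + d) = ?f x" if "x \<in> N" "d \<in> D" for x d
      proof -
        have "x + d + imul (int i) s = x + imul (int i) s + conjg (- imul (int i) s) d"
          by (simp add: conjg_def group_word_simps del: add_uminus_conv_diff)
        moreover have "conjg (- imul (int i) s) d \<in> D" using conjgD subgp_minus[OF N SN[OF s(1)]] that by blast
        ultimately show ?thesis using Cons.prems(2) subgp_add[OF N that(1) SN[OF s(1)]] by simp
      qed
      show "act p r ?f x = 0" if "x \<in> N" "r \<in> S" for x r
        using act_translate_right[OF Cons.prems(2) that(1) SN[OF s(1)]] that S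
          Cons.prems(3)[OF subgp_add[OF N that(1) SN[OF s(1)]]] by auto
      show "?f e = 0" if "e \<in> short_words (degree p) ss" for e
        using that i by (intro Cons.prems(4)) (auto simp: short_words_Cons)
      show "y0 \<in> words ss" by (rule y(2))
    qed
    then show ?thesis .
  qed
  have "f (y0 + imul (int a) s) = 0"
  proof (induction a rule: less_induct)
    case (less a)
    show ?case
    proof (cases "a < degree p")
      case False
      define b where "b = a - degree p"
      have a: "a = b + degree p" using False by (simp add: b_def)
      let ?x = "y0 + imul (int b) s"
      have sh: "?x + imul (int i) s = y0 + imul (int (b + i)) s" for i by (simp add: imul_add add.assoc)
      have "0 = act p s f ?x" using Cons.prems(3)[OF subgp_add[OF N y0N SN[OF s(1)]] s(1)] by simp
      also have "\<dots> = (\<Sum>i<degree p. coeff p i * f (?x + imul (int i) s)) + f (?x + imul (int (degree p)) s)"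
        using p by (simp add: act_def lessThan_Suc_atMost[symmetric])
      also have "(\<Sum>i<degree p. coeff p i * f (?x + imul (int i) s)) = 0"
        unfolding sh by (intro sum.neutral) (simp add: less a del: of_nat_add)
      finally show ?thesis unfolding sh a by simp
    qed (rule base)
  qed
  then show ?case using y by simp
qed (use subgp_zero[OF N] in simp)

text \<open>Once the differences of \<open>f\<close> and the functions \<open>p(s) f\<close> vanish,
  by the result for the lower level, \<open>f\<close> is invariant under \<open>D\<close> and
  satisfies the recurrences, so its values on short words decide.\<close>

lemma finite_determining:
  assumes fg: "finite F" "gen F = D" and p: "lead_coeff p = 1"
    and ss: "set ss = S" and span: "\<And>x. x \<in> N \<Longrightarrow> \<exists>y\<in>words ss. \<exists>d\<in>D. x = y + d"
  shows "\<exists>E. finite E \<and> E \<subseteq> N \<and> (\<forall>f\<in>fil N D S p k. (\<forall>e\<in>E. f e = 0) \<longrightarrow> (\<forall>x\<in>N. f x = 0))"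
proof (induction k)
  case 0
  show ?case by (intro exI[of _ "{}"]) simp
next
  case (Suc k)
  then obtain E where E: "finite E" "E \<subseteq> N" "\<forall>f\<in>fil N D S p k. (\<forall>e\<in>E. f e = 0) \<longrightarrow> (\<forall>x\<in>N. f x = 0)"
    by (elim exE conjE) (rule that)
  \<comment> \<open>Besides the short words these are the points at which \<open>f\<close> must be
    known in order to test the differences by \<open>F\<close> and the functions
    \<open>p(s) f\<close> on \<open>E\<close>.\<close>
  let ?E = "short_words (degree p) ss \<union> E \<union> (\<lambda>(e, d). e + d) ` (E \<times> F) \<union>
    (\<lambda>(e, s, i). e + imul (int i) s) ` (E \<times> S \<times> {..degree p})"
  have FD: "F \<subseteq> D" using fg gen_superset by blast
  have "finite ?E" using E(1) fg(1) ss finite_short_words by auto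
  moreover have "?E \<subseteq> N"
    using short_words_subset[of ss] ss S E(2) FD D(2) SN subgp_add[OF N] by (auto simp: subset_iff)
  moreover have "\<forall>x\<in>N. f x = 0" if f: "f \<in> fil N D S p (Suc k)" "\<forall>e\<in>?E. f e = 0" for f
  proof -
    have dF: "f (x + d) = f x" if "d \<in> F" "x \<in> N" for d x
    proof -
      have "\<forall>e\<in>E. delta d f e = 0" using f(2) that(1) by force
      then show ?thesis using E(3)[rule_format, of "delta d f" x] f(1) FD that by auto
    qed
    have "subgp {d \<in> D. \<forall>x\<in>N. f (x + d) = f x}"
    proof (rule subgpI)
      show "0 \<in> {d \<in> D. \<forall>x\<in>N. f (x + d) = f x}" using subgp_zero[OF D(1)] by simp
      show "a + b \<in> {d \<in> D. \<forall>x\<in>N. f (x + d) = f x}"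
        if "a \<in> {d \<in> D. \<forall>x\<in>N. f (x + d) = f x}" "b \<in> {d \<in> D. \<forall>x\<in>N. f (x + d) = f x}" for a b
        using that subgp_add[OF D(1)] subgp_add[OF N] D(2) by (auto simp: subset_iff simp flip: add.assoc)
      show "- a \<in> {d \<in> D. \<forall>x\<in>N. f (x + d) = f x}" if "a \<in> {d \<in> D. \<forall>x\<in>N. f (x + d) = f x}" for a
      proof -
        have "f (x - a) = f x" if "x \<in> N" for x
        proof -
          have "x - a \<in> N" using \<open>x \<in> N\<close> \<open>a \<in> _\<close> D(2) subgp_diff[OF N] by blast
          then have "f (x - a + a) = f (x - a)" using \<open>a \<in> _\<close> by blast
          then show ?thesis by simp
        qed
        then show ?thesis using that subgp_minus[OF D(1)] by simp
      qed
    qed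
    then have "gen F \<subseteq> {d \<in> D. \<forall>x\<in>N. f (x + d) = f x}" by (rule gen_least) (use dF FD in blast)
    then have inv: "f (x + d) = f x" if "x \<in> N" "d \<in> D" for x d using fg(2) that by blast
    have aS: "act p s f x = 0" if "s \<in> S" "x \<in> N" for s x
    proof -
      have "act p s f e = 0" if e: "e \<in> E" for e
        unfolding act_def
      proof (intro sum.neutral ballI)
        fix i assume i: "i \<in> {..degree p}"
        have "(e, s, i) \<in> E \<times> S \<times> {..degree p}" using e i \<open>s \<in> S\<close> by simp
        then have "e + imul (int i) s \<in> ?E" by (intro UnI2) (rule rev_image_eqI, auto)
        then show "coeff p i * f (e + imul (int i) s) = 0" using f(2) by simp
      qed
      then show ?thesis using E(3)[rule_format, of "act p s f" x] f(1) that by auto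
    qed
    have w: "f y = 0" if "y \<in> words ss" for y
      by (rule vanish_on_words[OF p, of ss f]) (use ss inv aS f(2) that in auto)
    show ?thesis
    proof
      fix x assume x: "x \<in> N"
      then obtain y d where "y \<in> words ss" "d \<in> D" "x = y + d" using span by blast
      then show "f x = 0" using w inv words_subset[of ss] ss S by auto
    qed
  qed
  ultimately show ?case by (intro exI[of _ ?E] conjI ballI[OF impI])
qed

end

section \<open>Lattices of integer valued functions\<close>

definition fun_module :: "('g \<Rightarrow> int) set \<Rightarrow> bool" where
  "fun_module Q \<longleftrightarrow> (\<lambda>x. 0) \<in> Q \<and> (\<forall>f\<in>Q. \<forall>g\<in>Q. (\<lambda>x. f x + g x) \<in> Q) \<and> (\<forall>f\<in>Q. \<forall>c. (\<lambda>x. c * f x) \<in> Q)"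

lemma fun_module_zero: "fun_module Q \<Longrightarrow> (\<lambda>x. 0) \<in> Q"
  and fun_module_add: "fun_module Q \<Longrightarrow> f \<in> Q \<Longrightarrow> g \<in> Q \<Longrightarrow> (\<lambda>x. f x + g x) \<in> Q"
  and fun_module_scale: "fun_module Q \<Longrightarrow> f \<in> Q \<Longrightarrow> (\<lambda>x. c * f x) \<in> Q"
  by (auto simp: fun_module_def)

lemma fun_module_sum:
  "fun_module Q \<Longrightarrow> (\<And>i. i \<in> A \<Longrightarrow> f i \<in> Q) \<Longrightarrow> (\<lambda>x. \<Sum>i\<in>A. c i * f i x) \<in> Q"
  by (induction A rule: infinite_finite_induct) (simp_all add: fun_module_def)

lemma fun_module_diff: "fun_module Q \<Longrightarrow> f \<in> Q \<Longrightarrow> g \<in> Q \<Longrightarrow> (\<lambda>x. f x - c * g x) \<in> Q"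
proof -
  assume "fun_module Q" "f \<in> Q" "g \<in> Q"
  then have "(\<lambda>x. f x + (- c) * g x) \<in> Q" by (intro fun_module_add fun_module_scale)
  then show ?thesis by simp
qed

text \<open>Restricted to \<open>E\<close> the functions form a subgroup of a free abelian group of
  finite rank. A basis of those vanishing at \<open>e\<close> is completed, if necessary, by one
  function with the least positive value at \<open>e\<close>, which divides all values
  there.\<close>

lemma fun_module_basis:
  assumes "finite E" "fun_module Q"
  shows "\<exists>bs. set bs \<subseteq> Q \<and> (\<forall>f\<in>Q. \<exists>c. \<forall>e\<in>E. f e = (\<Sum>i<length bs. c i * (bs ! i) e)) \<and>
    (\<forall>c. (\<forall>e\<in>E. (\<Sum>i<length bs. c i * (bs ! i) e) = 0) \<longrightarrow> (\<forall>i<length bs. c i = (0::int)))"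
  using assms
proof (induction E arbitrary: Q)
  case empty
  show ?case by (intro exI[of _ "[]"]) simp
next
  case (insert e E)
  define Q' where "Q' = {f \<in> Q. f e = 0}"
  have "fun_module Q'" using insert.prems unfolding fun_module_def Q'_def by simp
  from insert.IH[OF this] obtain bs where bs: "set bs \<subseteq> Q'"
    "\<forall>f\<in>Q'. \<exists>c. \<forall>e\<in>E. f e = (\<Sum>i<length bs. c i * (bs ! i) e)"
    "\<forall>c. (\<forall>e\<in>E. (\<Sum>i<length bs. c i * (bs ! i) e) = 0) \<longrightarrow> (\<forall>i<length bs. c i = (0::int))"
    by (elim exE conjE) (rule that)
  have bse: "(bs ! i) e = 0" "bs ! i \<in> Q" if "i < length bs" for i
    using bs(1) nth_mem[OF that] by (auto simp: Q'_def)
  show ?case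
  proof (cases "\<exists>f\<in>Q. f e \<noteq> 0")
    case False
    then have "Q' = Q" by (auto simp: Q'_def)
    have "\<exists>c. \<forall>e'\<in>insert e E. f e' = (\<Sum>i<length bs. c i * (bs ! i) e')" if f: "f \<in> Q" for f
    proof -
      obtain c where "\<forall>e\<in>E. f e = (\<Sum>i<length bs. c i * (bs ! i) e)" using bs(2) f \<open>Q' = Q\<close> by blast
      moreover have "f e = 0" using f False by blast
      ultimately show ?thesis by (intro exI[of _ c]) (simp add: bse)
    qed
    then show ?thesis using bs(1,3) \<open>Q' = Q\<close> by (intro exI[of _ bs]) auto
  next
    case True
    define d where "d = (LEAST d. d > 0 \<and> (\<exists>f\<in>Q. f e = int d))"
    have "\<exists>d. d > 0 \<and> (\<exists>f\<in>Q. f e = int d)"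
    proof -
      obtain f where f: "f \<in> Q" "f e \<noteq> 0" using True by blast
      have "(\<lambda>x. sgn (f e) * f x) \<in> Q" by (rule fun_module_scale[OF insert.prems f(1)])
      moreover have "sgn (f e) * f e = int (nat \<bar>f e\<bar>)" by (simp add: sgn_if)
      ultimately have "\<exists>f'\<in>Q. f' e = int (nat \<bar>f e\<bar>)"
        by (intro bexI[of _ "\<lambda>x. sgn (f e) * f x"])
      then show ?thesis using f(2) by (intro exI[of _ "nat \<bar>f e\<bar>"]) simp
    qed
    then have "d > 0 \<and> (\<exists>f\<in>Q. f e = int d)" unfolding d_def by (rule LeastI_ex)
    then obtain g where d: "d > 0" and g: "g \<in> Q" "g e = int d" by blast
    have least: "d \<le> n" if "n > 0" "f \<in> Q" "f e = int n" for n f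
      unfolding d_def by (rule Least_le) (use that in blast)
    let ?bs = "bs @ [g]"
    have "\<exists>c. \<forall>e'\<in>insert e E. f e' = (\<Sum>i<length ?bs. c i * (?bs ! i) e')" if f: "f \<in> Q" for f
    proof -
      define h where "h = (\<lambda>x. f x - (f e div int d) * g x)"
      have hQ: "h \<in> Q" unfolding h_def by (rule fun_module_diff[OF insert.prems f g(1)])
      have he: "h e = f e mod int d" by (simp add: h_def g(2) minus_div_mult_eq_mod)
      have "h e = 0"
      proof (rule ccontr)
        assume ne: "h e \<noteq> 0"
        have "0 \<le> h e" "h e < int d" using d by (simp_all add: he)
        then have "h e = int (nat (h e))" "nat (h e) > 0" "nat (h e) < d" using ne by auto
        then show False using least[OF _ hQ, of "nat (h e)"] by simp
      qed
      then obtain c where c: "\<forall>e\<in>E. h e = (\<Sum>i<length bs. c i * (bs ! i) e)" using bs(2) hQ by (auto simp: Q'_def)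
      let ?c = "c(length bs := f e div int d)"
      have "f e' = (\<Sum>i<length ?bs. ?c i * (?bs ! i) e')" if e': "e' \<in> insert e E" for e'
      proof -
        have "(\<Sum>i<length bs. ?c i * (?bs ! i) e') = (\<Sum>i<length bs. c i * (bs ! i) e')"
          by (intro sum.cong) (simp_all add: nth_append)
        also have "\<dots> = h e'"
          using e' c \<open>h e = 0\<close> by (auto simp: bse)
        finally show ?thesis by (simp add: h_def nth_append)
      qed
      then show ?thesis by blast
    qed
    moreover have "\<forall>i<length ?bs. c i = 0" if c: "\<forall>e'\<in>insert e E. (\<Sum>i<length ?bs. c i * (?bs ! i) e') = 0" for c
    proof -
      have *: "(\<Sum>i<length ?bs. c i * (?bs ! i) e') = (\<Sum>i<length bs. c i * (bs ! i) e') + c (length bs) * g e'" for e'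
        by (simp add: nth_append)
      have "(\<Sum>i<length bs. c i * (bs ! i) e) = 0" by (simp add: bse)
      then have c0: "c (length bs) = 0" using c *[of e] d g(2) by auto
      then have "\<forall>e'\<in>E. (\<Sum>i<length bs. c i * (bs ! i) e') = 0" using c * by simp
      then have "\<forall>i<length bs. c i = 0" using bs(3) by blast
      then show ?thesis using c0 by (auto simp: less_Suc_eq)
    qed
    moreover have "set ?bs \<subseteq> Q" using bs(1) g(1) by (auto simp: Q'_def)
    ultimately show ?thesis by (intro exI[of _ ?bs] conjI ballI allI impI) auto
  qed
qed

text \<open>For a module \<open>Q\<close> this says that restriction to \<open>E\<close> loses only
  functions vanishing on \<open>N\<close>, so that on \<open>N\<close> it is a lattice.\<close>

definition determined :: "'g set \<Rightarrow> ('g \<Rightarrow> int) set \<Rightarrow> bool" where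
  "determined N Q \<longleftrightarrow> (\<exists>E. finite E \<and> E \<subseteq> N \<and> (\<forall>f\<in>Q. (\<forall>e\<in>E. f e = 0) \<longrightarrow> (\<forall>x\<in>N. f x = 0)))"

lemma determined_subset: "determined N Q \<Longrightarrow> R \<subseteq> Q \<Longrightarrow> determined N R"
  unfolding determined_def by (elim exE) (rule exI, auto)

lemma determined_basis:
  assumes det: "determined N Q" and Q: "fun_module Q"
  obtains bs where "set bs \<subseteq> Q"
    "\<And>f. f \<in> Q \<Longrightarrow> \<exists>c. \<forall>x\<in>N. f x = (\<Sum>i<length bs. c i * (bs ! i) x)"
    "\<And>c. (\<forall>x\<in>N. (\<Sum>i<length bs. c i * (bs ! i) x) = 0) \<Longrightarrow> (\<forall>i<length bs. c i = (0::int))"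
proof -
  obtain E where E: "finite E" "E \<subseteq> N" "\<forall>f\<in>Q. (\<forall>e\<in>E. f e = 0) \<longrightarrow> (\<forall>x\<in>N. f x = 0)"
    using det unfolding determined_def by (elim exE conjE) (rule that)
  obtain bs where bs: "set bs \<subseteq> Q"
    "\<forall>f\<in>Q. \<exists>c. \<forall>e\<in>E. f e = (\<Sum>i<length bs. c i * (bs ! i) e)"
    "\<forall>c. (\<forall>e\<in>E. (\<Sum>i<length bs. c i * (bs ! i) e) = 0) \<longrightarrow> (\<forall>i<length bs. c i = (0::int))"
    using fun_module_basis[OF E(1) Q] by (elim exE conjE) (rule that)
  show ?thesis
  proof (rule that[OF bs(1)])
    fix f assume f: "f \<in> Q"
    then obtain c where c: "\<forall>e\<in>E. f e = (\<Sum>i<length bs. c i * (bs ! i) e)" using bs(2) by blast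
    have "(\<lambda>x. f x - 1 * (\<Sum>i<length bs. c i * (bs ! i) x)) \<in> Q"
      using bs(1) nth_mem by (intro fun_module_diff[OF Q f] fun_module_sum[OF Q]) auto
    then have "\<forall>x\<in>N. f x - 1 * (\<Sum>i<length bs. c i * (bs ! i) x) = 0" using E(3) c by fastforce
    then show "\<exists>c. \<forall>x\<in>N. f x = (\<Sum>i<length bs. c i * (bs ! i) x)" by (intro exI[of _ c]) auto
  next
    fix c assume "\<forall>x\<in>N. (\<Sum>i<length bs. c i * (bs ! i) x) = 0"
    then show "\<forall>i<length bs. c i = 0" using bs(3) E(2) by blast
  qed
qed

text \<open>The translates of \<open>b\<close> under non-negative multiples of \<open>t\<close> span
  a lattice with a finite basis of functions \<open>r i(t) b\<close>. On \<open>N\<close> a power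
  \<open>X^m\<close> with \<open>m\<close> beyond all degrees acts on \<open>b\<close> as a
  combination of these, and the difference is a monic polynomial.\<close>

lemma monic_annihilator_function:
  assumes det: "determined N Q" and Q: "fun_module Q"
    and inv: "\<And>f z. f \<in> Q \<Longrightarrow> (\<lambda>x. f (x + imul z t)) \<in> Q" and b: "b \<in> Q"
  shows "\<exists>q. lead_coeff q = 1 \<and> (\<forall>x\<in>N. act q t b x = 0)"
proof -
  define R where "R = {act r t b |r. True}"
  have RQ: "R \<subseteq> Q"
  proof -
    have "act r t b \<in> Q" for r
      unfolding act_def[abs_def]
      by (rule fun_module_sum[OF Q, of "{..degree r}" "\<lambda>i x. b (x + imul (int i) t)"]) (rule inv[OF b])
    then show ?thesis by (auto simp: R_def)
  qed
  have actR: "f \<in> R \<Longrightarrow> \<exists>r. f = act r t b" for f by (auto simp: R_def)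
  have "fun_module R" unfolding fun_module_def
  proof (intro conjI ballI allI)
    show "(\<lambda>x. 0) \<in> R" unfolding R_def by (intro CollectI exI[of _ 0]) auto
    show "(\<lambda>x. f x + g x) \<in> R" if fg: "f \<in> R" "g \<in> R" for f g
    proof -
      obtain r s where "f = act r t b" "g = act s t b" using fg actR by meson
      then show ?thesis unfolding R_def by (intro CollectI exI[of _ "r + s"]) (simp add: act_poly_add fun_eq_iff)
    qed
    show "(\<lambda>x. c * f x) \<in> R" if f: "f \<in> R" for f c
    proof -
      obtain r where "f = act r t b" using f actR by meson
      then show ?thesis unfolding R_def by (intro CollectI exI[of _ "smult c r"]) (simp add: act_poly_smult fun_eq_iff)
    qed
  qed
  obtain bs where bs: "set bs \<subseteq> R" "\<And>f. f \<in> R \<Longrightarrow> \<exists>c. \<forall>x\<in>N. f x = (\<Sum>i<length bs. c i * (bs ! i) x)"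
    by (rule determined_basis[OF determined_subset[OF det RQ] \<open>fun_module R\<close>]) (rule that)
  have "\<exists>r. bs ! i = act r t b" if "i < length bs" for i using actR bs(1) nth_mem[OF that] by blast
  then obtain r where r: "\<And>i. i < length bs \<Longrightarrow> bs ! i = act (r i) t b" by metis
  define m where "m = Suc (\<Sum>i<length bs. degree (r i))"
  have deg: "degree (r i) < m" if "i < length bs" for i
    unfolding m_def using that by (intro le_imp_less_Suc member_le_sum) auto
  have "act (monom 1 m) t b \<in> R" by (auto simp: R_def)
  then obtain c where c: "\<forall>x\<in>N. act (monom 1 m) t b x = (\<Sum>i<length bs. c i * (bs ! i) x)" using bs(2) by blast
  define q where "q = monom 1 m - (\<Sum>i<length bs. smult (c i) (r i))"
  have "act q t b x = 0" if "x \<in> N" for x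
    using c that by (simp add: q_def act_poly_diff act_poly_sum act_poly_smult r)
  moreover have "coeff (\<Sum>i<length bs. smult (c i) (r i)) j = 0" if "m \<le> j" for j
    using less_le_trans[OF deg that] by (auto simp: coeff_sum intro!: sum.neutral coeff_eq_0)
  then have "coeff q m = 1" "\<forall>i>m. coeff q i = 0" by (auto simp: q_def)
  then have "lead_coeff q = 1" by (metis degree_le le_degree le_antisym zero_neq_one)
  ultimately show ?thesis by blast
qed

text \<open>Polynomials in the translation by one element commute, so the product of annihilators of
  the basis functions kills each of them and, by linearity, all of \<open>Q\<close>.\<close>

lemma monic_annihilator_module:
  assumes det: "determined N Q" and Q: "fun_module Q"
    and N: "subgp N" "t \<in> N"
    and inv: "\<And>f z. f \<in> Q \<Longrightarrow> (\<lambda>x. f (x + imul z t)) \<in> Q"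
  shows "\<exists>q. lead_coeff q = 1 \<and> (\<forall>f\<in>Q. \<forall>x\<in>N. act q t f x = 0)"
proof -
  obtain bs where bs: "set bs \<subseteq> Q" "\<And>f. f \<in> Q \<Longrightarrow> \<exists>c. \<forall>x\<in>N. f x = (\<Sum>i<length bs. c i * (bs ! i) x)"
    by (rule determined_basis[OF det Q]) (rule that)
  have null: "act p t f x = 0" if "\<forall>x\<in>N. f x = 0" "x \<in> N" for p f x
    unfolding act_def using that N subgp_add[OF N(1)] subgp_imul[OF N] by (intro sum.neutral) simp
  have "\<exists>q. lead_coeff q = 1 \<and> (\<forall>b\<in>set bs. \<forall>x\<in>N. act q t b x = 0)"
    using bs(1)
  proof (induction bs)
    case Nil
    show ?case by (intro exI[of _ 1]) simp
  next
    case (Cons b bs)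
    then obtain q where q: "lead_coeff q = 1" "\<forall>b\<in>set bs. \<forall>x\<in>N. act q t b x = 0" by auto
    obtain r where r: "lead_coeff r = 1" "\<forall>x\<in>N. act r t b x = 0"
      using monic_annihilator_function[OF det Q inv, of b] Cons.prems by auto
    have "act (q * r) t b x = 0" if "x \<in> N" for x unfolding act_mult using null[OF r(2) that] .
    moreover have "act (q * r) t b' x = 0" if "b' \<in> set bs" "x \<in> N" for b' x
      unfolding mult.commute[of q] act_mult using null q(2) that by blast
    moreover have "lead_coeff (q * r) = 1" using q r by (simp add: lead_coeff_mult)
    ultimately show ?case by (intro exI[of _ "q * r"]) auto
  qed
  then obtain q where q: "lead_coeff q = 1" "\<forall>b\<in>set bs. \<forall>x\<in>N. act q t b x = 0" by blast
  have "act q t f x = 0" if f: "f \<in> Q" and x: "x \<in> N" for f x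
  proof -
    obtain c where c: "\<forall>x\<in>N. f x = (\<Sum>i<length bs. c i * (bs ! i) x)" using bs(2) f by blast
    have "act q t f x = act q t (\<lambda>x. \<Sum>i<length bs. c i * (bs ! i) x) x"
      using c x subgp_add[OF N(1)] subgp_imul[OF N] by (intro act_cong) auto
    also have "\<dots> = (\<Sum>i<length bs. c i * act q t (bs ! i) x)"
      unfolding act_def by (simp add: sum_distrib_left sum.swap[of _ "{..degree q}"] mult.left_commute)
    also have "\<dots> = 0" using q(2) x by (intro sum.neutral) auto
    finally show ?thesis .
  qed
  then show ?thesis using q(1) by blast
qed

lemma fil_fun_module: "fun_module (fil N D S p k)"
  unfolding fun_module_def by (simp add: fil_zero fil_add fil_scale)

definition faithful :: "'g::group_add set \<Rightarrow> ('g \<Rightarrow> int) set \<Rightarrow> bool" where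
  "faithful N Q \<longleftrightarrow> (\<forall>g\<in>N. g \<noteq> 0 \<longrightarrow> (\<exists>f\<in>Q. \<exists>x\<in>N. f (x + g) \<noteq> f x))"

section \<open>Extension by an infinite cyclic factor\<close>

locale infinite_cyclic_ext =
  fixes N :: "'g::group_add set" and t :: 'g
  assumes N: "subgp N" and t: "conjg t ` N = N" and tf: "imul z t \<in> N \<Longrightarrow> z = 0"
begin

abbreviation "N' \<equiv> ext N t"

lemma N': "subgp N'" by (rule subgp_ext[OF N t])

lemma NN': "N \<subseteq> N'" by (rule ext_superset)

lemma tN': "imul z t \<in> N'" by (intro subgp_imul[OF N'] ext_gen[OF N])

text \<open>\<open>ext\<close> puts the multiple of \<open>t\<close> on the right; functions
  invariant under left translation by \<open>t\<close> require it on the left.\<close>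

lemma left_form: "x \<in> N' \<Longrightarrow> \<exists>z. \<exists>n\<in>N. x = imul z t + n"
proof -
  assume "x \<in> N'"
  then obtain n z where n: "n \<in> N" "x = n + imul z t" by (auto simp: ext_iff)
  have "conjg (- imul z t) n \<in> N" using conjg_image_minus[OF conjg_image_imul[OF t, of z]] n(1) by blast
  moreover have "x = imul z t + conjg (- imul z t) n"
    by (simp add: n conjg_def group_word_simps del: add_uminus_conv_diff)
  ultimately show ?thesis by blast
qed

lemma left_form_unique:
  assumes "imul z t + n = imul w t + m" "n \<in> N" "m \<in> N"
  shows "z = w \<and> n = m"
proof -
  have "imul (- w + z) t = imul (- w) t + (imul z t + n) - n"
    by (simp only: imul_add add.assoc[symmetric] add_diff_cancel)
  also have "\<dots> = m - n" using assms(1) by (simp add: imul_neg)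
  finally have "imul (- w + z) t \<in> N" using assms subgp_diff[OF N] by simp
  then have "z = w" using tf by fastforce
  then show ?thesis using assms(1) by simp
qed

text \<open>Both functions are meaningful on \<open>N'\<close> only; elsewhere \<open>THE\<close> ranges over an empty predicate.\<close>

definition lift :: "('g \<Rightarrow> int) \<Rightarrow> 'g \<Rightarrow> int" where
  "lift f x = f (THE n. n \<in> N \<and> (\<exists>z. x = imul z t + n))"

definition deg :: "'g \<Rightarrow> int" where
  "deg x = (THE z. \<exists>n\<in>N. x = imul z t + n)"

lemma lift_eq: "n \<in> N \<Longrightarrow> lift f (imul z t + n) = f n"
  unfolding lift_def by (rule arg_cong[where f = f], rule the_equality) (use left_form_unique in blast)+

lemma lift_N: "n \<in> N \<Longrightarrow> lift f n = f n"
  using lift_eq[of n f 0] by simp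

lemma deg_eq: "n \<in> N \<Longrightarrow> deg (imul z t + n) = z"
  unfolding deg_def by (rule the_equality) (use left_form_unique in blast)+

lemma deg_N: "n \<in> N \<Longrightarrow> deg n = 0"
  using deg_eq[of n 0] by simp

lemma deg_add: "x \<in> N' \<Longrightarrow> y \<in> N' \<Longrightarrow> deg (x + y) = deg x + deg y"
proof -
  assume "x \<in> N'" "y \<in> N'"
  then obtain z n w m where *: "n \<in> N" "x = imul z t + n" "m \<in> N" "y = imul w t + m"
    using left_form by meson
  have "conjg (- imul w t) n \<in> N" using conjg_image_minus[OF conjg_image_imul[OF t, of w]] *(1) by blast
  then have "conjg (- imul w t) n + m \<in> N" using subgp_add[OF N] *(3) by blast
  moreover have "x + y = imul (z + w) t + (conjg (- imul w t) n + m)"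
    by (simp add: * imul_add conjg_def group_word_simps del: add_uminus_conv_diff)
  ultimately show ?thesis using * by (simp add: deg_eq)
qed

definition linv :: "('g \<Rightarrow> int) \<Rightarrow> bool" where
  "linv F \<longleftrightarrow> (\<forall>x\<in>N'. \<forall>z. F (imul z t + x) = F x)"

lemma linvD: "linv F \<Longrightarrow> x \<in> N' \<Longrightarrow> F (imul z t + x) = F x"
  by (simp add: linv_def)

lemma linv_lift: "linv (lift f)"
  unfolding linv_def
proof (intro ballI allI)
  fix x z assume "x \<in> N'"
  then obtain w n where n: "n \<in> N" "x = imul w t + n" using left_form by blast
  have "imul z t + x = imul (z + w) t + n" by (simp add: n imul_add add.assoc)
  then show "lift f (imul z t + x) = lift f x" using n by (simp add: lift_eq)
qed

lemma linv_translate: "linv F \<Longrightarrow> g \<in> N' \<Longrightarrow> linv (\<lambda>x. F (x + g))"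
  unfolding linv_def using subgp_add[OF N'] by (simp add: add.assoc)

lemma linv_delta: "linv F \<Longrightarrow> g \<in> N' \<Longrightarrow> linv (delta g F)"
  unfolding linv_def using subgp_add[OF N'] by (simp add: add.assoc)

lemma linv_act: "linv F \<Longrightarrow> s \<in> N' \<Longrightarrow> linv (act p s F)"
  unfolding linv_def act_def using subgp_add[OF N'] subgp_imul[OF N']
  by (intro ballI allI sum.cong) (simp_all add: add.assoc)

lemma linv_fun_module: "fun_module (Collect linv)"
  unfolding fun_module_def linv_def by simp

lemma linv_zero: "linv F \<Longrightarrow> \<forall>x\<in>N. F x = 0 \<Longrightarrow> x \<in> N' \<Longrightarrow> F x = 0"
proof -
  assume F: "linv F" "\<forall>x\<in>N. F x = 0" and "x \<in> N'"
  then obtain w n where n: "n \<in> N" "x = imul w t + n" using left_form by blast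
  then show ?thesis using linvD[OF F(1), of n w] F(2) NN' by auto
qed

text \<open>Right translation by an element of \<open>N\<close> changes only the component
  \<open>n\<close> of \<open>imul z t + n\<close>, so \<open>lift\<close> commutes with all
  operators that define the filtration.\<close>

lemma lift_fil:
  assumes filt: "filtration N' D S" and sub: "D \<subseteq> N" "S \<subseteq> N"
  shows "f \<in> fil N D S p k \<Longrightarrow> lift f \<in> fil N' D S p k"
proof (induction k arbitrary: f)
  case 0
  then show ?case using linv_zero[OF linv_lift] by (simp add: lift_N)
next
  case (Suc k)
  interpret filtration N' D S by (rule filt)
  have "delta d (lift f) \<in> fil N' D S p k" if d: "d \<in> D" for d
  proof (rule fil_cong[OF Suc.IH[of "delta d f"]])
    show "delta d f \<in> fil N D S p k" using Suc.prems d by simp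
    fix x assume "x \<in> N'"
    then obtain z n where n: "n \<in> N" "x = imul z t + n" using left_form by blast
    moreover have "n + d \<in> N" using n d sub subgp_add[OF infinite_cyclic_ext.N[OF infinite_cyclic_ext_axioms]] by blast
    ultimately show "lift f (x + d) - lift f x = lift (delta d f) x" by (simp add: lift_eq add.assoc)
  qed
  moreover have "act p s (lift f) \<in> fil N' D S p k" if s: "s \<in> S" for s
  proof (rule fil_cong[OF Suc.IH[of "act p s f"]])
    show "act p s f \<in> fil N D S p k" using Suc.prems s by simp
    fix x assume "x \<in> N'"
    then obtain z n where n: "n \<in> N" "x = imul z t + n" using left_form by blast
    have "n + imul i s \<in> N" for i
      using n s sub subgp_add[OF infinite_cyclic_ext.N[OF infinite_cyclic_ext_axioms]]
        subgp_imul[OF infinite_cyclic_ext.N[OF infinite_cyclic_ext_axioms]] by blast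
    then have "act p s (lift f) x = act p s f n" unfolding n by (intro act_cong) (simp add: add.assoc lift_eq)
    then show "act p s (lift f) x = lift (act p s f) x" using n by (simp add: lift_eq)
  qed
  ultimately show ?case by simp
qed

text \<open>An element of nonzero exponent is detected by \<open>deg\<close> at \<open>0\<close>, a
  nonzero element of \<open>N\<close> by a lifted function.\<close>

lemma faithful_extension:
  assumes f: "faithful N Q" and lift: "\<And>f. f \<in> Q \<Longrightarrow> lift f \<in> Q'" and deg: "deg \<in> Q'"
  shows "faithful N' Q'"
  unfolding faithful_def
proof (intro ballI impI)
  fix g assume g: "g \<in> N'" "g \<noteq> 0"
  show "\<exists>f\<in>Q'. \<exists>x\<in>N'. f (x + g) \<noteq> f x"
  proof (cases "deg g = 0")
    case True
    obtain z n where n: "n \<in> N" "g = imul z t + n" using left_form g(1) by blast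
    then have gN: "g \<in> N" using True deg_eq by auto
    then obtain f x where fx: "f \<in> Q" "x \<in> N" "f (x + g) \<noteq> f x" using f g(2) unfolding faithful_def by blast
    then have "lift f (x + g) \<noteq> lift f x" using subgp_add[OF N fx(2) gN] by (simp add: lift_N)
    then show ?thesis using lift[OF fx(1)] subsetD[OF NN' fx(2)] by (intro bexI[of _ "lift f"] bexI[of _ x])
  next
    case False
    then have "deg (0 + g) \<noteq> deg 0" using deg_N[OF subgp_zero[OF N]] by simp
    then show ?thesis using deg subgp_zero[OF N'] by (intro bexI[of _ "deg"] bexI[of _ 0])
  qed
qed

end

text \<open>The words in \<open>ss\<close> have non-negative exponents, so that \<open>p(s)\<close> with \<open>p\<close> monic reduces
  them to bounded ones; \<open>ss\<close> therefore contains generators together with their inverses.\<close>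

definition good_filtration :: "'g::group_add set \<Rightarrow> 'g set \<Rightarrow> bool" where
  "good_filtration N D \<longleftrightarrow> (\<exists>ss p k. set ss \<subseteq> N \<and> lead_coeff p = 1 \<and>
     (\<forall>x\<in>N. \<exists>y\<in>words ss. \<exists>d\<in>D. x = y + d) \<and>
     faithful N (fil N D (set ss) p k) \<and> (\<lambda>x. 1) \<in> fil N D (set ss) p k)"

text \<open>The conditions of the old filtration involve no translation by \<open>t\<close>. Its
  left invariant functions are determined by their values on \<open>N\<close>, so they form a
  lattice on which \<open>t\<close> and \<open>- t\<close> satisfy monic polynomials; with these as
  factors of the new polynomial, the new filtration contains all lifts.\<close>

lemma good_filtration_ext:
  assumes G: "noeth G" and D: "subgp D" "D \<subseteq> N" "D \<subseteq> G" and N: "subgp N" "conjg t ` N = N"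
    and tf: "\<And>z. imul z t \<in> N \<Longrightarrow> z = 0"
    and der: "\<And>x y. x \<in> ext N t \<Longrightarrow> y \<in> ext N t \<Longrightarrow> comm x y \<in> D"
    and good_filtration: "good_filtration N D"
  shows "good_filtration (ext N t) D"
proof -
  interpret e: infinite_cyclic_ext N t using N tf by unfold_locales
  let ?N = "ext N t"
  obtain ss p k where ss: "set ss \<subseteq> N" and p: "lead_coeff p = 1"
    and span: "\<forall>x\<in>N. \<exists>y\<in>words ss. \<exists>d\<in>D. x = y + d"
    and faith: "faithful N (fil N D (set ss) p k)"
    using good_filtration unfolding good_filtration_def by (elim exE conjE) (rule that)
  have tN: "t \<in> ?N" "- t \<in> ?N" using ext_gen[OF N(1)] subgp_minus[OF e.N'] by auto
  define ss' where "ss' = - t # t # ss"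
  have sub: "D \<subseteq> ?N" "set ss \<subseteq> ?N" "set ss' \<subseteq> ?N"
    using D(2) ss e.NN' tN unfolding ss'_def by auto
  have derN: "comm x y \<in> D" if "x \<in> N" "y \<in> N" for x y
    using der[OF subsetD[OF e.NN' that(1)] subsetD[OF e.NN' that(2)]] .
  interpret old: filtration N D "set ss" by unfold_locales (fact N(1) D ss derN)+
  interpret f: filtration ?N D "set ss" by unfold_locales (fact e.N' D(1) sub der)+
  interpret f': filtration ?N D "set ss'" by unfold_locales (fact e.N' D(1) sub der)+
  define Q where "Q j = {F \<in> fil ?N D (set ss) p j. e.linv F}" for j
  have Qmod: "fun_module (Q j)" for j
    using fil_fun_module[of ?N D "set ss" p j] e.linv_fun_module unfolding fun_module_def Q_def by simp
  have Qtrans: "(\<lambda>x. F (x + g)) \<in> Q j" if "F \<in> Q j" "g \<in> ?N" for F g j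
    using that f.fil_translate e.linv_translate by (simp add: Q_def)
  have det: "determined ?N (Q k)"
  proof -
    obtain F where F: "finite F" "gen F = D" using noeth_fg[OF G D(1,3)] by metis
    have "\<exists>E. finite E \<and> E \<subseteq> N \<and> (\<forall>f\<in>fil N D (set ss) p k. (\<forall>e\<in>E. f e = 0) \<longrightarrow> (\<forall>x\<in>N. f x = 0))"
      by (rule old.finite_determining[OF F p refl]) (use span in blast)
    then obtain E where E: "finite E" "E \<subseteq> N" "\<forall>f\<in>fil N D (set ss) p k. (\<forall>e\<in>E. f e = 0) \<longrightarrow> (\<forall>x\<in>N. f x = 0)"
      by (elim exE conjE) (rule that)
    have "\<forall>x\<in>?N. f x = 0" if f: "f \<in> Q k" "\<forall>e\<in>E. f e = 0" for f
    proof -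
      have "f \<in> fil N D (set ss) p k" using f(1) fil_restrict[OF e.NN'] by (simp add: Q_def)
      then have "\<forall>x\<in>N. f x = 0" using E(3) f(2) by blast
      then show ?thesis using e.linv_zero f(1) by (simp add: Q_def)
    qed
    then show ?thesis unfolding determined_def using E(1,2) e.NN' by (intro exI[of _ E]) auto
  qed
  have "\<exists>q. lead_coeff q = 1 \<and> (\<forall>f\<in>Q k. \<forall>x\<in>?N. act q s f x = 0)" if "s \<in> ?N" for s
    using Qtrans subgp_imul[OF e.N' that] by (intro monic_annihilator_module[OF det Qmod e.N' that]) blast
  then obtain q1 q2 where q: "lead_coeff q1 = 1" "\<And>f x. f \<in> Q k \<Longrightarrow> x \<in> ?N \<Longrightarrow> act q1 t f x = 0"
    "lead_coeff q2 = 1" "\<And>f x. f \<in> Q k \<Longrightarrow> x \<in> ?N \<Longrightarrow> act q2 (- t) f x = 0"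
    using tN by meson
  \<comment> \<open>One polynomial has to serve all generators: \<open>p\<close> for the old ones,
    \<open>q1\<close> and \<open>q2\<close> for \<open>t\<close> and \<open>- t\<close>, and
    \<open>X - 1\<close> for the constants.\<close>
  define p' where "p' = p * q1 * q2 * [:-1, 1:]"
  have p': "lead_coeff p' = 1" "poly p' 1 = 0" using p q(1,3) by (simp_all add: p'_def lead_coeff_mult del: mult_pCons_right)
  have killed: "act p' s f \<in> fil ?N D (set ss') p' j"
    if kill: "p' = r * q" "s \<in> ?N" "\<And>x. x \<in> ?N \<Longrightarrow> act q s f x = 0" for r q s f j
  proof -
    have "act p' s f x = 0" if x: "x \<in> ?N" for x
      unfolding kill(1) act_mult by (rule f'.act_null[OF kill(3) kill(2) x])
    then show ?thesis by (rule f'.fil_null)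
  qed
  have Qsub: "F \<in> Q j \<Longrightarrow> j \<le> k \<Longrightarrow> F \<in> fil ?N D (set ss') p' j" for F j
  proof (induction j arbitrary: F)
    case 0
    then show ?case by (simp add: Q_def)
  next
    case (Suc j)
    have Fk: "F \<in> Q k" using Suc.prems f.fil_le[OF Suc.prems(2)] by (auto simp: Q_def simp del: fil.simps)
    have "delta d F \<in> fil ?N D (set ss') p' j" if d: "d \<in> D" for d
    proof (rule Suc.IH)
      have "d \<in> ?N" using d D(2) e.NN' by blast
      then show "delta d F \<in> Q j" using Suc.prems(1) d e.linv_delta by (simp add: Q_def)
    qed (use Suc.prems in simp)
    moreover have "act p' s F \<in> fil ?N D (set ss') p' j" if s: "s \<in> set ss'" for s
    proof -
      consider "s = t" | "s = - t" | "s \<in> set ss" using s by (auto simp: ss'_def)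
      then show ?thesis
      proof cases
        case 1
        show ?thesis unfolding 1
          by (rule killed[of "p * q2 * [:-1, 1:]" q1]) (use q(2)[OF Fk] tN in \<open>simp_all only: p'_def mult_ac\<close>)
      next
        case 2
        show ?thesis unfolding 2
          by (rule killed[of "p * q1 * [:-1, 1:]" q2]) (use q(4)[OF Fk] tN in \<open>simp_all only: p'_def mult_ac\<close>)
      next
        case 3
        then have sN: "s \<in> ?N" using ss e.NN' by blast
        have "act p s F \<in> Q j" using Suc.prems(1) 3 e.linv_act[OF _ sN] by (simp add: Q_def)
        then have "act p s F \<in> fil ?N D (set ss') p' j" using Suc by simp
        then have "act (q1 * q2 * [:-1, 1:]) s (act p s F) \<in> fil ?N D (set ss') p' j"
          by (rule f'.fil_act[OF _ sN])
        moreover have "act (q1 * q2 * [:-1, 1:]) s (act p s F) = act p' s F"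
          unfolding act_mult[symmetric, abs_def] p'_def by (simp only: mult_ac)
        ultimately show ?thesis by simp
      qed
    qed
    ultimately show ?case by simp
  qed
  \<comment> \<open>Lifts lie in level \<open>k\<close>. \<open>deg\<close> needs level 2:
    \<open>s - 1\<close> turns it into a constant, and a second use of the factor
    \<open>X - 1\<close> gives zero.\<close>
  define K where "K = max k 2"
  have const: "(\<lambda>x. c) \<in> fil ?N D (set ss') p' 1" for c using f'.fil_const_1[of p' c] p'(2) by simp
  have degf: "e.deg \<in> fil ?N D (set ss') p' 2"
  proof -
    have "delta d e.deg \<in> fil ?N D (set ss') p' 1" if d: "d \<in> D" for d
    proof (rule f'.fil_cong[OF const[of 0]])
      fix x assume "x \<in> ?N"
      then show "e.deg (x + d) - e.deg x = 0" using d D(2) e.NN' e.deg_N by (subst e.deg_add) auto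
    qed
    moreover have "act p' s e.deg \<in> fil ?N D (set ss') p' 1" if s: "s \<in> set ss'" for s
    proof -
      have sN: "s \<in> ?N" using s f'.S by blast
      have "act [:-1, 1:] s e.deg \<in> fil ?N D (set ss') p' 1"
        by (rule f'.fil_cong[OF const[of "e.deg s"]]) (simp add: act_pCons e.deg_add sN)
      then have "act (p * q1 * q2) s (act [:-1, 1:] s e.deg) \<in> fil ?N D (set ss') p' 1"
        by (rule f'.fil_act[OF _ sN])
      then show ?thesis unfolding act_mult[symmetric, abs_def] p'_def .
    qed
    ultimately show ?thesis by (simp add: numeral_2_eq_2)
  qed
  have "good_filtration ?N D"
    unfolding good_filtration_def
  proof (intro exI[of _ ss'] exI[of _ p'] exI[of _ K] conjI ballI)
    show "set ss' \<subseteq> ?N" by (rule f'.S)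
    show "lead_coeff p' = 1" by (rule p'(1))
    show "(\<lambda>x. 1) \<in> fil ?N D (set ss') p' K" by (rule f'.fil_le[OF _ const]) (simp add: K_def)
    show "faithful ?N (fil ?N D (set ss') p' K)"
    proof (rule e.faithful_extension[OF faith])
      show "e.deg \<in> fil ?N D (set ss') p' K" by (rule f'.fil_le[OF _ degf]) (simp add: K_def)
      fix f assume f: "f \<in> fil N D (set ss) p k"
      have "e.lift f \<in> Q k" using e.lift_fil[OF f.filtration_axioms D(2) ss f] e.linv_lift by (simp add: Q_def)
      then show "e.lift f \<in> fil ?N D (set ss') p' K"
        using Qsub[of _ k] by (intro f'.fil_le[of k K]) (auto simp: K_def)
    qed
  next
    fix x assume "x \<in> ?N"
    then obtain n z where n: "n \<in> N" "x = n + imul z t" by (auto simp: ext_iff)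
    obtain y d where y: "y \<in> words ss" "d \<in> D" "n = y + d" using span n(1) by blast
    \<comment> \<open>The multiple of \<open>t\<close> has to follow the word in \<open>ss\<close>
      directly, so \<open>d\<close> is conjugated past it.\<close>
    define d' where "d' = conjg (- imul z t) d"
    have "d' \<in> D" unfolding d'_def using y(2) subgp_minus[OF e.N' e.tN'] by (intro f'.conjgD) auto
    moreover have "x = y + imul z t + d'"
      by (simp add: n y d'_def conjg_def group_word_simps del: add_uminus_conv_diff)
    moreover have "y + imul z t \<in> words ss'"
    proof (cases z)
      case (nonneg a)
      have "y + imul z t = (y + imul (int a) t) + imul (int 0) (- t)" using nonneg by simp
      then show ?thesis unfolding ss'_def words_Cons using y(1) by blast
    next
      case (neg a)
      have "imul (int (Suc a)) (- t) = imul z t"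
        unfolding neg using imul_mult[of "int (Suc a)" "- 1" t] by (simp add: imul_neg)
      then have "y + imul z t = (y + imul (int 0) t) + imul (int (Suc a)) (- t)" by simp
      then show ?thesis unfolding ss'_def words_Cons using y(1) by blast
    qed
    ultimately show "\<exists>y\<in>words ss'. \<exists>d\<in>D. x = y + d" by blast
  qed
  then show ?thesis .
qed

text \<open>Along a central series \<open>W\<close> the difference operator of an element of \<open>W a\<close> is given weight
  \<open>q + 2 - a\<close>; commutation with an element of weight one, which lowers \<open>a\<close>, then raises weights.\<close>

context infinite_cyclic_ext
begin

fun weighted :: "(nat \<Rightarrow> 'g set) \<Rightarrow> nat \<Rightarrow> nat \<Rightarrow> ('g \<Rightarrow> int) \<Rightarrow> bool" where
  "weighted W q 0 F \<longleftrightarrow> (\<forall>x\<in>N'. F x = 0)"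
| "weighted W q (Suc w) F \<longleftrightarrow> (\<forall>a\<le>q. \<forall>g\<in>N \<inter> W a. weighted W q (w - (q + 1 - a)) (delta g F))"

end

locale central_ext = infinite_cyclic_ext +
  fixes W :: "nat \<Rightarrow> 'a set" and q :: nat
  assumes W0: "W 0 = {0}" and WN: "N \<subseteq> W q" and W: "subgp (W a)"
    and central: "a < q \<Longrightarrow> w \<in> W (Suc a) \<Longrightarrow> d \<in> N' \<Longrightarrow> comm d w \<in> W a"
    and Wmono: "a < q \<Longrightarrow> W a \<subseteq> W (Suc a)"
    and derN: "x \<in> N' \<Longrightarrow> y \<in> N' \<Longrightarrow> comm x y \<in> N"
begin

abbreviation "wt \<equiv> weighted W q"

lemma wt_null: "(\<And>x. x \<in> N' \<Longrightarrow> F x = 0) \<Longrightarrow> wt w F"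
proof (induction w arbitrary: F rule: less_induct)
  case (less w)
  show ?case
  proof (cases w)
    case 0
    then show ?thesis using less.prems by simp
  next
    case (Suc v)
    have "wt (v - (q + 1 - a)) (delta g F)" if "a \<le> q" "g \<in> N \<inter> W a" for a g
      using that less.prems NN' subgp_add[OF N'] Suc by (intro less.IH) (auto simp: subset_iff)
    then show ?thesis using Suc by simp
  qed
qed

lemma wt_add: "wt w F \<Longrightarrow> wt w H \<Longrightarrow> wt w (\<lambda>x. F x + H x)"
proof (induction w arbitrary: F H rule: less_induct)
  case (less w)
  show ?case
  proof (cases w)
    case 0
    then show ?thesis using less.prems by simp
  next
    case (Suc v)
    have "wt (v - (q + 1 - a)) (delta g (\<lambda>x. F x + H x))" if "a \<le> q" "g \<in> N \<inter> W a" for a g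
    proof -
      have "wt (v - (q + 1 - a)) (\<lambda>x. delta g F x + delta g H x)"
        using less.prems that Suc by (intro less.IH) auto
      moreover have "delta g (\<lambda>x. F x + H x) = (\<lambda>x. delta g F x + delta g H x)" by auto
      ultimately show ?thesis by simp
    qed
    then show ?thesis using Suc by simp
  qed
qed

lemma wt_uminus: "wt w F \<Longrightarrow> wt w (\<lambda>x. - F x)"
proof (induction w arbitrary: F rule: less_induct)
  case (less w)
  show ?case
  proof (cases w)
    case 0
    then show ?thesis using less.prems by simp
  next
    case (Suc v)
    have "wt (v - (q + 1 - a)) (delta g (\<lambda>x. - F x))" if "a \<le> q" "g \<in> N \<inter> W a" for a g
    proof -
      have "wt (v - (q + 1 - a)) (\<lambda>x. - delta g F x)"
        using less.prems that Suc by (intro less.IH) auto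
      moreover have "delta g (\<lambda>x. - F x) = (\<lambda>x. - delta g F x)" by auto
      ultimately show ?thesis by simp
    qed
    then show ?thesis using Suc by simp
  qed
qed

lemma wt_mono: "v \<le> w \<Longrightarrow> wt v F \<Longrightarrow> wt w F"
proof (induction w arbitrary: v F rule: less_induct)
  case (less w)
  show ?case
  proof (cases v)
    case 0
    then show ?thesis using less.prems by (intro wt_null) simp
  next
    case (Suc u)
    then obtain u' where w: "w = Suc u'" "u \<le> u'" using less.prems(1) by (cases w) auto
    have "wt (u' - (q + 1 - a)) (delta g F)" if "a \<le> q" "g \<in> N \<inter> W a" for a g
    proof (rule less.IH)
      show "u' - (q + 1 - a) < w" using w by simp
      show "u - (q + 1 - a) \<le> u' - (q + 1 - a)" using w by simp
      show "wt (u - (q + 1 - a)) (delta g F)" using less.prems(2) that Suc by simp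
    qed
    then show ?thesis using w by simp
  qed
qed

lemma conjgW: "u \<in> N' \<Longrightarrow> g \<in> N \<Longrightarrow> g \<in> W a \<Longrightarrow> a \<le> q \<Longrightarrow> conjg u g \<in> N \<inter> W a"
proof
  assume u: "u \<in> N'" and g: "g \<in> N" "g \<in> W a" "a \<le> q"
  show "conjg u g \<in> N" using conjg_image_ext[OF N t u] g(1) by blast
  show "conjg u g \<in> W a"
  proof (cases a)
    case 0
    then show ?thesis using g W0 by simp
  next
    case (Suc b)
    then have "comm u g \<in> W a" using central[of b g u] Wmono[of b] g u by auto
    then show ?thesis using subgp_add[OF W _ g(2)] by (simp add: comm_conjg) (metis diff_add_cancel)
  qed
qed

lemma wt_translate: "wt w F \<Longrightarrow> u \<in> N' \<Longrightarrow> wt w (\<lambda>x. F (x + u))"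
proof (induction w arbitrary: F rule: less_induct)
  case (less w)
  show ?case
  proof (cases w)
    case 0
    then show ?thesis using less.prems subgp_add[OF N'] by simp
  next
    case (Suc v)
    have "wt (v - (q + 1 - a)) (delta g (\<lambda>x. F (x + u)))" if a: "a \<le> q" "g \<in> N \<inter> W a" for a g
    proof -
      have "conjg (- u) g \<in> N \<inter> W a" using a less.prems subgp_minus[OF N'] by (intro conjgW) auto
      then have "wt (v - (q + 1 - a)) (delta (conjg (- u) g) F)" using less.prems(1) a(1) Suc by simp
      then have "wt (v - (q + 1 - a)) (\<lambda>x. delta (conjg (- u) g) F (x + u))"
        using less.prems(2) Suc by (intro less.IH) auto
      moreover have "x + g + u = x + u + conjg (- u) g" for x
        by (simp add: conjg_def group_word_simps del: add_uminus_conv_diff)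
      ultimately show ?thesis by simp
    qed
    then show ?thesis using Suc by simp
  qed
qed

lemma t_in: "t \<in> N'"
  by (rule ext_gen[OF N])

lemma linv_t: "linv F \<Longrightarrow> x \<in> N' \<Longrightarrow> F (t + x) = F x"
  using linvD[of F x 1] by simp

text \<open>Left invariance gives \<open>t\<close> weight one. For \<open>w = 0\<close> the function
  is invariant under \<open>N\<close>, and as \<open>N'\<close> is abelian modulo \<open>N\<close>,
  right translation by \<open>t\<close> has the effect of left translation. Otherwise the
  differences by \<open>g\<close> and \<open>t\<close> are interchanged; the correction is a
  difference by a commutator, which lies one term lower in \<open>W\<close> and so has the weight of
  \<open>g\<close> plus one.\<close>

lemma wt_delta_t: "linv F \<Longrightarrow> wt (Suc w) F \<Longrightarrow> wt w (delta t F)"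
proof (induction w arbitrary: F rule: less_induct)
  case (less w)
  show ?case
  proof (cases w)
    case 0
    have "wt 0 (delta g F)" if "g \<in> N" for g
      using less.prems(2) that WN 0 by (auto dest!: spec[of _ q])
    then have inv: "F (x + g) = F x" if "g \<in> N" "x \<in> N'" for g x using that by simp
    have "F (x + t) = F x" if x: "x \<in> N'" for x
    proof -
      have "comm (- x) (- t) \<in> N" using x t_in subgp_minus[OF N'] by (intro derN) auto
      moreover have "x + t = t + x + comm (- x) (- t)"
        by (simp add: comm_def group_word_simps del: add_uminus_conv_diff)
      ultimately have "F (x + t) = F (t + x)" using inv subgp_add[OF N' t_in x] by simp
      then show ?thesis using linv_t[OF less.prems(1) x] by simp
    qed
    then show ?thesis using 0 by simp
  next
    case (Suc v)
    have "wt (v - (q + 1 - a)) (delta g (delta t F))" if a: "a \<le> q" "g \<in> N \<inter> W a" for a g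
    proof (cases a)
      case 0
      then have "g = 0" using a W0 by simp
      then show ?thesis by (intro wt_null) simp
    next
      case (Suc b)
      have gN': "g \<in> N'" using a NN' by blast
      define u where "u = comm (- g) (- t)"
      have "- comm (- t) (- g) \<in> W b"
        using central[of b "- g" "- t"] a Suc subgp_minus[OF W] subgp_minus[OF N' t_in] by auto
      then have "u \<in> N \<inter> W b"
        using derN[of "- g" "- t"] subgp_minus[OF N'] gN' t_in by (auto simp: u_def comm_minus)
      then have "wt (Suc v - (q + 1 - b)) (delta u F)"
        using less.prems(2) \<open>w = Suc v\<close> a(1) Suc by auto
      moreover have "Suc v - (q + 1 - b) = v - (q + 1 - a)" using a(1) Suc by simp
      ultimately have "wt (v - (q + 1 - a)) (delta u F)" by (simp only:)
      then have 1: "wt (v - (q + 1 - a)) (\<lambda>x. delta u F (x + (t + g)))"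
        by (rule wt_translate[OF _ subgp_add[OF N' t_in gN']])
      have gF: "wt (Suc v - (q + 1 - a)) (delta g F)"
        using less.prems(2) \<open>w = Suc v\<close> a by auto
      have 2: "wt (v - (q + 1 - a)) (delta t (delta g F))"
      \<comment> \<open>The subtraction of naturals truncates: in the second case the difference by
        \<open>g\<close> already has weight zero and vanishes on \<open>N'\<close>.\<close>
      proof (cases "q + 1 - a \<le> v")
        case True
        then have "Suc v - (q + 1 - a) = Suc (v - (q + 1 - a))" by simp
        then show ?thesis
          using gF linv_delta[OF less.prems(1) gN'] \<open>w = Suc v\<close> by (intro less.IH) auto
      next
        case False
        then have "Suc v - (q + 1 - a) = 0" by simp
        then have "\<forall>x\<in>N'. delta g F x = 0" using gF by simp
        then show ?thesis using subgp_add[OF N' _ t_in] by (intro wt_null) simp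
      qed
      have "x + g + t = x + (t + g) + u" for x
        by (simp add: u_def comm_def group_word_simps del: add_uminus_conv_diff)
      then have "delta g (delta t F) = (\<lambda>x. delta t (delta g F) x + delta u F (x + (t + g)))"
        by (simp add: fun_eq_iff add.assoc)
      then show ?thesis using wt_add[OF 2 1] by simp
    qed
    then show ?thesis using Suc by simp
  qed
qed

text \<open>A difference by an element of \<open>N\<close> costs at most \<open>q + 2\<close> in
  weight, the cost at \<open>a = 0\<close>.\<close>

lemma fil_wt: "F \<in> fil N' N {} p k \<Longrightarrow> wt (k * (q + 2)) F"
proof (induction k arbitrary: F)
  case (Suc k)
  have "wt (k * (q + 2) + (q + 1) - (q + 1 - a)) (delta g F)" if "a \<le> q" "g \<in> N" for a g
    using Suc that by (intro wt_mono[OF _ Suc.IH]) auto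
  then show ?case by simp
qed simp

text \<open>The elements whose differences take weight \<open>Suc w\<close> to \<open>w\<close> form
  a subgroup. It contains \<open>N\<close>, where even the cheapest difference costs two, and
  \<open>t\<close> by \<open>wt_delta_t\<close>, hence all of \<open>N'\<close>.\<close>

lemma wt_fil: "linv F \<Longrightarrow> wt w F \<Longrightarrow> F \<in> fil N' N' {} p w"
proof (induction w arbitrary: F)
  case (Suc w)
  define A where "A = {d \<in> N'. \<forall>F. linv F \<and> wt (Suc w) F \<longrightarrow> wt w (delta d F)}"
  have "subgp A"
  proof (rule subgpI)
    show "0 \<in> A" unfolding A_def using subgp_zero[OF N'] by (auto intro: wt_null)
    show "d + e \<in> A" if de: "d \<in> A" "e \<in> A" for d e
    proof -
      have "wt w (delta (d + e) F)" if F: "linv F" "wt (Suc w) F" for F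
      proof -
        have "wt w (\<lambda>x. delta e F (x + d) + delta d F x)"
          using de F by (intro wt_add wt_translate) (auto simp: A_def)
        then show ?thesis by (simp add: add.assoc)
      qed
      then show ?thesis using de subgp_add[OF N'] by (simp add: A_def)
    qed
    show "- d \<in> A" if d: "d \<in> A" for d
    proof -
      have "wt w (delta (- d) F)" if F: "linv F" "wt (Suc w) F" for F
      proof -
        have "- d \<in> N'" using d subgp_minus[OF N'] by (simp add: A_def)
        then have "wt w (\<lambda>x. - delta d F (x + - d))"
          using d F by (intro wt_uminus wt_translate) (auto simp: A_def)
        then show ?thesis by simp
      qed
      then show ?thesis using d subgp_minus[OF N'] by (simp add: A_def)
    qed
  qed
  moreover have "N \<subseteq> A"
  proof
    fix g assume g: "g \<in> N"
    have "wt w (delta g F)" if "wt (Suc w) F" for F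
    proof -
      have "wt (w - (q + 1 - q)) (delta g F)" using that g WN by (auto dest!: spec[of _ q])
      then show ?thesis by (rule wt_mono[rotated]) simp
    qed
    then show "g \<in> A" using g NN' by (auto simp: A_def)
  qed
  moreover have "t \<in> A" using t_in wt_delta_t by (simp add: A_def)
  ultimately have "N' \<subseteq> A" by (rule ext_subset)
  then have "delta d F \<in> fil N' N' {} p w" if "d \<in> N'" for d
    using Suc.prems that linv_delta by (intro Suc.IH) (auto simp: A_def)
  then show ?case by simp
qed simp

lemma polynomials_extend:
  assumes faith: "faithful N (fil N N {} p k)"
  shows "\<exists>K. faithful N' (fil N' N' {} p K) \<and> (\<lambda>x. 1) \<in> fil N' N' {} p K"
proof -
  interpret f: filtration N' N "{}" by unfold_locales (use N' N NN' derN in auto)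
  interpret f': filtration N' N' "{}" by unfold_locales (use N' subgp_comm in auto)
  define K where "K = max (k * (q + 2)) 2"
  have const: "(\<lambda>x. c) \<in> fil N' N' {} p 1" for c using f'.fil_const_1[of p c] by simp
  have "deg \<in> fil N' N' {} p 2"
  proof -
    have "delta d deg \<in> fil N' N' {} p 1" if d: "d \<in> N'" for d
      by (rule f'.fil_cong[OF const[of "deg d"]]) (simp add: deg_add d)
    then show ?thesis by (simp add: numeral_2_eq_2)
  qed
  then have degK: "deg \<in> fil N' N' {} p K" by (rule f'.fil_le[rotated]) (simp add: K_def)
  have "lift f \<in> fil N' N' {} p K" if f: "f \<in> fil N N {} p k" for f
  proof -
    have "lift f \<in> fil N' N {} p k" by (rule lift_fil[OF f.filtration_axioms subset_refl _ f]) simp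
    then have "lift f \<in> fil N' N' {} p (k * (q + 2))" by (intro wt_fil[OF linv_lift] fil_wt)
    then show ?thesis by (rule f'.fil_le[rotated]) (simp add: K_def)
  qed
  then have "faithful N' (fil N' N' {} p K)" using faithful_extension[OF faith _ degK] by blast
  moreover have "(\<lambda>x. 1) \<in> fil N' N' {} p K" by (rule f'.fil_le[OF _ const]) (simp add: K_def)
  ultimately show ?thesis by blast
qed

end

text \<open>The central series witnessing that \<open>D\<close> is nilpotent is available at every
  term \<open>B\<close>, so each step of the torsion-free series is a
  \<open>central_ext\<close>.\<close>

lemma polynomials_faithful:
  assumes D: "nilp D" and B: "torsion_free_series D {0} B" "B \<subseteq> D"
  shows "\<exists>k. faithful B (fil B B {} 1 k) \<and> (\<lambda>x. 1) \<in> fil B B {} 1 k"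
  using B
proof (induction rule: torsion_free_series.induct)
  case torsion_free_series_refl
  show ?case by (intro exI[of _ 1]) (auto simp: faithful_def)
next
  case (torsion_free_series_ext B t)
  have sB: "subgp B" using torsion_free_series_subgp[OF torsion_free_series_ext.hyps(1)] by simp
  have BD: "B \<subseteq> D" using torsion_free_series_ext.prems ext_superset by blast
  obtain k where k: "faithful B (fil B B {} 1 k)" using torsion_free_series_ext.IH BD by blast
  obtain W q where W: "W 0 = {0}" "W q = D" "\<forall>a. subgp (W a)" "\<forall>a<q. W a \<subseteq> W (Suc a)"
    "\<forall>a<q. \<forall>w\<in>W (Suc a). \<forall>d\<in>D. comm d w \<in> W a"
    using D unfolding nilp_def by (elim exE conjE) (rule that)
  interpret central_ext B t W q
  proof
    show "comm x y \<in> B" if "x \<in> ext B t" "y \<in> ext B t" for x y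
      using torsion_free_series_ext.hyps(3) that torsion_free_series_ext.prems by blast
    show "comm d w \<in> W a" if "a < q" "w \<in> W (Suc a)" "d \<in> ext B t" for a w d
      using W(5) that torsion_free_series_ext.prems by blast
  qed (use sB torsion_free_series_ext.hyps(2,4) W BD in auto)
  show ?case by (rule polynomials_extend[OF k])
qed

lemma torsion_free_series_good_filtration:
  assumes G: "noeth G" and D: "nilp D" "D \<subseteq> M" "torsion_free_series D {0} D" and M: "M \<subseteq> G" "torsion_free_series M D B" "B \<subseteq> M"
    and der: "\<And>a b. a \<in> M \<Longrightarrow> b \<in> M \<Longrightarrow> comm a b \<in> D"
  shows "good_filtration B D"
  using M(2,3)
proof (induction rule: torsion_free_series.induct)
  case torsion_free_series_refl
  obtain k where "faithful D (fil D D {} 1 k)" "(\<lambda>x. 1) \<in> fil D D {} 1 k"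
    using polynomials_faithful[OF D(1,3) subset_refl] by blast
  then show ?case unfolding good_filtration_def by (intro exI[of _ "[]"] exI[of _ 1] exI[of _ k]) simp
next
  case (torsion_free_series_ext B t)
  note sD = nilp_subgp[OF D(1)]
  have sB: "subgp B" "D \<subseteq> B" using torsion_free_series_subgp[OF torsion_free_series_ext.hyps(1) sD] by auto
  have "good_filtration B D" using torsion_free_series_ext.IH torsion_free_series_ext.prems ext_superset by blast
  moreover have "D \<subseteq> G" using D(2) M(1) by blast
  moreover have "comm x y \<in> D" if "x \<in> ext B t" "y \<in> ext B t" for x y
    using der that torsion_free_series_ext.prems by blast
  ultimately show ?case
    using good_filtration_ext[OF G sD sB(2) _ sB(1) torsion_free_series_ext.hyps(2,4)] by simp
qed

text \<open>Functions live on the whole type but only their values on \<open>H\<close> count, hence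
  the closure under changes off \<open>H\<close>. The constant \<open>1\<close> supplies the
  indicator of a subgroup in an induced module and ensures a nonempty basis.\<close>

definition rep_module :: "'g::group_add set \<Rightarrow> ('g \<Rightarrow> int) set \<Rightarrow> bool" where
  "rep_module H Q \<longleftrightarrow> fun_module Q \<and> (\<forall>f\<in>Q. \<forall>g\<in>H. (\<lambda>x. f (x + g)) \<in> Q) \<and> determined H Q \<and>
     faithful H Q \<and> (\<lambda>x. 1) \<in> Q \<and> (\<forall>f\<in>Q. \<forall>g. (\<forall>x\<in>H. g x = f x) \<longrightarrow> g \<in> Q)"

lemma good_filtration_rep_module:
  assumes G: "noeth G" "N \<subseteq> G" and N: "subgp N" and D: "subgp D" "D \<subseteq> N"
    and der: "\<And>x y. x \<in> N \<Longrightarrow> y \<in> N \<Longrightarrow> comm x y \<in> D" and good_filtration: "good_filtration N D"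
  shows "\<exists>Q. rep_module N Q"
proof -
  obtain ss p k where ss: "set ss \<subseteq> N" and p: "lead_coeff p = 1"
    and span: "\<forall>x\<in>N. \<exists>y\<in>words ss. \<exists>d\<in>D. x = y + d"
    and faith: "faithful N (fil N D (set ss) p k)" and one: "(\<lambda>x. 1) \<in> fil N D (set ss) p k"
    using good_filtration unfolding good_filtration_def by (elim exE conjE) (rule that)
  interpret filtration N D "set ss" by unfold_locales (fact N D ss der)+
  obtain F where F: "finite F" "gen F = D" using noeth_fg[OF G(1) D(1)] D(2) G(2) by (metis subset_trans)
  have "\<exists>y\<in>words ss. \<exists>d\<in>D. x = y + d" if "x \<in> N" for x using span that by blast
  then have "determined N (fil N D (set ss) p k)"
    unfolding determined_def by (rule finite_determining[OF F p refl])
  moreover have "g \<in> fil N D (set ss) p k" if "f \<in> fil N D (set ss) p k" "\<forall>x\<in>N. g x = f x" for f g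
    using fil_cong[OF that(1)] that(2) by blast
  ultimately have "rep_module N (fil N D (set ss) p k)"
    unfolding rep_module_def using fil_fun_module fil_translate faith one by simp
  then show ?thesis by blast
qed

text \<open>The induced module: functions whose restriction to each right coset of \<open>M\<close>
  in \<open>H\<close>, translated to \<open>M\<close>, lies in \<open>Q\<close>. Nonzero elements of
  \<open>M\<close> are detected by functions of \<open>Q\<close> extended by zero, the remaining
  ones by the indicator of \<open>M\<close>.\<close>

lemma rep_module_induced:
  assumes MH: "fin_index M H" and Q: "rep_module M Q"
  shows "\<exists>R. rep_module H R"
proof -
  note s = fin_indexD[OF MH]
  have Qm: "fun_module Q" and Qt: "\<And>f g. f \<in> Q \<Longrightarrow> g \<in> M \<Longrightarrow> (\<lambda>x. f (x + g)) \<in> Q"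
    and Qd: "determined M Q" and Qf: "faithful M Q" and Q1: "(\<lambda>x. 1) \<in> Q"
    and Qc: "\<And>f g. f \<in> Q \<Longrightarrow> \<forall>x\<in>M. g x = f x \<Longrightarrow> g \<in> Q"
    using Q unfolding rep_module_def by auto
  define R where "R = {F. \<forall>x\<in>H. (\<lambda>y. F (y + x)) \<in> Q}"
  have Rm: "fun_module R"
    unfolding fun_module_def R_def
    by (intro conjI ballI allI CollectI)
      (simp_all add: fun_module_zero[OF Qm] fun_module_add[OF Qm] fun_module_scale[OF Qm])
  have Rt: "(\<lambda>x. F (x + g)) \<in> R" if "F \<in> R" "g \<in> H" for F g
    unfolding R_def
  proof (intro CollectI ballI)
    fix x assume "x \<in> H"
    then have "(\<lambda>y. F (y + (x + g))) \<in> Q" using that subgp_add[OF s(2)] by (simp add: R_def)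
    then show "(\<lambda>y. F (y + x + g)) \<in> Q" by (simp add: add.assoc)
  qed
  have Rd: "determined H R"
  proof -
    obtain T where T: "finite T" "T \<subseteq> H" "\<And>h. h \<in> H \<Longrightarrow> \<exists>t\<in>T. h - t \<in> M"
      using fin_indexE[OF MH] by metis
    obtain E where E: "finite E" "E \<subseteq> M" "\<forall>f\<in>Q. (\<forall>e\<in>E. f e = 0) \<longrightarrow> (\<forall>x\<in>M. f x = 0)"
      using Qd unfolding determined_def by (elim exE conjE) (rule that)
    have E3: "f \<in> Q \<Longrightarrow> \<forall>e\<in>E. f e = 0 \<Longrightarrow> \<forall>x\<in>M. f x = 0" for f using E(3) by simp
    let ?E = "(\<lambda>(e, c). e + c) ` (E \<times> T)"
    have "\<forall>x\<in>H. F x = 0" if F: "F \<in> R" "\<forall>e\<in>?E. F e = 0" for F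
    proof
      fix h assume "h \<in> H"
      then obtain c where c: "c \<in> T" "h - c \<in> M" using T(3) by blast
      have "(\<lambda>y. F (y + c)) \<in> Q" using F(1) c(1) T(2) by (auto simp: R_def)
      moreover have "F (e + c) = 0" if "e \<in> E" for e using F(2) c(1) that by force
      then have "\<forall>e\<in>E. F (e + c) = 0" by (intro ballI)
      ultimately have "\<forall>m\<in>M. F (m + c) = 0" by (rule E3)
      then have "F (h - c + c) = 0" using c(2) by blast
      then show "F h = 0" by simp
    qed
    moreover have "finite ?E" using E(1) T(1) by simp
    moreover have "?E \<subseteq> H" using E(2) T(2) s(3) subgp_add[OF s(2)] by (auto simp: subset_iff)
    ultimately show ?thesis unfolding determined_def by (intro exI[of _ ?E] conjI ballI[OF impI])
  qed
  have ext0: "(\<lambda>y. if y \<in> M then f y else 0) \<in> R" if f: "f \<in> Q" for f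
    unfolding R_def
  proof (intro CollectI ballI)
    fix x assume "x \<in> H"
    show "(\<lambda>y. if y + x \<in> M then f (y + x) else 0) \<in> Q"
    proof (cases "x \<in> M")
      case True
      show ?thesis by (rule Qc[OF Qt[OF f True]]) (simp add: subgp_add[OF s(1) _ True])
    next
      case False
      show ?thesis by (rule Qc[OF fun_module_zero[OF Qm]]) (simp add: subgp_add_iff[OF s(1)] False)
    qed
  qed
  have "faithful H R"
    unfolding faithful_def
  proof (intro ballI impI)
    fix g assume g: "g \<in> H" "g \<noteq> 0"
    show "\<exists>f\<in>R. \<exists>x\<in>H. f (x + g) \<noteq> f x"
    proof (cases "g \<in> M")
      case True
      then obtain f x where f: "f \<in> Q" "x \<in> M" "f (x + g) \<noteq> f x" using Qf g(2) unfolding faithful_def by blast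
      then show ?thesis using subgp_add[OF s(1) f(2) True] s(3)
        by (intro bexI[OF _ ext0[OF f(1)]] bexI[of _ x]) auto
    next
      case False
      then show ?thesis using subgp_zero[OF s(1)] subgp_zero[OF s(2)]
        by (intro bexI[OF _ ext0[OF Q1]] bexI[of _ 0]) auto
    qed
  qed
  moreover have "(\<lambda>x. 1) \<in> R" using Q1 by (simp add: R_def)
  moreover have "g \<in> R" if fg: "f \<in> R" "\<forall>x\<in>H. g x = f x" for f g
    unfolding R_def
  proof (intro CollectI ballI)
    fix x assume x: "x \<in> H"
    show "(\<lambda>y. g (y + x)) \<in> Q"
    proof (rule Qc)
      show "(\<lambda>y. f (y + x)) \<in> Q" using fg(1) x by (simp add: R_def)
      show "\<forall>y\<in>M. g (y + x) = f (y + x)" using fg(2) subgp_add[OF s(2) subsetD[OF s(3)] x] by simp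
    qed
  qed
  ultimately have "rep_module H R" unfolding rep_module_def using Rm Rt Rd by simp
  then show ?thesis by blast
qed

theorem pcf_rep_module:
  assumes G: "noeth G" and H: "pcf H" "H \<subseteq> G"
  shows "\<exists>Q. rep_module H Q"
proof -
  obtain M D where MD: "fin_index M H" "nilp D" "D \<subseteq> M" "\<And>a b. a \<in> M \<Longrightarrow> b \<in> M \<Longrightarrow> comm a b \<in> D"
    "torsion_free_series D {0} D" "torsion_free_series M D M"
    by (rule pcf_virtually_torsion_free_series[OF G H]) (rule that)
  note s = fin_indexD[OF MD(1)]
  have MG: "M \<subseteq> G" using s(3) H(2) by blast
  have "good_filtration M D" by (rule torsion_free_series_good_filtration[OF G MD(2,3,5) MG MD(6) subset_refl MD(4)])
  then obtain Q where "rep_module M Q"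
    using good_filtration_rep_module[OF G MG s(1) nilp_subgp[OF MD(2)] MD(3,4)] by blast
  then show ?thesis by (rule rep_module_induced[OF MD(1)])
qed

lemma central_series_pcf: "central_series X C B \<Longrightarrow> pcf C \<Longrightarrow> pcf B"
  by (induction rule: central_series.induct) (auto intro: pcf_ext)

lemma central_chain_pcf:
  assumes G: "noeth G" "F \<subseteq> G" and C: "C 0 = K" "C n = F" "\<And>i. i \<le> n \<Longrightarrow> subgp (C i)"
    "\<And>i. i < n \<Longrightarrow> C i \<subseteq> C (Suc i)" "\<And>i e c. i < n \<Longrightarrow> e \<in> F \<Longrightarrow> c \<in> C (Suc i) \<Longrightarrow> comm e c \<in> C i"
    and K: "pcf K"
  shows "pcf F"
proof -
  have sub: "C i \<subseteq> F" if "i \<le> n" for i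
    using that by (induction rule: inc_induct) (use C(2,4) in auto)
  have "i \<le> n \<Longrightarrow> pcf (C i)" for i
  proof (induction i)
    case (Suc i)
    have "central_series F (C i) (C (Suc i))"
    proof (rule central_series_central[OF G(1)])
      show "C (Suc i) \<subseteq> F" "C (Suc i) \<subseteq> G" using sub Suc.prems G(2) by auto
      show "subgp (C (Suc i))" "subgp (C i)" using C(3) Suc.prems by auto
      show "C i \<subseteq> C (Suc i)" using C(4) Suc.prems by auto
      show "comm x b \<in> C i" if "x \<in> F" "b \<in> C (Suc i)" for x b using C(5) Suc.prems that by auto
    qed (rule central_series_refl)
    then show ?case using central_series_pcf Suc by simp
  qed (use K C(1) in simp)
  then show ?thesis using C(2) by blast
qed

section \<open>Transfer to groups with a carrier\<close>

lemma pcyc_chain: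
  "pcyc K \<Longrightarrow> \<exists>H n. H 0 = {0} \<and> H n = K \<and> (\<forall>i. pcyc (H i)) \<and>
     (\<forall>i<n::nat. \<exists>t. conjg t ` H i = H i \<and> H (Suc i) = ext (H i) t)"
proof (induction rule: pcyc.induct)
  case pcyc_zero
  show ?case by (intro exI[of _ "\<lambda>_. {0}"] exI[of _ 0]) (simp add: pcyc.pcyc_zero)
next
  case (pcyc_ext K t)
  then obtain H n where H: "H 0 = {0}" "H n = K" "\<forall>i. pcyc (H i)"
    "\<forall>i<n::nat. \<exists>t. conjg t ` H i = H i \<and> H (Suc i) = ext (H i) t"
    by (elim exE conjE) (rule that)
  have "pcyc (ext K t)" by (rule pcyc.pcyc_ext[OF pcyc_ext.hyps])
  moreover have "\<exists>s. conjg s ` (if i \<le> n then H i else ext K t) = (if i \<le> n then H i else ext K t) \<and>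
      (if Suc i \<le> n then H (Suc i) else ext K t) = ext (if i \<le> n then H i else ext K t) s" if "i < Suc n" for i
  proof (cases "i = n")
    case True
    then show ?thesis using H(2) pcyc_ext.hyps(2) by (intro exI[of _ t]) simp
  next
    case False
    then show ?thesis using H(4) that by simp
  qed
  ultimately show ?case using H
    by (intro exI[of _ "\<lambda>i. if i \<le> n then H i else ext K t"] exI[of _ "Suc n"]) simp
qed

locale embedded_group = group G for G :: "('a, 'b) monoid_scheme" (structure) +
  fixes \<phi> :: "'a \<Rightarrow> 'g::group_add"
  assumes hom: "x \<in> carrier G \<Longrightarrow> y \<in> carrier G \<Longrightarrow> \<phi> (x \<otimes> y) = \<phi> x + \<phi> y"
    and inj: "inj_on \<phi> (carrier G)"
begin

definition pre :: "'g set \<Rightarrow> 'a set" where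
  "pre K = {x \<in> carrier G. \<phi> x \<in> K}"

lemma phi_one: "\<phi> \<one> = 0"
proof -
  have "\<phi> \<one> + \<phi> \<one> = \<phi> \<one> + 0" using hom[of \<one> \<one>] by simp
  then show ?thesis by (simp only: add_left_cancel)
qed

lemma phi_inv: "x \<in> carrier G \<Longrightarrow> \<phi> (inv x) = - \<phi> x"
proof -
  assume x: "x \<in> carrier G"
  then have "\<phi> x + \<phi> (inv x) = 0" using hom[of x "inv x"] by (simp add: phi_one)
  then show ?thesis by (metis minus_unique)
qed

lemma phi_pow: "x \<in> carrier G \<Longrightarrow> \<phi> (x [^] (n::nat)) = imul (int n) (\<phi> x)"
  by (induction n) (simp_all add: phi_one hom imul_succ_nat' del: of_nat_Suc)

lemma phi_int_pow: "x \<in> carrier G \<Longrightarrow> \<phi> (x [^] (z::int)) = imul z (\<phi> x)"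
proof (cases z)
  case (neg n)
  assume x: "x \<in> carrier G"
  then show ?thesis
    unfolding neg by (simp only: int_pow_neg_int imul_neg phi_inv nat_pow_closed phi_pow)
qed (simp add: int_pow_int phi_pow)

lemma phi_mem: "H \<subseteq> carrier G \<Longrightarrow> x \<in> carrier G \<Longrightarrow> \<phi> x \<in> \<phi> ` H \<longleftrightarrow> x \<in> H"
  using inj by (meson inj_on_image_mem_iff)

lemma phi_eq: "x \<in> carrier G \<Longrightarrow> y \<in> carrier G \<Longrightarrow> \<phi> x = \<phi> y \<longleftrightarrow> x = y"
  using inj by (meson inj_on_eq_iff)

lemma subgp_image: "subgroup H G \<Longrightarrow> subgp (\<phi> ` H)"
proof (rule subgpI)
  assume H: "subgroup H G"
  note HC = subgroup.subset[OF H]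
  show "0 \<in> \<phi> ` H" using subgroup.one_closed[OF H] phi_one by (metis imageI)
  show "x + y \<in> \<phi> ` H" if "x \<in> \<phi> ` H" "y \<in> \<phi> ` H" for x y
  proof -
    obtain a b where ab: "a \<in> H" "b \<in> H" "x = \<phi> a" "y = \<phi> b" using \<open>x \<in> _\<close> \<open>y \<in> _\<close> by auto
    then have "x + y = \<phi> (a \<otimes> b)" using subsetD[OF HC] hom[of a b] by simp
    then show ?thesis using subgroup.m_closed[OF H ab(1,2)] by simp
  qed
  show "- x \<in> \<phi> ` H" if "x \<in> \<phi> ` H" for x
  proof -
    obtain a where a: "a \<in> H" "x = \<phi> a" using \<open>x \<in> _\<close> by auto
    then have "- x = \<phi> (inv a)" using HC phi_inv[of a] by auto
    then show ?thesis using subgroup.m_inv_closed[OF H a(1)] by simp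
  qed
qed

lemma subgroup_pre: "subgp K \<Longrightarrow> subgroup (pre K) G"
  by (rule subgroupI) (auto simp: pre_def hom phi_inv phi_one subgp_zero subgp_add subgp_minus intro!: exI[of _ \<one>])

lemma image_pre: "K \<subseteq> \<phi> ` carrier G \<Longrightarrow> \<phi> ` pre K = K"
  by (auto simp: pre_def)

lemma pre_image: "H \<subseteq> carrier G \<Longrightarrow> pre (\<phi> ` H) = H"
  using phi_mem by (auto simp: pre_def)

lemma noeth_image:
  assumes "noetherian_group G"
  shows "noeth (\<phi> ` carrier G)"
  unfolding noeth_def
proof (intro conjI allI impI)
  show "subgp (\<phi> ` carrier G)" by (rule subgp_image[OF subgroup_self])
  fix \<S> assume S: "\<S> \<noteq> {} \<and> (\<forall>H\<in>\<S>. subgp H \<and> H \<subseteq> \<phi> ` carrier G)"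
  then have "pre ` \<S> \<subseteq> {H. subgroup H G} \<and> pre ` \<S> \<noteq> {}" using subgroup_pre by auto
  then have "\<exists>M\<in>pre ` \<S>. \<forall>H\<in>pre ` \<S>. M \<subseteq> H \<longrightarrow> H = M"
    using assms[unfolded noetherian_group_def, THEN spec, of "pre ` \<S>"] by (rule mp[rotated])
  then obtain M where M: "M \<in> \<S>" "\<And>H. H \<in> \<S> \<Longrightarrow> pre M \<subseteq> pre H \<Longrightarrow> pre H = pre M" by auto
  have "H = M" if H: "H \<in> \<S>" "M \<subseteq> H" for H
  proof -
    have "pre H = pre M" using H(2) by (intro M(2)[OF H(1)]) (auto simp: pre_def)
    then have "\<phi> ` pre H = \<phi> ` pre M" by (rule arg_cong)
    moreover have "\<phi> ` pre H = H" "\<phi> ` pre M = M" using S H(1) M(1) by (intro image_pre; blast)+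
    ultimately show ?thesis by (simp only:)
  qed
  then show "\<exists>M\<in>\<S>. \<forall>H\<in>\<S>. M \<subseteq> H \<longrightarrow> H = M" using M(1) by blast
qed

text \<open>\<open>F\<close> is finitely generated by the maximal condition, so the factor is
  generated by finitely many cosets and its local property becomes a global one: it is finite or
  nilpotent.\<close>

lemma factor_pcf:
  assumes G: "noeth (\<phi> ` carrier G)" and K: "K \<lhd> G" and F: "F \<lhd> G" and KF: "K \<subseteq> F" and pcf: "pcf (\<phi> ` K)"
    and fac: "locally_nilpotent_group (G\<lparr>carrier := F\<rparr> Mod K) \<or> locally_finite_group (G\<lparr>carrier := F\<rparr> Mod K)"
  shows "pcf (\<phi> ` F)"
proof -
  let ?F = "G\<lparr>carrier := F\<rparr>"
  let ?Q = "?F Mod K"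
  have sF: "subgroup F G" and sK: "subgroup K G" using F K by (simp_all add: normal_imp_subgroup)
  have FC: "F \<subseteq> carrier G" using sF by (rule subgroup.subset)
  have KnF: "K \<lhd> ?F" by (rule normal_restrict_supergroup[OF sF K KF])
  interpret n: normal K ?F by (rule KnF)
  interpret q: group ?Q by (rule n.factorgroup_is_group)
  have coset: "r_coset ?F K x = K #> x" for x by (simp add: r_coset_def)
  have carQ: "carrier ?Q = (\<lambda>x. K #> x) ` F" using carrier_FactGroup[of ?F K] by (simp add: coset)
  have multQ: "(K #> x) \<otimes>\<^bsub>?Q\<^esub> (K #> y) = K #> (x \<otimes> y)" if "x \<in> F" "y \<in> F" for x y
    using n.rcos_sum[of x y] that by (simp add: coset)
  have invQ: "inv\<^bsub>?Q\<^esub> (K #> x) = K #> inv x" if "x \<in> F" for x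
    using n.inv_FactGroup[of "K #> x"] n.rcos_inv[of x] that carQ m_inv_consistent[OF sF] by (simp add: coset)
  have oneQ: "\<one>\<^bsub>?Q\<^esub> = K" by simp
  have subA: "subgroup {x \<in> F. K #> x \<in> A} G" if A: "subgroup A ?Q" for A
  proof (rule subgroupI)
    show "{x \<in> F. K #> x \<in> A} \<subseteq> carrier G" using FC by blast
    have "K #> \<one> = K" by (rule coset_mult_one[OF subgroup.subset[OF sK]])
    then show "{x \<in> F. K #> x \<in> A} \<noteq> {}"
      using subgroup.one_closed[OF sF] subgroup.one_closed[OF A] unfolding oneQ by force
    show "inv x \<in> {x \<in> F. K #> x \<in> A}" if "x \<in> {x \<in> F. K #> x \<in> A}" for x
      using that subgroup.m_inv_closed[OF A, of "K #> x"] subgroup.m_inv_closed[OF sF, of x] invQ[of x] by simp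
    show "x \<otimes> y \<in> {x \<in> F. K #> x \<in> A}" if "x \<in> {x \<in> F. K #> x \<in> A}" "y \<in> {x \<in> F. K #> x \<in> A}" for x y
      using that subgroup.m_closed[OF A, of "K #> x" "K #> y"] subgroup.m_closed[OF sF, of x y] multQ[of x y] by simp
  qed
  have sf: "subgp (\<phi> ` F)" by (rule subgp_image[OF sF])
  have fG: "\<phi> ` F \<subseteq> \<phi> ` carrier G" using FC by blast
  obtain S where S: "finite S" "S \<subseteq> \<phi> ` F" "gen S = \<phi> ` F" using noeth_fg[OF G sf fG] by metis
  obtain S0 where S0: "finite S0" "S0 \<subseteq> F" "S = \<phi> ` S0" using S(1,2) by (meson finite_subset_image)
  let ?S = "(\<lambda>x. K #> x) ` S0"
  have SQ: "finite ?S" "?S \<subseteq> carrier ?Q" using S0 carQ by auto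
  let ?A = "carrier (subgroup_generated ?Q ?S)"
  have A: "subgroup ?A ?Q" by (rule q.subgroup_subgroup_generated)
  \<comment> \<open>The preimage in \<open>F\<close> of the subgroup generated by the cosets of
    \<open>S0\<close> is a subgroup containing \<open>S0\<close>, hence all of
    \<open>F\<close>.\<close>
  have "gen S \<subseteq> \<phi> ` {x \<in> F. K #> x \<in> ?A}"
  proof (rule gen_least)
    show "subgp (\<phi> ` {x \<in> F. K #> x \<in> ?A})" by (rule subgp_image[OF subA[OF A]])
    show "S \<subseteq> \<phi> ` {x \<in> F. K #> x \<in> ?A}"
      using q.subgroup_generated_subset_carrier_subset[OF SQ(2)] S0(2,3) by auto
  qed
  then have img: "\<phi> ` F \<subseteq> \<phi> ` {x \<in> F. K #> x \<in> ?A}" using S(3) by simp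
  have FA: "K #> x \<in> ?A" if x: "x \<in> F" for x
  proof -
    obtain y where y: "y \<in> F" "K #> y \<in> ?A" "\<phi> x = \<phi> y" using img x by blast
    then show ?thesis using phi_eq[of x y] x FC by auto
  qed
  have full: "?A = carrier ?Q"
  proof (rule subset_antisym[OF q.carrier_subgroup_generated_subset])
    show "carrier ?Q \<subseteq> ?A" unfolding carQ using FA by (rule image_subsetI)
  qed
  then have genQ: "subgroup_generated ?Q ?S = ?Q"
    by (simp add: subgroup_generated_def)
  from fac show ?thesis
  proof
    assume "locally_finite_group ?Q"
    then have fin: "finite (carrier ?Q)" using SQ full unfolding locally_finite_group_def by metis
    define T where "T = (\<lambda>X. SOME x. x \<in> F \<and> X = K #> x) ` carrier ?Q"
    have rep: "(SOME x. x \<in> F \<and> X = K #> x) \<in> F \<and> X = K #> (SOME x. x \<in> F \<and> X = K #> x)" if "X \<in> carrier ?Q" for X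
      by (rule someI_ex) (use that carQ in auto)
    have "\<exists>t\<in>\<phi> ` T. h - t \<in> \<phi> ` K" if h: "h \<in> \<phi> ` F" for h
    proof -
      obtain x where x: "x \<in> F" "h = \<phi> x" using h by blast
      then have X: "K #> x \<in> carrier ?Q" using carQ by blast
      define y where "y = (SOME y. y \<in> F \<and> K #> x = K #> y)"
      have y: "y \<in> F" "K #> x = K #> y" using rep[OF X] by (simp_all add: y_def)
      have "x \<in> K #> y" using rcos_self[OF _ sK, of x] x(1) FC y(2) by auto
      then obtain k where k: "k \<in> K" "x = k \<otimes> y" by (auto simp: r_coset_def)
      have "k \<in> carrier G" "y \<in> carrier G" using k(1) y(1) FC KF by auto
      then have "h - \<phi> y = \<phi> k" using hom[of k y] x(2) k(2) by simp
      moreover have "y \<in> T" unfolding T_def y_def using X by blast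
      ultimately show ?thesis using k(1) by auto
    qed
    moreover have "finite (\<phi> ` T)" "\<phi> ` T \<subseteq> \<phi> ` F" using fin rep by (auto simp: T_def)
    ultimately have "fin_index (\<phi> ` K) (\<phi> ` F)"
      unfolding fin_index_def using subgp_image[OF sK] sf KF
      by (intro conjI exI[of _ "\<phi> ` T"] ballI) auto
    then show ?thesis by (rule pcf_fin[OF pcf])
  next
    assume "locally_nilpotent_group ?Q"
    then have "nilpotent_group ?Q" using SQ genQ unfolding locally_nilpotent_group_def by metis
    then obtain n :: nat and Hs where Hs: "Hs 0 = {\<one>\<^bsub>?Q\<^esub>}" "Hs n = carrier ?Q" "\<forall>i\<le>n. Hs i \<lhd> ?Q"
      "\<forall>i<n. Hs i \<subseteq> Hs (Suc i) \<and> carrier (?Q\<lparr>carrier := Hs (Suc i)\<rparr> Mod Hs i) \<subseteq> group_center (?Q Mod Hs i)"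
      unfolding nilpotent_group_def by (elim exE conjE) (rule that)
    define C where "C i = {x \<in> F. K #> x \<in> Hs i}" for i
    have sC: "subgroup (C i) G" if "i \<le> n" for i
      unfolding C_def using Hs(3) that by (intro subA normal_imp_subgroup) auto
    show ?thesis
    proof (rule central_chain_pcf[OF G fG _ _ _ _ _ pcf, of "\<lambda>i. \<phi> ` C i" n])
      have "K #> x = K \<longleftrightarrow> x \<in> K" if "x \<in> F" for x
        using coset_join1[OF _ _ sK, of x] coset_join2[OF _ sK, of x] that FC subgroup.subset[OF sK] by auto
      then have "C 0 = K" using KF Hs(1) by (auto simp: C_def)
      then show "\<phi> ` C 0 = \<phi> ` K" by simp
      show "\<phi> ` C n = \<phi> ` F" using Hs(2) carQ by (auto simp: C_def)
      show "subgp (\<phi> ` C i)" if "i \<le> n" for i using subgp_image[OF sC[OF that]] .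
      show "\<phi> ` C i \<subseteq> \<phi> ` C (Suc i)" if "i < n" for i using Hs(4) that by (auto simp: C_def)
      show "comm e c \<in> \<phi> ` C i" if i: "i < n" and e: "e \<in> \<phi> ` F" and c: "c \<in> \<phi> ` C (Suc i)" for i e c
      proof -
        obtain x y where x: "x \<in> F" "e = \<phi> x" and y: "y \<in> F" "K #> y \<in> Hs (Suc i)" "c = \<phi> y"
          using e c by (auto simp: C_def)
        have xy: "x \<in> carrier G" "y \<in> carrier G" using x y FC by auto
        interpret m: normal "Hs i" ?Q using Hs(3) i by simp
        let ?X = "K #> x" and ?Y = "K #> y"
        have XY: "?X \<in> carrier ?Q" "?Y \<in> carrier ?Q" using x(1) y(1) carQ by auto
        \<comment> \<open>Centrality is stated for cosets of \<open>Hs i\<close> in the quotient by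
          \<open>K\<close>. It is unfolded to \<open>X Y = Z (Y X)\<close> with \<open>Z\<close> in
          \<open>Hs i\<close>, and \<open>Z\<close> turns out to be the coset of the
          commutator.\<close>
        have "r_coset ?Q (Hs i) ?Y \<in> carrier (?Q\<lparr>carrier := Hs (Suc i)\<rparr> Mod Hs i)"
          using y(2) by (simp add: carrier_FactGroup r_coset_def image_iff) blast
        then have "r_coset ?Q (Hs i) ?Y \<in> group_center (?Q Mod Hs i)" using Hs(4) i by blast
        moreover have "r_coset ?Q (Hs i) ?X \<in> carrier (?Q Mod Hs i)" using XY(1) by (simp add: carrier_FactGroup)
        ultimately have "set_mult ?Q (r_coset ?Q (Hs i) ?Y) (r_coset ?Q (Hs i) ?X) =
            set_mult ?Q (r_coset ?Q (Hs i) ?X) (r_coset ?Q (Hs i) ?Y)"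
          unfolding group_center_def by auto
        then have "r_coset ?Q (Hs i) (?Y \<otimes>\<^bsub>?Q\<^esub> ?X) = r_coset ?Q (Hs i) (?X \<otimes>\<^bsub>?Q\<^esub> ?Y)"
          using m.rcos_sum XY by simp
        then have "?X \<otimes>\<^bsub>?Q\<^esub> ?Y \<in> r_coset ?Q (Hs i) (?Y \<otimes>\<^bsub>?Q\<^esub> ?X)"
          using q.rcos_self[OF q.m_closed[OF XY] m.subgroup_axioms] by simp
        then obtain Z where Z: "Z \<in> Hs i" "?X \<otimes>\<^bsub>?Q\<^esub> ?Y = Z \<otimes>\<^bsub>?Q\<^esub> (?Y \<otimes>\<^bsub>?Q\<^esub> ?X)"
          unfolding r_coset_def by auto
        have ZQ: "Z \<in> carrier ?Q" using m.subset Z(1) by blast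
        have yx: "y \<otimes> x \<in> F" "x \<otimes> y \<in> F" using x(1) y(1) subgroup.m_closed[OF sF] by auto
        have "Z = (?X \<otimes>\<^bsub>?Q\<^esub> ?Y) \<otimes>\<^bsub>?Q\<^esub> inv\<^bsub>?Q\<^esub> (?Y \<otimes>\<^bsub>?Q\<^esub> ?X)"
          using Z(2) ZQ XY by (simp only: q.m_assoc q.m_closed q.inv_closed q.r_inv q.r_one)
        also have "\<dots> = K #> ((x \<otimes> y) \<otimes> inv (y \<otimes> x))"
          using x(1) y(1) yx subgroup.m_inv_closed[OF sF] by (simp only: multQ invQ)
        finally have "(x \<otimes> y) \<otimes> inv (y \<otimes> x) \<in> C i"
          using Z(1) yx subgroup.m_closed[OF sF] subgroup.m_inv_closed[OF sF] by (simp add: C_def)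
        moreover have "comm e c = \<phi> ((x \<otimes> y) \<otimes> inv (y \<otimes> x))"
          unfolding x(2) y(3) comm_def using xy
          by (simp add: hom phi_inv group_word_simps del: add_uminus_conv_diff)
        ultimately show ?thesis by blast
      qed
    qed
  qed
qed

text \<open>Transfinite induction along the given series; no finite subseries is extracted. At a
  limit the maximal condition yields a largest earlier term, and the union equals it.\<close>

lemma generalized_radical_pcf:
  assumes noe: "noetherian_group G" and rad: "generalized_radical G"
  shows "pcf (\<phi> ` carrier G)"
proof -
  note G = noeth_image[OF noe]
  obtain r :: "'a set rel" and H where ser: "ascending_normal_series G r H" and fac: "factors_locally_nilpotent_or_finite G r H"
    using rad unfolding generalized_radical_def by blast
  have wo: "Well_order r" and nrm: "\<And>i. i \<in> Field r \<Longrightarrow> H i \<lhd> G"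
    and mono: "\<And>i j. (i, j) \<in> r \<Longrightarrow> H i \<subseteq> H j"
    and zero: "\<And>i. i \<in> Field r \<Longrightarrow> underS r i = {} \<Longrightarrow> H i = {\<one>}"
    and lim: "\<And>j. is_limit r j \<Longrightarrow> H j = (\<Union>i\<in>underS r j. H i)"
    using ser unfolding ascending_normal_series_def by auto
  obtain l where l: "l \<in> Field r" "H l = carrier G"
    using ser unfolding ascending_normal_series_def by auto
  interpret w: wo_rel r by (simp add: wo_rel_def wo)
  have "j \<in> Field r \<longrightarrow> pcf (\<phi> ` H j)" for j
  proof (rule w.well_order_induct[of _ j], intro impI)
    fix j assume IH: "\<forall>i. i \<noteq> j \<and> (i, j) \<in> r \<longrightarrow> i \<in> Field r \<longrightarrow> pcf (\<phi> ` H i)" and j: "j \<in> Field r"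
    have below: "pcf (\<phi> ` H i) \<and> i \<in> Field r \<and> H i \<subseteq> H j" if "i \<in> underS r j" for i
    proof -
      have "i \<noteq> j" "(i, j) \<in> r" using that by (auto simp: underS_def)
      then show ?thesis using IH mono by (auto simp: Field_def)
    qed
    consider "underS r j = {}" | i where "is_succ r i j" | "is_limit r j"
      using j unfolding is_limit_def by blast
    then show "pcf (\<phi> ` H j)"
    proof cases
      case 1
      then show ?thesis using zero[OF j] by (simp add: phi_one pcf_zero)
    next
      case (2 i)
      then have i: "i \<in> Field r" "underS r j = under r i" by (auto simp: is_succ_def)
      then have "i \<in> underS r j" using w.REFL by (auto simp: refl_on_def under_def)
      then have b: "pcf (\<phi> ` H i)" "H i \<subseteq> H j" using below by auto
      show ?thesis
        using factor_pcf[OF G nrm[OF i(1)] nrm[OF j] b(2,1)] fac 2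
        unfolding factors_locally_nilpotent_or_finite_def by blast
    next
      case 3
      then obtain i0 where i0: "i0 \<in> underS r j" by (auto simp: is_limit_def)
      let ?\<S> = "(\<lambda>i. \<phi> ` H i) ` underS r j"
      have sub: "H i \<subseteq> carrier G" "subgroup (H i) G" if "i \<in> underS r j" for i
        using nrm[of i] below[OF that] normal_imp_subgroup subgroup.subset by blast+
      obtain M where M: "M \<in> ?\<S>" "\<And>K. K \<in> ?\<S> \<Longrightarrow> M \<subseteq> K \<Longrightarrow> K = M"
      proof (rule noeth_maximal[OF G, of "\<phi> ` H i0" ?\<S>])
        show "\<phi> ` H i0 \<in> ?\<S>" using i0 by blast
        show "subgp K" if "K \<in> ?\<S>" for K using that sub(2) subgp_image by auto
        show "K \<subseteq> \<phi> ` carrier G" if "K \<in> ?\<S>" for K using that sub(1) by auto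
      qed (rule that)
      obtain m where m: "m \<in> underS r j" "M = \<phi> ` H m" using M(1) by blast
      have "H i \<subseteq> H m" if i: "i \<in> underS r j" for i
      proof -
        have "(i, m) \<in> r \<or> (m, i) \<in> r" using below i m(1) w.TOTALS by blast
        then show ?thesis
        proof
          assume "(m, i) \<in> r"
          then have "\<phi> ` H m \<subseteq> \<phi> ` H i" using mono by blast
          then have "\<phi> ` H i = \<phi> ` H m" using M(2)[of "\<phi> ` H i"] m(2) i by blast
          then show ?thesis using inj_on_image_eq_iff[OF inj sub(1)[OF i] sub(1)[OF m(1)]] by simp
        qed (rule mono)
      qed
      then have "H j = H m" using lim[OF 3] m(1) by blast
      then show ?thesis using below[OF m(1)] by simp
    qed
  qed
  then show ?thesis using l by metis
qed

lemma normal_pre: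
  assumes K: "subgp K" "K \<subseteq> L" and L: "subgp L" and inv: "\<And>x k. x \<in> L \<Longrightarrow> k \<in> K \<Longrightarrow> conjg x k \<in> K"
  shows "pre K \<lhd> G\<lparr>carrier := pre L\<rparr>"
proof -
  have sL: "subgroup (pre L) G" and sK: "subgroup (pre K) G" using L K(1) by (simp_all add: subgroup_pre)
  interpret l: group "G\<lparr>carrier := pre L\<rparr>" by (rule subgroup.subgroup_is_group[OF sL group_axioms])
  have "subgroup (pre K) (G\<lparr>carrier := pre L\<rparr>)"
    using K(2) by (intro subgroup_incl sK sL) (auto simp: pre_def)
  moreover have "x \<otimes> h \<otimes> inv x \<in> pre K" if x: "x \<in> pre L" and h: "h \<in> pre K" for x h
  proof -
    have xc: "x \<in> carrier G" "h \<in> carrier G" "\<phi> x \<in> L" "\<phi> h \<in> K" using x h by (auto simp: pre_def)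
    then have "\<phi> (x \<otimes> h \<otimes> inv x) = conjg (\<phi> x) (\<phi> h)" by (simp add: hom phi_inv conjg_def)
    then show ?thesis using inv xc by (simp add: pre_def)
  qed
  ultimately show ?thesis
    unfolding l.normal_inv_iff using m_inv_consistent[OF sL] by simp
qed

text \<open>The coset of a preimage of \<open>t\<close> generates the factor, since
  \<open>ext\<close> writes every element as one of the lower term plus a multiple of
  \<open>t\<close>.\<close>

lemma polycyclic_pre:
  assumes K: "pcyc K" "K \<subseteq> \<phi> ` carrier G"
  shows "polycyclic_group (G\<lparr>carrier := pre K\<rparr>)"
proof -
  obtain H n where H: "H 0 = {0}" "H n = K" "\<forall>i. pcyc (H i)"
    "\<forall>i<n::nat. \<exists>t. conjg t ` H i = H i \<and> H (Suc i) = ext (H i) t"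
    using pcyc_chain[OF K(1)] by (elim exE conjE) (rule that)
  have sub: "subgp (H i)" for i using H(3) pcyc_subgp by blast
  have step: "H i \<subseteq> H (Suc i)" if "i < n" for i using H(4) that ext_superset by metis
  have HK: "H i \<subseteq> K" if "i \<le> n" for i
    using that by (induction rule: inc_induct) (use H(2) step in auto)
  have sK: "subgroup (pre K) G" using K(1) by (simp add: subgroup_pre pcyc_subgp)
  show ?thesis
    unfolding polycyclic_group_def
  proof (intro exI[of _ n] exI[of _ "\<lambda>i. pre (H i)"] conjI allI impI)
    show "pre (H 0) = {\<one>\<^bsub>G\<lparr>carrier := pre K\<rparr>\<^esub>}"
      using phi_eq[OF _ one_closed] by (auto simp: H(1) pre_def phi_one)
    show "pre (H n) = carrier (G\<lparr>carrier := pre K\<rparr>)" by (simp add: H(2))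
    show "subgroup (pre (H i)) (G\<lparr>carrier := pre K\<rparr>)" if "i \<le> n" for i
      using HK[OF that] by (intro subgroup_incl subgroup_pre sub sK) (auto simp: pre_def)
    fix i assume i: "i < n"
    obtain t where t: "conjg t ` H i = H i" "H (Suc i) = ext (H i) t" using H(4) i by blast
    have car: "G\<lparr>carrier := pre K, carrier := pre (H (Suc i))\<rparr> = G\<lparr>carrier := pre (H (Suc i))\<rparr>" by simp
    let ?F = "G\<lparr>carrier := pre (H (Suc i))\<rparr>"
    have nrm: "pre (H i) \<lhd> ?F"
      using conjg_image_ext[OF sub t(1)] t(2) step[OF i] by (intro normal_pre sub) blast+
    then show "pre (H i) \<lhd> G\<lparr>carrier := pre K, carrier := pre (H (Suc i))\<rparr>" by simp
    interpret n: normal "pre (H i)" ?F by (rule nrm)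
    interpret q: group "?F Mod pre (H i)" by (rule n.factorgroup_is_group)
    have sS: "subgroup (pre (H (Suc i))) G" by (rule subgroup_pre[OF sub])
    have "t \<in> H (Suc i)" unfolding t(2) by (rule ext_gen[OF sub])
    moreover have "H (Suc i) \<subseteq> \<phi> ` carrier G" using HK[of "Suc i"] i K(2) by auto
    ultimately obtain a where a: "a \<in> carrier G" "\<phi> a = t" "a \<in> pre (H (Suc i))" by (auto simp: pre_def)
    let ?c = "\<lambda>x. r_coset ?F (pre (H i)) x"
    have pow: "?c a [^]\<^bsub>?F Mod pre (H i)\<^esub> z = ?c (a [^] z)" for z :: int
      using n.FactGroup_int_pow[of a z] a(3) int_pow_consistent[OF sS a(3)] by simp
    have "X \<in> range (\<lambda>z::int. ?c a [^]\<^bsub>?F Mod pre (H i)\<^esub> z)" if X: "X \<in> carrier (?F Mod pre (H i))" for X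
    proof -
      obtain x where x: "x \<in> pre (H (Suc i))" "X = ?c x" using X by (auto simp: carrier_FactGroup)
      then obtain m z where m: "m \<in> H i" "\<phi> x = m + imul z t" by (auto simp: pre_def t(2) ext_iff)
      have xc: "x \<in> carrier G" using x(1) by (simp add: pre_def)
      have az: "a [^] z \<in> carrier G" "a [^] z \<in> pre (H (Suc i))"
        using a(1) subgroup_int_pow_closed[OF sS a(3)] by auto
      define k where "k = x \<otimes> inv (a [^] z)"
      have "\<phi> k = m" using xc az(1) a by (simp add: k_def hom phi_inv phi_int_pow m(2))
      then have k: "k \<in> pre (H i)" using m(1) xc az(1) by (simp add: pre_def k_def)
      have "x = k \<otimes> a [^] z" using xc az(1) by (simp add: k_def m_assoc)
      then have "x \<in> ?c (a [^] z)" using k by (auto simp: r_coset_def)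
      then have "?c (a [^] z) = ?c x"
        using n.repr_independence[of x "pre (H i)" "a [^] z"] az(2) n.subgroup_axioms by simp
      then show ?thesis using pow x(2) by (metis rangeI)
    qed
    moreover have "?c a \<in> carrier (?F Mod pre (H i))" using a(3) by (auto simp: carrier_FactGroup)
    ultimately have "cyclic_group (?F Mod pre (H i))"
      unfolding q.cyclic_group by (intro bexI[of _ "?c a"]) auto
    then show "cyclic_group (G\<lparr>carrier := pre K, carrier := pre (H (Suc i))\<rparr> Mod pre (H i))" by simp
  qed
qed

text \<open>A polycyclic subgroup of finite index need not be normal; \<open>fin_index_core\<close>
  shrinks it to one that is, and polycyclicity passes to subgroups.\<close>

lemma polycyclic_by_finite:
  assumes noe: "noetherian_group G" and pcf: "pcf (\<phi> ` carrier G)"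
  shows "polycyclic_by_finite_group G"
proof -
  note G = noeth_image[OF noe]
  note sG = noeth_subgp[OF G]
  obtain M where M: "fin_index M (\<phi> ` carrier G)" "pcyc M"
    using pcf_virtually_pcyc[OF G pcf subset_refl] by blast
  obtain K where K: "fin_index K (\<phi> ` carrier G)" "K \<subseteq> M"
    "\<And>x. conjg x ` (\<phi> ` carrier G) = \<phi> ` carrier G \<Longrightarrow> conjg x ` K = K"
    by (rule fin_index_core[OF G subset_refl M(1)]) (rule that)
  note s = fin_indexD[OF K(1)]
  have pcycK: "pcyc K" using pcyc_subset[OF M(2) s(1) K(2)] .
  have "conjg x k \<in> K" if "x \<in> \<phi> ` carrier G" "k \<in> K" for x k
    using K(3)[OF conjg_image_self[OF sG that(1)]] that(2) by blast
  then have "pre K \<lhd> G\<lparr>carrier := pre (\<phi> ` carrier G)\<rparr>"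
    using s(1,3) sG by (intro normal_pre) auto
  then have nrm: "pre K \<lhd> G" by (simp add: pre_image)
  obtain T where T: "finite T" "T \<subseteq> \<phi> ` carrier G" "\<And>h. h \<in> \<phi> ` carrier G \<Longrightarrow> \<exists>t\<in>T. h - t \<in> K"
    using fin_indexE[OF K(1)] by metis
  have "carrier (G Mod pre K) \<subseteq> (\<lambda>a. pre K #> a) ` pre T"
  proof
    fix X assume "X \<in> carrier (G Mod pre K)"
    then obtain x where x: "x \<in> carrier G" "X = pre K #> x" by (auto simp: carrier_FactGroup)
    then obtain a where a: "a \<in> carrier G" "\<phi> a \<in> T" "\<phi> x - \<phi> a \<in> K" using T(3)[of "\<phi> x"] T(2) by blast
    have "x \<otimes> inv a \<in> pre K" using x(1) a by (simp add: pre_def hom phi_inv)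
    then have "x \<otimes> inv a \<otimes> a \<in> pre K #> a" unfolding r_coset_def by blast
    moreover have "x \<otimes> inv a \<otimes> a = x" using x(1) a(1) by (simp add: m_assoc)
    ultimately have "X = pre K #> a"
      using repr_independence[of x "pre K" a] a(1) x(2) subgroup_pre[OF s(1)] by simp
    then show "X \<in> (\<lambda>a. pre K #> a) ` pre T" using a by (auto simp: pre_def)
  qed
  moreover have "pre T = \<phi> -` T \<inter> carrier G" by (auto simp: pre_def)
  then have "finite (pre T)" using finite_vimage_IntI[OF T(1) inj] by simp
  ultimately have "finite (carrier (G Mod pre K))" by (meson finite_imageI finite_subset)
  then show ?thesis
    unfolding polycyclic_by_finite_group_def using nrm polycyclic_pre[OF pcycK s(3)] by blast
qed

end

section \<open>Matrices\<close>

text \<open>Column \<open>j\<close> of \<open>A g\<close> holds the coordinates of the translate of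
  the \<open>j\<close>-th basis function by \<open>g\<close>. As the translation is on the right of
  the argument, \<open>A\<close> preserves the order of products.\<close>

lemma rep_module_matrices:
  assumes H: "subgp H" and Q: "rep_module H Q"
  obtains n and A :: "'g::group_add \<Rightarrow> int mat" where "n \<ge> 1" "\<And>g. A g \<in> carrier_mat n n"
    "\<And>g h. g \<in> H \<Longrightarrow> h \<in> H \<Longrightarrow> A (g + h) = A g * A h" "A 0 = 1\<^sub>m n" "inj_on A H"
proof -
  have Qm: "fun_module Q" and Qt: "\<And>f g. f \<in> Q \<Longrightarrow> g \<in> H \<Longrightarrow> (\<lambda>x. f (x + g)) \<in> Q"
    and Qd: "determined H Q" and Qf: "faithful H Q" and Q1: "(\<lambda>x. 1) \<in> Q"
    using Q unfolding rep_module_def by auto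
  obtain bs where bs: "set bs \<subseteq> Q"
    "\<And>f. f \<in> Q \<Longrightarrow> \<exists>c. \<forall>x\<in>H. f x = (\<Sum>i<length bs. c i * (bs ! i) x)"
    "\<And>c. (\<forall>x\<in>H. (\<Sum>i<length bs. c i * (bs ! i) x) = 0) \<Longrightarrow> (\<forall>i<length bs. c i = (0::int))"
    by (rule determined_basis[OF Qd Qm]) (rule that)
  define n where "n = length bs"
  have bQ: "bs ! j \<in> Q" if "j < n" for j using bs(1) nth_mem that by (auto simp: n_def)
  define co where "co f = (SOME c. \<forall>x\<in>H. f x = (\<Sum>i<n. c i * (bs ! i) x))" for f :: "'g \<Rightarrow> int"
  have co: "f x = (\<Sum>i<n. co f i * (bs ! i) x)" if "f \<in> Q" "x \<in> H" for f x
    using someI_ex[OF bs(2)[OF that(1)]] that(2) unfolding co_def n_def by blast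
  have uniq: "c i = d i"
    if "\<And>x. x \<in> H \<Longrightarrow> (\<Sum>i<n. c i * (bs ! i) x) = (\<Sum>i<n. d i * (bs ! i) x)" "i < n" for c d :: "nat \<Rightarrow> int" and i
  proof -
    have "\<forall>x\<in>H. (\<Sum>i<length bs. (c i - d i) * (bs ! i) x) = 0"
      using that(1) by (simp add: left_diff_distrib sum_subtractf n_def)
    then show ?thesis using bs(3)[of "\<lambda>i. c i - d i"] that(2) by (simp add: n_def)
  qed
  \<comment> \<open>The constant \<open>1\<close> is a nonzero function on \<open>H\<close>, so the
    basis is not empty.\<close>
  have n: "n \<ge> 1"
  proof (rule ccontr)
    assume "\<not> n \<ge> 1"
    then have "n = 0" by simp
    then show False using co[OF Q1 subgp_zero[OF H]] by simp
  qed
  define a where "a g i j = co (\<lambda>x. (bs ! j) (x + g)) i" for g i j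
  have a: "(bs ! j) (x + g) = (\<Sum>i<n. a g i j * (bs ! i) x)" if "g \<in> H" "j < n" "x \<in> H" for g j x
    using co[OF Qt[OF bQ[OF that(2)] that(1)] that(3)] by (simp add: a_def)
  define A where "A g = mat n n (\<lambda>(i, j). a g i j)" for g
  have mult: "a (g + h) i j = (\<Sum>k<n. a g i k * a h k j)" if gh: "g \<in> H" "h \<in> H" and ij: "i < n" "j < n" for g h i j
  proof (rule uniq[of "\<lambda>i. a (g + h) i j" "\<lambda>i. \<Sum>k<n. a g i k * a h k j"])
    fix x assume x: "x \<in> H"
    have "(\<Sum>i<n. a (g + h) i j * (bs ! i) x) = (bs ! j) (x + g + h)"
      using a[OF subgp_add[OF H gh] ij(2) x] by (simp add: add.assoc)
    also have "\<dots> = (\<Sum>k<n. a h k j * (bs ! k) (x + g))" by (rule a[OF gh(2) ij(2) subgp_add[OF H x gh(1)]])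
    also have "\<dots> = (\<Sum>k<n. a h k j * (\<Sum>i<n. a g i k * (bs ! i) x))"
      using a[OF gh(1) _ x] by (intro sum.cong) auto
    also have "\<dots> = (\<Sum>i<n. (\<Sum>k<n. a g i k * a h k j) * (bs ! i) x)"
      by (simp add: sum_distrib_left sum_distrib_right mult_ac) (rule sum.swap)
    finally show "(\<Sum>i<n. a (g + h) i j * (bs ! i) x) = (\<Sum>i<n. (\<Sum>k<n. a g i k * a h k j) * (bs ! i) x)" .
  qed (rule ij(1))
  have zero: "a 0 i j = (if i = j then 1 else 0)" if ij: "i < n" "j < n" for i j
  proof (rule uniq[of "\<lambda>i. a 0 i j" "\<lambda>i. if i = j then 1 else 0"])
    fix x assume x: "x \<in> H"
    have "(\<Sum>i<n. a 0 i j * (bs ! i) x) = (bs ! j) x" using a[OF subgp_zero[OF H] ij(2) x] by simp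
    also have "\<dots> = (\<Sum>i<n. (if i = j then 1 else 0) * (bs ! i) x)"
      using ij(2) by (simp add: if_distrib[of "\<lambda>c. c * _"] cong: if_cong)
    finally show "(\<Sum>i<n. a 0 i j * (bs ! i) x) = (\<Sum>i<n. (if i = j then 1 else 0) * (bs ! i) x)" .
  qed (rule ij(1))
  have "inj_on A H"
  proof (rule inj_onI)
    fix g h assume gh: "g \<in> H" "h \<in> H" "A g = A h"
    have agh: "a g i j = a h i j" if "i < n" "j < n" for i j
      using arg_cong[OF gh(3), of "\<lambda>M. M $$ (i, j)"] that by (simp add: A_def)
    have b: "(bs ! j) (x + g) = (bs ! j) (x + h)" if "j < n" "x \<in> H" for j x
      unfolding a[OF gh(1) that] a[OF gh(2) that] using agh that(1) by (intro sum.cong) auto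
    have f: "f (x + g) = f (x + h)" if "f \<in> Q" "x \<in> H" for f x
      using b that(2) co[OF that(1)] subgp_add[OF H that(2)] gh(1,2) by simp
    \<comment> \<open>Equal matrices mean that \<open>- h + g\<close> fixes every function of
      \<open>Q\<close> on \<open>H\<close>, against faithfulness.\<close>
    have "- h + g = 0"
    proof (rule ccontr)
      assume "- h + g \<noteq> 0"
      moreover have "- h + g \<in> H" using gh(1,2) subgp_add[OF H] subgp_minus[OF H] by blast
      ultimately obtain F x where F: "F \<in> Q" "x \<in> H" "F (x + (- h + g)) \<noteq> F x"
        using Qf unfolding faithful_def by blast
      have "F (x + - h + g) = F (x + - h + h)"
        using gh(2) F(2) by (intro f[OF F(1)] subgp_add[OF H] subgp_minus[OF H])
      moreover have "x + - h + h = x" by simp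
      ultimately show False using F(3) by (simp only: add.assoc)
    qed
    then have "h + (- h + g) = h" by simp
    then show "g = h" by simp
  qed
  moreover have "A g \<in> carrier_mat n n" for g by (simp add: A_def)
  moreover have "A (g + h) = A g * A h" if "g \<in> H" "h \<in> H" for g h
    by (rule eq_matI) (simp_all add: A_def mult[OF that] scalar_prod_def atLeast0LessThan)
  moreover have "A 0 = 1\<^sub>m n" by (rule eq_matI) (simp_all add: A_def zero)
  ultimately show ?thesis using that[OF n, of A] by blast
qed

text \<open>Cayley's theorem provides a type of class \<open>group_add\<close> that contains a copy of any group whose
  elements have type \<open>'a\<close>.\<close>

typedef 'a sym = "{f :: 'a \<Rightarrow> 'a. bij f}"
  by (rule exI[of _ id]) simp

setup_lifting type_definition_sym

instantiation sym :: (type) group_add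
begin

lift_definition zero_sym :: "'a sym" is id by simp
lift_definition plus_sym :: "'a sym \<Rightarrow> 'a sym \<Rightarrow> 'a sym" is "(\<circ>)" by (rule bij_comp)
lift_definition uminus_sym :: "'a sym \<Rightarrow> 'a sym" is "inv_into UNIV" by (rule bij_imp_bij_inv)
definition minus_sym :: "'a sym \<Rightarrow> 'a sym \<Rightarrow> 'a sym" where "minus_sym f g = f + - g"

instance
proof
  fix f g h :: "'a sym"
  show "f + g + h = f + (g + h)" by transfer (simp add: comp_assoc)
  show "0 + f = f" "f + 0 = f" by (transfer, simp)+
  show "- f + f = 0" by transfer (simp add: bij_is_inj)
  show "f + - g = f - g" by (simp add: minus_sym_def)
qed

end

text \<open>The identity off the carrier, so that a group element becomes a permutation of the whole
  type.\<close>

definition left_mult :: "('a, 'b) monoid_scheme \<Rightarrow> 'a \<Rightarrow> 'a \<Rightarrow> 'a" where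
  "left_mult G g x = (if x \<in> carrier G then g \<otimes>\<^bsub>G\<^esub> x else x)"

definition cayley :: "('a, 'b) monoid_scheme \<Rightarrow> 'a \<Rightarrow> 'a sym" where
  "cayley G g = Abs_sym (left_mult G g)"

lemma cayley_embedding:
  assumes "group G"
  shows "embedded_group G (cayley G)"
proof -
  interpret group G by fact
  have mult: "left_mult G (g \<otimes>\<^bsub>G\<^esub> h) = left_mult G g \<circ> left_mult G h"
    if "g \<in> carrier G" "h \<in> carrier G" for g h
    using that by (auto simp: left_mult_def fun_eq_iff m_assoc)
  have one: "left_mult G \<one>\<^bsub>G\<^esub> = id" by (auto simp: left_mult_def fun_eq_iff)
  have bij: "bij (left_mult G g)" if g: "g \<in> carrier G" for g
  proof (rule o_bij)
    show "left_mult G (inv\<^bsub>G\<^esub> g) \<circ> left_mult G g = id" using mult[of "inv\<^bsub>G\<^esub> g" g] g one by simp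
    show "left_mult G g \<circ> left_mult G (inv\<^bsub>G\<^esub> g) = id" using mult[of g "inv\<^bsub>G\<^esub> g"] g one by simp
  qed
  have Rep: "Rep_sym (cayley G g) = left_mult G g" if "g \<in> carrier G" for g
    using bij[OF that] by (simp add: cayley_def Abs_sym_inverse)
  show ?thesis
  proof
    show "cayley G (x \<otimes>\<^bsub>G\<^esub> y) = cayley G x + cayley G y" if "x \<in> carrier G" "y \<in> carrier G" for x y
      using that by (simp add: Rep_sym_inject[symmetric] plus_sym.rep_eq Rep mult)
    show "inj_on (cayley G) (carrier G)"
    proof (rule inj_onI)
      fix x y assume xy: "x \<in> carrier G" "y \<in> carrier G" "cayley G x = cayley G y"
      then have "left_mult G x \<one>\<^bsub>G\<^esub> = left_mult G y \<one>\<^bsub>G\<^esub>" using Rep by metis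
      then show "x = y" using xy(1,2) by (simp add: left_mult_def)
    qed
  qed
qed

context embedded_group
begin

lemma embeds_in_GL_int:
  assumes Q: "rep_module (\<phi> ` carrier G) Q"
  shows "\<exists>n\<ge>1. \<exists>h. h \<in> mon G (GL_int n)"
proof -
  let ?H = "\<phi> ` carrier G"
  have H: "subgp ?H" by (rule subgp_image[OF subgroup_self])
  obtain n and A :: "_ \<Rightarrow> int mat" where n: "n \<ge> 1" and A: "\<And>g. A g \<in> carrier_mat n n"
    "\<And>g h. g \<in> ?H \<Longrightarrow> h \<in> ?H \<Longrightarrow> A (g + h) = A g * A h" "A 0 = 1\<^sub>m n" "inj_on A ?H"
    by (rule rep_module_matrices[OF H Q]) (rule that)
  have unit: "A g \<in> carrier (GL_int n)" if g: "g \<in> ?H" for g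
  proof -
    have "A (- g) * A g = 1\<^sub>m n" "A g * A (- g) = 1\<^sub>m n"
      using A(2)[OF subgp_minus[OF H g] g] A(2)[OF g subgp_minus[OF H g]] A(3) by simp_all
    then show ?thesis using A(1)
      by (auto simp: GL_int_def units_of_def Units_def ring_mat_simps)
  qed
  have "(\<lambda>x. A (\<phi> x)) \<in> hom G (GL_int n)"
  proof (rule homI)
    show "A (\<phi> x) \<in> carrier (GL_int n)" if "x \<in> carrier G" for x using that by (intro unit) blast
    show "A (\<phi> (x \<otimes> y)) = A (\<phi> x) \<otimes>\<^bsub>GL_int n\<^esub> A (\<phi> y)" if "x \<in> carrier G" "y \<in> carrier G" for x y
      using that A(2)[of "\<phi> x" "\<phi> y"] by (simp add: hom GL_int_def units_of_def ring_mat_simps)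
  qed
  moreover have "inj_on (\<lambda>x. A (\<phi> x)) (carrier G)"
    using comp_inj_on[OF inj A(4)] by (simp add: comp_def)
  ultimately show ?thesis using n unfolding mon_def by blast
qed

end

theorem theorem8p3:
  fixes G :: "('a, 'b) monoid_scheme"
  assumes "group G" and "generalized_radical G" and "noetherian_group G"
  shows "polycyclic_by_finite_group G \<and> (\<exists>n\<ge>1. \<exists>h. h \<in> mon G (GL_int n))"
proof
  interpret embedded_group G "cayley G" by (rule cayley_embedding[OF assms(1)])
  have pcf: "pcf (cayley G ` carrier G)" by (rule generalized_radical_pcf[OF assms(3,2)])
  show "polycyclic_by_finite_group G" by (rule polycyclic_by_finite[OF assms(3) pcf])
  obtain Q where "rep_module (cayley G ` carrier G) Q"
    using pcf_rep_module[OF noeth_image[OF assms(3)] pcf subset_refl] by blast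
  then show "\<exists>n\<ge>1. \<exists>h. h \<in> mon G (GL_int n)" by (rule embeds_in_GL_int)
qed

end
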